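(* Let $q\in(0,1)$, $A=\mathcal{O}(S^{2n-1}_q)$, $B=\mathcal{O}(\mathbb{C}P^{n-1}_q)$, $H=\mathbb{C}[u,u^{-1}]$, and let $\mathcal{C}(A,H)$ be the Ehresmann–Schauenburg bialgebroid of the $H$-Hopf–Galois extension $B\subseteq A$, with algebra generators $$V_{ij}=z_i^*\otimes z_j,\qquad W_{ij}=q^{2n-i-j}z_i\otimes z_j^*,\qquad 1\le i,j\le n.$$ Define on the generators the map $$\underline{S}:\ V_{ij}\longmapsto q^{\,j-i}W_{ji},\qquad W_{ij}\longmapsto q^{\,i-j}V_{ji}.$$ Then (extended as an anti-algebra morphism) this is an antipode of $\mathcal{C}(A,H)$, with inverse given by $$\underline{S}^{-1}:\ V_{ij}\longmapsto q^{\,i-j}W_{ji},\qquad W_{ij}\longmapsto q^{\,j-i}V_{ji}.$$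
   Context: All algebras are unital over $\mathbb{C}$, $\otimes=\otimes_{\mathbb{C}}$. Sweedler-type notations and expressions such as $a\otimes\tilde a$ denote sums. **The extension.** $\mathcal{O}(S^{2n-1}_q)$ is the $*$-algebra generated by $z_i,z_i^*$, $i=1,\dots,n$, with relations $z_iz_j=qz_jz_i$ for $i<j$; $z_i^*z_j=qz_jz_i^*$ for $i\ne j$; $[z_1^*,z_1]=0$; $[z_k^*,z_k]=(1-q^2)\sum_{j=1}^{k-1}z_jz_j^*$ for $1<k\le n$; $\sum_{j=1}^nz_jz_j^*=1$ (equivalently $\sum_{j=1}^nq^{2(n-j)}z_j^*z_j=1$). $H=\mathcal{O}(U(1))=\mathbb{C}[u,u^{-1}]$ is the Hopf algebra of Laurent polynomials with $\Delta(u^{\pm1})=u^{\pm1}\otimes u^{\pm1}$, $\epsilon(u^{\pm1})=1$, $S(u^{\pm1})=u^{\mp1}$. The right coaction $\rho:A\to A\otimes H$, $\rho(a)=a_{(0)}\otimes a_{(1)}$, is the algebra morphism with $z_i\mapsto z_i\otimes u$, $z_i^*\mapsto z_i^*\otimes u^{-1}$. The subalgebra of coaction invariants $\{a\mid\rho(a)=a\otimes1\}$ is $B=\mathcal{O}(\mathbb{C}P^{n-1}_q)$, the $*$-subalgebra generated by the elements $z_i^*z_j$. The canonical map $\chi:A\otimes_BA\to A\otimes H$, $a\otimes_B\tilde a\mapsto a\tilde a_{(0)}\otimes\tilde a_{(1)}$, is bijective and $A$ is faithfully flat over $B$; the translation map $\tau(h)=\chi^{-1}(1_A\otimes h)=h^{\langle1\rangle}\otimes_Bh^{\langle2\rangle}$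 satisfies $\tau(u)=\sum_jq^{2(n-j)}z_j^*\otimes_Bz_j$ and $\tau(u^{-1})=\sum_jz_j\otimes_Bz_j^*$. **Ehresmann–Schauenburg bialgebroid.** $\mathcal{C}(A,H)=(A\otimes A)^{coH}=\{a\otimes\tilde a\in A\otimes A\mid a_{(0)}\otimes\tilde a_{(0)}\otimes a_{(1)}\tilde a_{(1)}=a\otimes\tilde a\otimes1_H\}$, a subalgebra of $A\otimes A^{op}$: $(a\otimes\tilde a)(c\otimes\tilde c)=ac\otimes\tilde c\tilde a$. It is a left $B$-bialgebroid with source $s(b)=b\otimes1_A$, target $t(b)=1_A\otimes b$, $B$-bimodule structure $b\,h\,b'=s(b)t(b')h$, tensor product $\mathcal{C}(A,H)\otimes_B\mathcal{C}(A,H)$ equal to the quotient of $\mathcal{C}(A,H)\otimes\mathcal{C}(A,H)$ by the span of all $t(b)h\otimes h'-h\otimes s(b)h'$, coproduct $\underline{\Delta}(a\otimes\tilde a)=a_{(0)}\otimes a_{(1)}{}^{\langle1\rangle}\otimes_Ba_{(1)}{}^{\langle2\rangle}\otimes\tilde a$ and counit $\underline{\epsilon}(a\otimes\tilde a)=a\tilde a$. On the generators, $\underline{\Delta}(V_{ij})=\sum_kV_{ik}\otimes_BV_{kj}$, $\underline{\Delta}(W_{ij})=\sum_kW_{ik}\otimes_BW_{kj}$, $\underline{\epsilon}(V_{ij})=z_i^*z_j$, $\underline{\epsilon}(W_{ij})=q^{2n-i-j}z_iz_j^*$. **Antipode.** An antipode for a left $B$-bialgebroid $(\mathcal{H},s,t,\underline{\Delta},\underline{\epsilon})$,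 with $\underline{\Delta}(h)=h_{(1)}\otimes_Bh_{(2)}$, is a bijective anti-algebra morphism $\underline{S}:\mathcal{H}\to\mathcal{H}$ with $\underline{S}\circ t=s$ and, for all $h\in\mathcal{H}$, $$\underline{S}(h_{(1)})_{(1')}h_{(2)}\otimes_B\underline{S}(h_{(1)})_{(2')}=1_{\mathcal{H}}\otimes_B\underline{S}(h),\qquad \underline{S}^{-1}(h_{(2)})_{(1')}\otimes_B\underline{S}^{-1}(h_{(2)})_{(2')}h_{(1)}=\underline{S}^{-1}(h)\otimes_B1_{\mathcal{H}},$$ where primed indices denote a further application of $\underline{\Delta}$. *)

theory Defs
  imports
    Complex_Main
    "HOL-Algebra.QuotRing"
    "HOL-Algebra.Module"
    "HOL-Library.Poly_Mapping"
begin

section \<open>Vector spaces and algebras over the complex numbers\<close>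

text \<open>
  Complex vector spaces and (noncommutative) algebras are \<^typ>\<open>(complex, 'a) module\<close> records of
  HOL-Algebra.  For a mere vector space the fields \<open>mult\<close> and \<open>one\<close> carry no information.
\<close>

definition fscale :: "complex \<Rightarrow> ('k \<Rightarrow>\<^sub>0 complex) \<Rightarrow> ('k \<Rightarrow>\<^sub>0 complex)" where
  "fscale c p = Poly_Mapping.map ((*) c) p"

lemma lookup_fscale: "Poly_Mapping.lookup (fscale c p) k = c * Poly_Mapping.lookup p k"
  by (simp add: fscale_def Poly_Mapping.map.rep_eq when_def)

global_interpretation fvs: vector_space "fscale :: complex \<Rightarrow> ('k \<Rightarrow>\<^sub>0 complex) \<Rightarrow> _"
  by unfold_locales
    (auto intro!: poly_mapping_eqI simp: lookup_fscale lookup_add algebra_simps)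

text \<open>The vector space with basis \<open>X\<close>.\<close>

definition free_vs :: "'k set \<Rightarrow> (complex, 'k \<Rightarrow>\<^sub>0 complex) module" where
  "free_vs X = \<lparr>carrier = {p. Poly_Mapping.keys p \<subseteq> X}, mult = undefined, one = undefined,
     zero = 0, add = (+), smult = fscale\<rparr>"

text \<open>
  Quotient of \<open>R\<close> by \<open>I\<close>, with cosets as elements: this is \<open>R Quot I\<close> together with the induced
  scalar multiplication.
\<close>

definition quot :: "(complex, 'a) module \<Rightarrow> 'a set \<Rightarrow> (complex, 'a set) module" where
  "quot R I = \<lparr>carrier = a_rcosets\<^bsub>R\<^esub> I, mult = rcoset_mult R I, one = I +>\<^bsub>R\<^esub> \<one>\<^bsub>R\<^esub>,
     zero = I, add = set_add R, smult = (\<lambda>c X. \<Union>x\<in>X. I +>\<^bsub>R\<^esub> (c \<odot>\<^bsub>R\<^esub> x))\<rparr>"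

definition opp :: "(complex, 'a) module \<Rightarrow> (complex, 'a) module" where
  "opp A = A\<lparr>mult := \<lambda>x y. y \<otimes>\<^bsub>A\<^esub> x\<rparr>"

definition alg_hom :: "(complex, 'a) module \<Rightarrow> (complex, 'b) module \<Rightarrow> ('a \<Rightarrow> 'b) set" where
  "alg_hom A B = {f \<in> ring_hom A B. \<forall>c. \<forall>x\<in>carrier A. f (c \<odot>\<^bsub>A\<^esub> x) = c \<odot>\<^bsub>B\<^esub> f x}"

definition anti_alg_hom :: "(complex, 'a) module \<Rightarrow> (complex, 'b) module \<Rightarrow> ('a \<Rightarrow> 'b) set" where
  "anti_alg_hom A B = alg_hom A (opp B)"

inductive_set alg_span :: "(complex, 'a) module \<Rightarrow> 'a set \<Rightarrow> 'a set"
  for A :: "(complex, 'a) module" and X :: "'a set" where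
  one: "\<one>\<^bsub>A\<^esub> \<in> alg_span A X"
| incl: "x \<in> X \<Longrightarrow> x \<in> alg_span A X"
| add: "x \<in> alg_span A X \<Longrightarrow> y \<in> alg_span A X \<Longrightarrow> x \<oplus>\<^bsub>A\<^esub> y \<in> alg_span A X"
| smult: "x \<in> alg_span A X \<Longrightarrow> c \<odot>\<^bsub>A\<^esub> x \<in> alg_span A X"
| mult: "x \<in> alg_span A X \<Longrightarrow> y \<in> alg_span A X \<Longrightarrow> x \<otimes>\<^bsub>A\<^esub> y \<in> alg_span A X"


section \<open>Tensor products\<close>

definition bilin_rel ::
  "(complex, 'a) module \<Rightarrow> (complex, 'b) module \<Rightarrow> ('a \<times> 'b \<Rightarrow>\<^sub>0 complex) set" where
  "bilin_rel M N =
     {Poly_Mapping.single (x \<oplus>\<^bsub>M\<^esub> x', y) 1 - Poly_Mapping.single (x, y) 1 - Poly_Mapping.single (x', y) 1 | x x' y.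
        x \<in> carrier M \<and> x' \<in> carrier M \<and> y \<in> carrier N}
   \<union> {Poly_Mapping.single (x, y \<oplus>\<^bsub>N\<^esub> y') 1 - Poly_Mapping.single (x, y) 1 - Poly_Mapping.single (x, y') 1 | x y y'.
        x \<in> carrier M \<and> y \<in> carrier N \<and> y' \<in> carrier N}
   \<union> {Poly_Mapping.single (c \<odot>\<^bsub>M\<^esub> x, y) 1 - Poly_Mapping.single (x, y) c | c x y. x \<in> carrier M \<and> y \<in> carrier N}
   \<union> {Poly_Mapping.single (x, c \<odot>\<^bsub>N\<^esub> y) 1 - Poly_Mapping.single (x, y) c | c x y. x \<in> carrier M \<and> y \<in> carrier N}"

text \<open>
  The quotient of \<open>M \<otimes> N\<close> by the span of the images of the additional relations \<open>Rel\<close>, and the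
  class of \<open>x \<otimes> y\<close> in it.
\<close>

definition tensor_null where
  "tensor_null M N Rel = fvs.span (bilin_rel M N \<union> Rel)"

definition tensor ::
  "(complex, 'a) module \<Rightarrow> (complex, 'b) module \<Rightarrow> ('a \<times> 'b \<Rightarrow>\<^sub>0 complex) set
   \<Rightarrow> (complex, ('a \<times> 'b \<Rightarrow>\<^sub>0 complex) set) module" where
  "tensor M N Rel = quot (free_vs (carrier M \<times> carrier N)) (tensor_null M N Rel)"

definition pure ::
  "(complex, 'a) module \<Rightarrow> (complex, 'b) module \<Rightarrow> ('a \<times> 'b \<Rightarrow>\<^sub>0 complex) set
   \<Rightarrow> 'a \<Rightarrow> 'b \<Rightarrow> ('a \<times> 'b \<Rightarrow>\<^sub>0 complex) set" where
  "pure M N Rel x y =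
     tensor_null M N Rel +>\<^bsub>free_vs (carrier M \<times> carrier N)\<^esub> Poly_Mapping.single (x, y) 1"

abbreviation "tens M N \<equiv> tensor M N {}"
abbreviation "tpure M N \<equiv> pure M N {}"

text \<open>
  \<open>sweedler Z f P\<close> is the element \<open>\<Sum> f x y\<close> of \<open>Z\<close> for \<open>P = \<Sum> x \<otimes> y\<close>, computed from some
  representative of \<open>P\<close>.  It is independent of that choice whenever \<open>f\<close> is bilinear and respects the
  relations of the tensor product in which \<open>P\<close> lives.
\<close>

definition sweedler ::
  "(complex, 'c) module \<Rightarrow> ('a \<Rightarrow> 'b \<Rightarrow> 'c) \<Rightarrow> ('a \<times> 'b \<Rightarrow>\<^sub>0 complex) set \<Rightarrow> 'c" where
  "sweedler Z f P = (let p = (SOME p. p \<in> P) in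
     \<Oplus>\<^bsub>Z\<^esub>k\<in>Poly_Mapping.keys p. Poly_Mapping.lookup p k \<odot>\<^bsub>Z\<^esub> f (fst k) (snd k))"

definition tens_alg ::
  "(complex, 'a) module \<Rightarrow> (complex, 'b) module \<Rightarrow> (complex, ('a \<times> 'b \<Rightarrow>\<^sub>0 complex) set) module" where
  "tens_alg A B = (tens A B)\<lparr>
     mult := \<lambda>P Q. sweedler (tens A B) (\<lambda>a b. sweedler (tens A B) (\<lambda>a' b'.
               tpure A B (a \<otimes>\<^bsub>A\<^esub> a') (b \<otimes>\<^bsub>B\<^esub> b')) Q) P,
     one := tpure A B \<one>\<^bsub>A\<^esub> \<one>\<^bsub>B\<^esub>\<rparr>"

text \<open>
  Relations defining \<open>M \<otimes>\<^sub>B N\<close> for a right action \<open>ra\<close> of \<open>B\<close> on \<open>M\<close> and a left action \<open>la\<close> of \<open>B\<close>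
  on \<open>N\<close>.
\<close>

definition bal_rel ::
  "(complex, 'b) module \<Rightarrow> ('m \<Rightarrow> 'b \<Rightarrow> 'm) \<Rightarrow> ('b \<Rightarrow> 'n \<Rightarrow> 'n)
   \<Rightarrow> (complex, 'm) module \<Rightarrow> (complex, 'n) module \<Rightarrow> ('m \<times> 'n \<Rightarrow>\<^sub>0 complex) set" where
  "bal_rel B ra la M N =
     {Poly_Mapping.single (ra x b, y) 1 - Poly_Mapping.single (x, la b y) 1 | x b y.
        x \<in> carrier M \<and> b \<in> carrier B \<and> y \<in> carrier N}"


section \<open>Antipodes of left bialgebroids\<close>

record ('b, 'h) bialgebroid =
  b_base :: "(complex, 'b) module"
  b_total :: "(complex, 'h) module"
  b_src :: "'b \<Rightarrow> 'h"
  b_tgt :: "'b \<Rightarrow> 'h"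
  b_coprod :: "'h \<Rightarrow> ('h \<times> 'h \<Rightarrow>\<^sub>0 complex) set"
  b_counit :: "'h \<Rightarrow> 'b"

text \<open>Balancing for the \<open>B\<close>-bimodule structure \<open>b h b' = s(b) t(b') h\<close>.\<close>

definition st_rel ::
  "(complex, 'b) module \<Rightarrow> (complex, 'h) module \<Rightarrow> ('b \<Rightarrow> 'h) \<Rightarrow> ('b \<Rightarrow> 'h)
   \<Rightarrow> ('h \<times> 'h \<Rightarrow>\<^sub>0 complex) set" where
  "st_rel B H s t = bal_rel B (\<lambda>h b. t b \<otimes>\<^bsub>H\<^esub> h) (\<lambda>b h. s b \<otimes>\<^bsub>H\<^esub> h) H H"

definition btensor where
  "btensor D = tensor (b_total D) (b_total D) (st_rel (b_base D) (b_total D) (b_src D) (b_tgt D))"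

definition bpure where
  "bpure D = pure (b_total D) (b_total D) (st_rel (b_base D) (b_total D) (b_src D) (b_tgt D))"

text \<open>
  \<open>T\<close> is the inverse of \<open>S\<close>.  The other conditions make the two outer maps well defined on the
  balanced tensor product when \<open>D\<close> is a left bialgebroid.
\<close>

definition is_antipode :: "('b, 'h) bialgebroid \<Rightarrow> ('h \<Rightarrow> 'h) \<Rightarrow> bool" where
  "is_antipode D S \<longleftrightarrow>
     (let H = b_total D; T = inv_into (carrier H) S in
       bij_betw S (carrier H) (carrier H) \<and>
       S \<in> anti_alg_hom H H \<and>
       (\<forall>b\<in>carrier (b_base D). S (b_tgt D b) = b_src D b) \<and>
       (\<forall>h\<in>carrier H.
          sweedler (btensor D) (\<lambda>h1 h2. sweedler (btensor D) (\<lambda>x y. bpure D (x \<otimes>\<^bsub>H\<^esub> h2) y)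
              (b_coprod D (S h1))) (b_coprod D h)
          = bpure D \<one>\<^bsub>H\<^esub> (S h)) \<and>
       (\<forall>h\<in>carrier H.
          sweedler (btensor D) (\<lambda>h1 h2. sweedler (btensor D) (\<lambda>x y. bpure D x (y \<otimes>\<^bsub>H\<^esub> h1))
              (b_coprod D (T h2))) (b_coprod D h)
          = bpure D (T h) \<one>\<^bsub>H\<^esub>))"


section \<open>The Ehresmann--Schauenburg bialgebroid of a Hopf--Galois extension\<close>

text \<open>
  Throughout, \<open>rho : A \<rightarrow> A \<otimes> H\<close> is a right coaction.  Bijectivity of the canonical map, proved or
  assumed where the construction is used, makes the inverse in \<open>transl\<close> meaningful.
\<close>

definition coinv where
  "coinv A H rho = A\<lparr>carrier := {a \<in> carrier A. rho a = tpure A H a \<one>\<^bsub>H\<^esub>}\<rparr>"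

definition can_rel where
  "can_rel A H rho = bal_rel (coinv A H rho) (mult A) (mult A) A A"

definition can_map where
  "can_map A H rho P = sweedler (tens A H) (\<lambda>a a'. sweedler (tens A H) (\<lambda>a0' a1'.
     tpure A H (a \<otimes>\<^bsub>A\<^esub> a0') a1') (rho a')) P"

definition transl where
  "transl A H rho h =
     inv_into (carrier (tensor A A (can_rel A H rho))) (can_map A H rho) (tpure A H \<one>\<^bsub>A\<^esub> h)"

definition env_alg where
  "env_alg A = tens_alg A (opp A)"

text \<open>
  The pure tensors of \<open>A \<otimes> A\<^sup>o\<^sup>p\<close> and of \<open>A \<otimes> A\<close> coincide, since the tensor product of vector spaces
  does not involve the multiplication.
\<close>

definition es_alg where
  "es_alg A H rho = (env_alg A)\<lparr>carrier := {P \<in> carrier (env_alg A).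
     sweedler (tens A (tens A H)) (\<lambda>a a'.
       sweedler (tens A (tens A H)) (\<lambda>a0 a1.
         sweedler (tens A (tens A H)) (\<lambda>a0' a1'.
           tpure A (tens A H) a0 (tpure A H a0' (a1 \<otimes>\<^bsub>H\<^esub> a1'))) (rho a')) (rho a)) P
     = sweedler (tens A (tens A H)) (\<lambda>a a'. tpure A (tens A H) a (tpure A H a' \<one>\<^bsub>H\<^esub>)) P}\<rparr>"

definition es_src where
  "es_src A b = tpure A A b \<one>\<^bsub>A\<^esub>"

definition es_tgt where
  "es_tgt A b = tpure A A \<one>\<^bsub>A\<^esub> b"

text \<open>
  The formula \<open>a\<^sub>0 \<otimes> a\<^sub>1\<^sup>\<langle>1\<^sup>\<rangle> \<otimes>\<^sub>B a\<^sub>1\<^sup>\<langle>2\<^sup>\<rangle> \<otimes> a'\<close> produces an element of \<open>(A \<otimes> A) \<otimes>\<^sub>B (A \<otimes> A)\<close>; the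
  coproduct is the unique element of \<open>C \<otimes>\<^sub>B C\<close>, for \<open>C\<close> the coinvariants of \<open>A \<otimes> A\<close>, which the map
  induced by the inclusion of \<open>C\<close> sends to it.
\<close>

definition es_big_rel where
  "es_big_rel A H rho = st_rel (coinv A H rho) (env_alg A) (es_src A) (es_tgt A)"

definition es_big where
  "es_big A H rho = tensor (env_alg A) (env_alg A) (es_big_rel A H rho)"

definition es_big_pure where
  "es_big_pure A H rho = pure (env_alg A) (env_alg A) (es_big_rel A H rho)"

definition es_coprod_big where
  "es_coprod_big A H rho P =
     sweedler (es_big A H rho) (\<lambda>a a'.
       sweedler (es_big A H rho) (\<lambda>a0 a1.
         sweedler (es_big A H rho) (\<lambda>x y.
           es_big_pure A H rho (tpure A A a0 x) (tpure A A y a'))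
         (transl A H rho a1)) (rho a)) P"

definition es_coprod where
  "es_coprod A H rho P = (THE Q.
     Q \<in> carrier (tensor (es_alg A H rho) (es_alg A H rho)
           (st_rel (coinv A H rho) (es_alg A H rho) (es_src A) (es_tgt A))) \<and>
     sweedler (es_big A H rho) (es_big_pure A H rho) Q = es_coprod_big A H rho P)"

definition es_counit where
  "es_counit A P = sweedler A (\<lambda>a a'. a \<otimes>\<^bsub>A\<^esub> a') P"

definition es_bialgebroid where
  "es_bialgebroid A H rho = \<lparr>b_base = coinv A H rho, b_total = es_alg A H rho,
     b_src = es_src A, b_tgt = es_tgt A, b_coprod = es_coprod A H rho, b_counit = es_counit A\<rparr>"


section \<open>The quantum sphere\<close>

datatype letter = Gen nat | GenStar nat

datatype word = Word (letters: "letter list")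

instantiation word :: monoid_add
begin
definition zero_word :: word where "0 = Word []"
definition plus_word :: "word \<Rightarrow> word \<Rightarrow> word" where "u + v = Word (letters u @ letters v)"
instance
  by standard (auto simp: zero_word_def plus_word_def)
end

text \<open>
  With words added by concatenation, the product of \<^typ>\<open>word \<Rightarrow>\<^sub>0 complex\<close> is that of the free
  algebra.
\<close>

definition free_alg :: "nat \<Rightarrow> (complex, word \<Rightarrow>\<^sub>0 complex) module" where
  "free_alg n = (free_vs {w. set (letters w) \<subseteq> Gen ` {1..n} \<union> GenStar ` {1..n}})
     \<lparr>mult := (*), one := 1\<rparr>"

fun letter_star :: "letter \<Rightarrow> letter" where
  "letter_star (Gen i) = GenStar i"
| "letter_star (GenStar i) = Gen i"

definition word_star :: "word \<Rightarrow> word" where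
  "word_star w = Word (rev (map letter_star (letters w)))"

text \<open>The antilinear extension of \<^const>\<open>word_star\<close>, which is an involution on words.\<close>

definition free_star :: "(word \<Rightarrow>\<^sub>0 complex) \<Rightarrow> (word \<Rightarrow>\<^sub>0 complex)" where
  "free_star p = Poly_Mapping.map cnj (Poly_Mapping.map_key word_star p)"

definition zf :: "nat \<Rightarrow> word \<Rightarrow>\<^sub>0 complex" where "zf i = Poly_Mapping.single (Word [Gen i]) 1"
definition zsf :: "nat \<Rightarrow> word \<Rightarrow>\<^sub>0 complex" where "zsf i = Poly_Mapping.single (Word [GenStar i]) 1"

definition sphere_rels :: "nat \<Rightarrow> real \<Rightarrow> (word \<Rightarrow>\<^sub>0 complex) set" where
  "sphere_rels n q =
     {zf i * zf j - fscale (of_real q) (zf j * zf i) | i j. 1 \<le> i \<and> i < j \<and> j \<le> n}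
   \<union> {zsf i * zf j - fscale (of_real q) (zf j * zsf i) | i j.
        i \<in> {1..n} \<and> j \<in> {1..n} \<and> i \<noteq> j}
   \<union> {zsf 1 * zf 1 - zf 1 * zsf 1}
   \<union> {(zsf k * zf k - zf k * zsf k)
        - fscale (of_real (1 - q\<^sup>2)) (\<Sum>j=1..k-1. zf j * zsf j) | k. 1 < k \<and> k \<le> n}
   \<union> {(\<Sum>j=1..n. zf j * zsf j) - 1}"

text \<open>A presentation as a \<open>*\<close>-algebra also imposes the adjoints of the relations.\<close>

definition sphere_ideal :: "nat \<Rightarrow> real \<Rightarrow> (word \<Rightarrow>\<^sub>0 complex) set" where
  "sphere_ideal n q =
     genideal (free_alg n) (sphere_rels n q \<union> free_star ` sphere_rels n q)"

definition qsphere :: "nat \<Rightarrow> real \<Rightarrow> (complex, (word \<Rightarrow>\<^sub>0 complex) set) module" where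
  "qsphere n q = quot (free_alg n) (sphere_ideal n q)"

definition qs_z :: "nat \<Rightarrow> real \<Rightarrow> nat \<Rightarrow> (word \<Rightarrow>\<^sub>0 complex) set" where
  "qs_z n q i = sphere_ideal n q +>\<^bsub>free_alg n\<^esub> zf i"

definition qs_zs :: "nat \<Rightarrow> real \<Rightarrow> nat \<Rightarrow> (word \<Rightarrow>\<^sub>0 complex) set" where
  "qs_zs n q i = sphere_ideal n q +>\<^bsub>free_alg n\<^esub> zsf i"

text \<open>
  The Laurent polynomials, as the group algebra of the integers: \<open>u\<close> is \<open>single 1 1\<close> and its
  inverse is \<open>single (- 1) 1\<close>.
\<close>

definition OU1 :: "(complex, int \<Rightarrow>\<^sub>0 complex) module" where
  "OU1 = (free_vs UNIV)\<lparr>mult := (*), one := 1\<rparr>"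

definition sphere_coaction ::
  "nat \<Rightarrow> real \<Rightarrow> (word \<Rightarrow>\<^sub>0 complex) set
   \<Rightarrow> ((word \<Rightarrow>\<^sub>0 complex) set \<times> (int \<Rightarrow>\<^sub>0 complex) \<Rightarrow>\<^sub>0 complex) set" where
  "sphere_coaction n q = (THE rho.
     rho \<in> extensional (carrier (qsphere n q)) \<and>
     rho \<in> alg_hom (qsphere n q) (tens_alg (qsphere n q) OU1) \<and>
     (\<forall>i\<in>{1..n}. rho (qs_z n q i) = tpure (qsphere n q) OU1 (qs_z n q i) (Poly_Mapping.single 1 1) \<and>
                 rho (qs_zs n q i) = tpure (qsphere n q) OU1 (qs_zs n q i) (Poly_Mapping.single (- 1) 1)))"

definition sphere_bialgebroid where
  "sphere_bialgebroid n q = es_bialgebroid (qsphere n q) OU1 (sphere_coaction n q)"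

abbreviation "sphere_C n q \<equiv> b_total (sphere_bialgebroid n q)"

definition ES_V where
  "ES_V n q i j = tpure (qsphere n q) (qsphere n q) (qs_zs n q i) (qs_z n q j)"

definition ES_W where
  "ES_W n q i j = complex_of_real (q powi (2 * int n - int i - int j))
     \<odot>\<^bsub>sphere_C n q\<^esub> tpure (qsphere n q) (qsphere n q) (qs_z n q i) (qs_zs n q j)"

end

theory Submission
  imports Defs
begin

text \<open>
  The sphere algebra \<open>A\<close> is strongly graded by the integers: \<open>A\<^sub>k\<close> consists of the elements
  with coaction \<open>a \<mapsto> a \<otimes> u\<^sup>k\<close>, the coinvariants are \<open>B = A\<^sub>0\<close>, and the two sphere relations
  write \<open>1\<close> as a sum \<open>\<Sum> x y\<close> with \<open>x \<in> A\<^sub>-\<^sub>k\<close> and \<open>y \<in> A\<^sub>k\<close>, for \<open>k = 1, -1\<close> and hence for all \<open>k\<close>.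
  Such sums give the translation map \<open>\<tau>(u\<^sup>k) = \<Sum> x \<otimes>\<^sub>B y\<close>, so that on \<open>A\<^sub>k \<otimes> A\<^sub>-\<^sub>k\<close> the coproduct is
  \<open>a \<otimes> a' \<mapsto> \<Sum> (a \<otimes> x) \<otimes>\<^sub>B (y \<otimes> a')\<close>.  For every automorphism \<open>\<theta>\<close> of degree zero,
  \<open>S(a \<otimes> a') = a' \<otimes> \<theta>(a)\<close> is an antipode: in both axioms one moves an element of \<open>B\<close> such as
  \<open>a' x\<close> across the balanced tensor product and then uses \<open>\<Sum> x y = 1\<close>.  The statement is the case
  in which \<open>\<theta>\<close> multiplies \<open>z\<^sub>i\<close> by \<open>q\<^bsup>2i-2n\<^esup>\<close> and \<open>z\<^sub>i\<^sup>*\<close> by the inverse.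
\<close>

section \<open>Linear algebra over module records\<close>

text \<open>The obstacle is well-definedness. \<open>sweedler\<close> evaluates a formula on an
  arbitrarily chosen representative of a coset, and the antipode axioms nest such formulas. Each
  layer is therefore named and shown to be bilinear and compatible with the balancing; linearity
  then reduces every identity to homogeneous pure tensors, where sums over explicit decompositions
  of 1 can be manipulated. Two maps are given only indirectly. The translation map is an inverse
  image under the canonical map and is identified through the injectivity of that map. The coproduct
  is a unique preimage under the map from C \<otimes>_B C to (A \<otimes> A) \<otimes>_B (A
  \<otimes> A); an inclusion need not stay injective after tensoring over B, so a retraction is
  built from the projection onto total degree zero. That V and W generate C is a separate matter
  about pairs of words: inserting decompositions of 1 lets a pair of words of opposite degree be
  split into pairs of letters of opposite sign.\<close>

locale cvs = abelian_group M for M :: "(complex, 'a) module" (structure) +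
  assumes smult_closed [simp, intro]: "x \<in> carrier M \<Longrightarrow> c \<odot> x \<in> carrier M"
    and smult_l_distr: "x \<in> carrier M \<Longrightarrow> (a + b) \<odot> x = a \<odot> x \<oplus> b \<odot> x"
    and smult_r_distr: "\<lbrakk>x \<in> carrier M; y \<in> carrier M\<rbrakk> \<Longrightarrow> c \<odot> (x \<oplus> y) = c \<odot> x \<oplus> c \<odot> y"
    and smult_assoc1: "x \<in> carrier M \<Longrightarrow> (a * b) \<odot> x = a \<odot> (b \<odot> x)"
    and smult_one [simp]: "x \<in> carrier M \<Longrightarrow> 1 \<odot> x = x"
begin

lemma smult_zero_left [simp]: "x \<in> carrier M \<Longrightarrow> 0 \<odot> x = \<zero>"
  by (metis add.r_cancel_one' add_0 smult_closed smult_l_distr)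

lemma smult_zero_right [simp]: "c \<odot> \<zero> = \<zero>"
  by (metis add.r_cancel_one' l_zero smult_closed smult_r_distr zero_closed)

lemma smult_minus_one: "x \<in> carrier M \<Longrightarrow> (-1) \<odot> x = \<ominus> x"
proof -
  assume x: "x \<in> carrier M"
  have "(-1) \<odot> x \<oplus> x = (-1 + 1) \<odot> x"
    using x by (simp only: smult_l_distr smult_one)
  also have "\<dots> = \<zero>" using x by simp
  finally show ?thesis using x by (metis minus_equality smult_closed)
qed

lemma smult_commute: "x \<in> carrier M \<Longrightarrow> a \<odot> (b \<odot> x) = b \<odot> (a \<odot> x)"
  by (metis mult.commute smult_assoc1)

end

locale calg = cvs A + ring A for A :: "(complex, 'a) module" (structure) +
  assumes smult_assoc2: "\<lbrakk>x \<in> carrier A; y \<in> carrier A\<rbrakk> \<Longrightarrow> (c \<odot> x) \<otimes> y = c \<odot> (x \<otimes> y)"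
    and smult_assoc3: "\<lbrakk>x \<in> carrier A; y \<in> carrier A\<rbrakk> \<Longrightarrow> x \<otimes> (c \<odot> y) = c \<odot> (x \<otimes> y)"

definition lin :: "(complex, 'a) module \<Rightarrow> (complex, 'b) module \<Rightarrow> ('a \<Rightarrow> 'b) set" where
  "lin M N = {f \<in> carrier M \<rightarrow> carrier N.
     (\<forall>x\<in>carrier M. \<forall>y\<in>carrier M. f (x \<oplus>\<^bsub>M\<^esub> y) = f x \<oplus>\<^bsub>N\<^esub> f y) \<and>
     (\<forall>c. \<forall>x\<in>carrier M. f (c \<odot>\<^bsub>M\<^esub> x) = c \<odot>\<^bsub>N\<^esub> f x)}"

definition bilin ::
  "(complex, 'a) module \<Rightarrow> (complex, 'b) module \<Rightarrow> (complex, 'c) module \<Rightarrow> ('a \<Rightarrow> 'b \<Rightarrow> 'c) \<Rightarrow> bool" where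
  "bilin M N Z f \<longleftrightarrow> (\<forall>y\<in>carrier N. (\<lambda>x. f x y) \<in> lin M Z) \<and> (\<forall>x\<in>carrier M. f x \<in> lin N Z)"

inductive_set lspan :: "(complex, 'a) module \<Rightarrow> 'a set \<Rightarrow> 'a set"
  for M :: "(complex, 'a) module" and X :: "'a set" where
  zero: "\<zero>\<^bsub>M\<^esub> \<in> lspan M X"
| incl: "x \<in> X \<Longrightarrow> x \<in> lspan M X"
| add: "x \<in> lspan M X \<Longrightarrow> y \<in> lspan M X \<Longrightarrow> x \<oplus>\<^bsub>M\<^esub> y \<in> lspan M X"
| smult: "x \<in> lspan M X \<Longrightarrow> c \<odot>\<^bsub>M\<^esub> x \<in> lspan M X"

lemma linI:
  assumes "\<And>x. x \<in> carrier M \<Longrightarrow> f x \<in> carrier N"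
    and "\<And>x y. \<lbrakk>x \<in> carrier M; y \<in> carrier M\<rbrakk> \<Longrightarrow> f (x \<oplus>\<^bsub>M\<^esub> y) = f x \<oplus>\<^bsub>N\<^esub> f y"
    and "\<And>c x. x \<in> carrier M \<Longrightarrow> f (c \<odot>\<^bsub>M\<^esub> x) = c \<odot>\<^bsub>N\<^esub> f x"
  shows "f \<in> lin M N"
  using assms by (auto simp: lin_def)

lemma lin_closed: "f \<in> lin M N \<Longrightarrow> x \<in> carrier M \<Longrightarrow> f x \<in> carrier N"
  and lin_add: "f \<in> lin M N \<Longrightarrow> x \<in> carrier M \<Longrightarrow> y \<in> carrier M \<Longrightarrow> f (x \<oplus>\<^bsub>M\<^esub> y) = f x \<oplus>\<^bsub>N\<^esub> f y"
  and lin_smult: "f \<in> lin M N \<Longrightarrow> x \<in> carrier M \<Longrightarrow> f (c \<odot>\<^bsub>M\<^esub> x) = c \<odot>\<^bsub>N\<^esub> f x"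
  by (auto simp: lin_def)

lemma lin_zero:
  assumes "cvs M" "cvs N" "f \<in> lin M N"
  shows "f \<zero>\<^bsub>M\<^esub> = \<zero>\<^bsub>N\<^esub>"
proof -
  interpret M: cvs M by fact
  interpret N: cvs N by fact
  have "f (0 \<odot>\<^bsub>M\<^esub> \<zero>\<^bsub>M\<^esub>) = 0 \<odot>\<^bsub>N\<^esub> f \<zero>\<^bsub>M\<^esub>"
    using assms(3) by (rule lin_smult) simp
  then show ?thesis using lin_closed[OF assms(3) M.zero_closed] by simp
qed

lemma lin_id: "(\<lambda>x. x) \<in> lin M M"
  by (auto intro: linI)

lemma lin_comp: "f \<in> lin M N \<Longrightarrow> g \<in> lin N Z \<Longrightarrow> (\<lambda>x. g (f x)) \<in> lin M Z"
  by (auto simp: lin_def Pi_iff)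

lemma lin_smult_const:
  assumes "cvs N" "f \<in> lin M N"
  shows "(\<lambda>x. c \<odot>\<^bsub>N\<^esub> f x) \<in> lin M N"
proof -
  interpret N: cvs N by fact
  show ?thesis using assms(2)
    by (auto simp: lin_def N.smult_r_distr N.smult_commute Pi_iff)
qed

lemma lin_plus:
  assumes "cvs N" "f \<in> lin M N" "g \<in> lin M N"
  shows "(\<lambda>x. f x \<oplus>\<^bsub>N\<^esub> g x) \<in> lin M N"
proof -
  interpret N: cvs N by fact
  show ?thesis using assms(2,3)
    by (intro linI) (auto simp: lin_def N.smult_r_distr Pi_iff N.a_ac)
qed

lemma lin_const_zero: "cvs N \<Longrightarrow> (\<lambda>x. \<zero>\<^bsub>N\<^esub>) \<in> lin M N"
proof -
  assume "cvs N"
  then interpret N: cvs N .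
  show ?thesis by (auto intro: linI)
qed

lemma lin_cong: "f \<in> lin M N \<Longrightarrow> cvs M \<Longrightarrow> (\<And>x. x \<in> carrier M \<Longrightarrow> f x = g x) \<Longrightarrow> g \<in> lin M N"
proof -
  assume f: "f \<in> lin M N" and M: "cvs M" and e: "\<And>x. x \<in> carrier M \<Longrightarrow> f x = g x"
  interpret M: cvs M by fact
  show ?thesis
    by (rule linI) (simp_all flip: e add: lin_closed[OF f] lin_add[OF f] lin_smult[OF f])
qed

lemma bilinI:
  assumes "\<And>y. y \<in> carrier N \<Longrightarrow> (\<lambda>x. f x y) \<in> lin M Z" "\<And>x. x \<in> carrier M \<Longrightarrow> f x \<in> lin N Z"
  shows "bilin M N Z f"
  using assms by (auto simp: bilin_def)

lemma bilin_left: "bilin M N Z f \<Longrightarrow> y \<in> carrier N \<Longrightarrow> (\<lambda>x. f x y) \<in> lin M Z"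
  and bilin_right: "bilin M N Z f \<Longrightarrow> x \<in> carrier M \<Longrightarrow> f x \<in> lin N Z"
  by (auto simp: bilin_def)

lemma bilin_closed: "bilin M N Z f \<Longrightarrow> x \<in> carrier M \<Longrightarrow> y \<in> carrier N \<Longrightarrow> f x y \<in> carrier Z"
  using bilin_right lin_closed by metis

lemma lspan_closed:
  assumes "cvs M" "X \<subseteq> carrier M" "x \<in> lspan M X"
  shows "x \<in> carrier M"
proof -
  interpret cvs M by fact
  show ?thesis using assms(3) by induction (use assms(2) in auto)
qed

lemma lspan_subset:
  assumes "X \<subseteq> lspan M Y" shows "lspan M X \<subseteq> lspan M Y"
proof
  fix x assume "x \<in> lspan M X"
  then show "x \<in> lspan M Y" by induction (use assms in \<open>auto intro: lspan.intros\<close>)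
qed

lemma lin_image_lspan:
  assumes "cvs M" "cvs N" "f \<in> lin M N" "X \<subseteq> carrier M" "x \<in> lspan M X"
  shows "f x \<in> lspan N (f ` X)"
  using assms(5)
proof induction
  case zero
  show ?case using lin_zero[OF assms(1-3)] by (simp add: lspan.zero)
next
  case (add x y)
  then show ?case
    using lspan_closed[OF assms(1,4)] by (simp add: lin_add[OF assms(3)] lspan.add)
next
  case (smult x c)
  then show ?case
    using lspan_closed[OF assms(1,4)] by (simp add: lin_smult[OF assms(3)] lspan.smult)
qed (auto intro: lspan.incl)

text \<open>The rule behind most identities below: the effort goes into showing that both sides are
  linear in a variable, after which that variable may be taken to be a pure tensor, a homogeneous
  element or a monomial.\<close>

lemma lin_eqI:
  assumes "cvs M" "cvs Z" "f \<in> lin M Z" "g \<in> lin M Z" "X \<subseteq> carrier M"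
    and "\<And>x. x \<in> X \<Longrightarrow> f x = g x" "x \<in> lspan M X"
  shows "f x = g x"
  using assms(7)
proof induction
  case zero
  show ?case using lin_zero assms(1-4) by metis
next
  case (add x y)
  then show ?case
    using lspan_closed[OF assms(1,5)] by (simp add: lin_add[OF assms(3)] lin_add[OF assms(4)])
next
  case (smult x c)
  then show ?case
    using lspan_closed[OF assms(1,5)] by (simp add: lin_smult[OF assms(3)] lin_smult[OF assms(4)])
qed (rule assms)

subsection \<open>Free vector spaces\<close>

lemma free_vs_simps [simp]:
  "carrier (free_vs X) = {p. Poly_Mapping.keys p \<subseteq> X}"
  "\<zero>\<^bsub>free_vs X\<^esub> = 0" "x \<oplus>\<^bsub>free_vs X\<^esub> y = x + y" "c \<odot>\<^bsub>free_vs X\<^esub> x = fscale c x"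
  by (simp_all add: free_vs_def)

lemma keys_fscale: "Poly_Mapping.keys (fscale c p) \<subseteq> Poly_Mapping.keys p"
  by (auto simp: in_keys_iff lookup_fscale)

lemma fscale_single [simp]: "fscale c (Poly_Mapping.single k d) = Poly_Mapping.single k (c * d)"
  by (auto intro!: poly_mapping_eqI simp: lookup_fscale lookup_single when_def)

lemma cvs_free_vs: "cvs (free_vs X)"
proof (intro cvs.intro cvs_axioms.intro abelian_groupI)
  fix x assume "x \<in> carrier (free_vs X)"
  then show "\<exists>y\<in>carrier (free_vs X). y \<oplus>\<^bsub>free_vs X\<^esub> x = \<zero>\<^bsub>free_vs X\<^esub>"
    by (intro bexI[of _ "-x"]) auto
next
  fix x y assume "x \<in> carrier (free_vs X)" "y \<in> carrier (free_vs X)"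
  then show "x \<oplus>\<^bsub>free_vs X\<^esub> y \<in> carrier (free_vs X)"
    using keys_add[of x y] by auto
next
  fix x c assume "x \<in> carrier (free_vs X)"
  then show "c \<odot>\<^bsub>free_vs X\<^esub> x \<in> carrier (free_vs X)"
    using keys_fscale[of c x] by auto
qed (auto simp: fvs.scale_left_distrib fvs.scale_right_distrib ac_simps)

lemma free_vs_span: "carrier (free_vs X) = lspan (free_vs X) ((\<lambda>x. Poly_Mapping.single x 1) ` X)"
proof (intro equalityI subsetI)
  fix p assume p: "p \<in> carrier (free_vs X)"
  have "p \<in> lspan (free_vs X) ((\<lambda>x. Poly_Mapping.single x 1) ` X)"
    if "finite S" "Poly_Mapping.keys p \<subseteq> S" "S \<subseteq> X" for S and p :: "'a \<Rightarrow>\<^sub>0 complex"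
    using that
  proof (induction S arbitrary: p)
    case empty
    then show ?case using lspan.zero[of "free_vs X"] by simp
  next
    case (insert k S)
    define r where "r = p - Poly_Mapping.single k (Poly_Mapping.lookup p k)"
    have "Poly_Mapping.keys r \<subseteq> S"
    proof
      fix k' assume "k' \<in> Poly_Mapping.keys r"
      then have "Poly_Mapping.lookup r k' \<noteq> 0" by (simp add: in_keys_iff)
      then have "k' \<noteq> k" "k' \<in> Poly_Mapping.keys p"
        by (auto simp: r_def lookup_minus lookup_single when_def in_keys_iff split: if_splits)
      then show "k' \<in> S" using insert.prems by auto
    qed
    then have 1: "r \<in> lspan (free_vs X) ((\<lambda>x. Poly_Mapping.single x 1) ` X)"
      using insert by auto
    have 2: "fscale (Poly_Mapping.lookup p k) (Poly_Mapping.single k 1)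
        \<in> lspan (free_vs X) ((\<lambda>x. Poly_Mapping.single x 1) ` X)"
      using insert.prems lspan.smult[OF lspan.incl, of "Poly_Mapping.single k 1" _ "free_vs X"] by auto
    have "p = r + fscale (Poly_Mapping.lookup p k) (Poly_Mapping.single k 1)"
      by (simp add: r_def)
    then show ?case using lspan.add[OF 1 2] by simp
  qed
  from this[of "Poly_Mapping.keys p" p] p
  show "p \<in> lspan (free_vs X) ((\<lambda>x. Poly_Mapping.single x 1) ` X)" by simp
next
  fix p assume "p \<in> lspan (free_vs X) ((\<lambda>x. Poly_Mapping.single x 1) ` X)"
  then show "p \<in> carrier (free_vs X)"
    by (rule lspan_closed[OF cvs_free_vs, rotated]) auto
qed

text \<open>The linear extension of \<open>f\<close> from the basis to the free vector space.
  \<open>sweedler\<close> is this map applied to a chosen representative of a coset.\<close>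

definition flin :: "(complex, 'c) module \<Rightarrow> ('k \<Rightarrow> 'c) \<Rightarrow> ('k \<Rightarrow>\<^sub>0 complex) \<Rightarrow> 'c" where
  "flin Z f p = (\<Oplus>\<^bsub>Z\<^esub>k\<in>Poly_Mapping.keys p. Poly_Mapping.lookup p k \<odot>\<^bsub>Z\<^esub> f k)"

context cvs
begin

text \<open>The support of a sum is in general smaller than the union of the supports, so additivity
  of \<open>flin\<close> is proved by evaluating all terms over one common finite set.\<close>

lemma flin_eq_finsum:
  assumes "finite S" "Poly_Mapping.keys p \<subseteq> S" "\<And>k. k \<in> S \<Longrightarrow> f k \<in> carrier M"
  shows "flin M f p = (\<Oplus>k\<in>S. Poly_Mapping.lookup p k \<odot> f k)"
  unfolding flin_def
  by (rule add.finprod_mono_neutral_cong_left) (use assms in \<open>auto simp: in_keys_iff\<close>)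

lemma finsum_smult:
  assumes "finite S" "\<And>k. k \<in> S \<Longrightarrow> f k \<in> carrier M"
  shows "(\<Oplus>k\<in>S. c \<odot> f k) = c \<odot> (\<Oplus>k\<in>S. f k)"
  using assms
proof (induction S)
  case (insert x S)
  then have "f \<in> S \<rightarrow> carrier M" "(\<lambda>k. c \<odot> f k) \<in> S \<rightarrow> carrier M" by auto
  with insert show ?case by (simp add: smult_r_distr)
qed simp

lemma flin_lin:
  assumes "\<And>k. k \<in> X \<Longrightarrow> f k \<in> carrier M"
  shows "flin M f \<in> lin (free_vs X) M"
proof (rule linI)
  fix p assume p: "p \<in> carrier (free_vs X)"
  then show "flin M f p \<in> carrier M"
    unfolding flin_def using assms by (intro finsum_closed) auto
  fix c
  have "flin M f (fscale c p) = (\<Oplus>k\<in>Poly_Mapping.keys p. (c * Poly_Mapping.lookup p k) \<odot> f k)"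
    using p assms keys_fscale[of c p]
    by (subst flin_eq_finsum[of "Poly_Mapping.keys p"]) (auto simp: lookup_fscale)
  also have "\<dots> = (\<Oplus>k\<in>Poly_Mapping.keys p. c \<odot> (Poly_Mapping.lookup p k \<odot> f k))"
    using p assms by (intro finsum_cong') (auto simp: smult_assoc1)
  also have "\<dots> = c \<odot> flin M f p"
    unfolding flin_def using p assms by (intro finsum_smult) auto
  finally show "flin M f (c \<odot>\<^bsub>free_vs X\<^esub> p) = c \<odot> flin M f p" by simp
next
  fix p r assume p: "p \<in> carrier (free_vs X)" and r: "r \<in> carrier (free_vs X)"
  let ?S = "Poly_Mapping.keys p \<union> Poly_Mapping.keys r"
  have S: "f k \<in> carrier M" if "k \<in> ?S" for k using p r that assms by auto
  have "flin M f (p + r) = (\<Oplus>k\<in>?S. Poly_Mapping.lookup (p + r) k \<odot> f k)"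
    using S keys_add[of p r] by (intro flin_eq_finsum) auto
  also have "\<dots> = (\<Oplus>k\<in>?S. Poly_Mapping.lookup p k \<odot> f k \<oplus> Poly_Mapping.lookup r k \<odot> f k)"
    using S by (intro finsum_cong') (auto simp: lookup_add smult_l_distr)
  also have "\<dots> = (\<Oplus>k\<in>?S. Poly_Mapping.lookup p k \<odot> f k) \<oplus> (\<Oplus>k\<in>?S. Poly_Mapping.lookup r k \<odot> f k)"
    using S by (intro finsum_addf) auto
  also have "\<dots> = flin M f p \<oplus> flin M f r"
    using flin_eq_finsum[of ?S p f] flin_eq_finsum[of ?S r f] S by simp
  finally show "flin M f (p \<oplus>\<^bsub>free_vs X\<^esub> r) = flin M f p \<oplus> flin M f r" by simp
qed

lemma flin_single [simp]: "f k \<in> carrier M \<Longrightarrow> flin M f (Poly_Mapping.single k c) = c \<odot> f k"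
  by (subst flin_eq_finsum[of "{k}"]) auto

lemma flin_cong:
  assumes "\<And>k. k \<in> Poly_Mapping.keys p \<Longrightarrow> f k = g k" "\<And>k. k \<in> Poly_Mapping.keys p \<Longrightarrow> g k \<in> carrier M"
  shows "flin M f p = flin M g p"
  unfolding flin_def using assms by (intro finsum_cong') auto

text \<open>In a nested Sweedler formula the outer variable enters through the function and not
  through the coset; this is the linearity needed for that variable.\<close>

lemma flin_fun_lin:
  assumes "cvs N" and f: "\<And>k. k \<in> Poly_Mapping.keys p \<Longrightarrow> (\<lambda>x. f x k) \<in> lin N M"
  shows "(\<lambda>x. flin M (f x) p) \<in> lin N M"
proof -
  have "(\<lambda>x. \<Oplus>k\<in>S. c k \<odot> f x k) \<in> lin N M" if "finite S" "S \<subseteq> Poly_Mapping.keys p" for S c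
    using that
  proof (induction S)
    case empty
    then show ?case by (simp add: lin_const_zero cvs_axioms)
  next
    case (insert k S)
    have "(\<lambda>x. c k \<odot> f x k \<oplus> (\<Oplus>k\<in>S. c k \<odot> f x k)) \<in> lin N M"
      using insert f by (intro lin_plus lin_smult_const cvs_axioms) auto
    then show ?case
    proof (rule lin_cong[OF _ \<open>cvs N\<close>])
      fix x assume "x \<in> carrier N"
      then show "c k \<odot> f x k \<oplus> (\<Oplus>k\<in>S. c k \<odot> f x k) = (\<Oplus>k\<in>insert k S. c k \<odot> f x k)"
        using insert by (subst finsum_insert) (auto intro!: lin_closed[OF f])
    qed
  qed
  then show ?thesis by (simp add: flin_def)
qed

end

subsection \<open>Quotients\<close>

locale subspace = cvs M for M :: "(complex, 'a) module" (structure) +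
  fixes I :: "'a set"
  assumes sub_carrier: "I \<subseteq> carrier M" and sub_zero: "\<zero> \<in> I"
    and sub_add: "\<lbrakk>x \<in> I; y \<in> I\<rbrakk> \<Longrightarrow> x \<oplus> y \<in> I"
    and sub_smult: "x \<in> I \<Longrightarrow> c \<odot> x \<in> I"
begin

sublocale abelian_subgroup I M
proof (rule abelian_subgroupI3)
  show "additive_subgroup I M"
  proof (rule additive_subgroupI, rule add.subgroupI)
    fix x assume "x \<in> I"
    then show "\<ominus> x \<in> I" using sub_smult[of x "-1"] sub_carrier by (auto simp: smult_minus_one)
  qed (use sub_carrier sub_zero sub_add in auto)
qed (rule abelian_group_axioms)

lemma quot_simps:
  "carrier (quot M I) = (\<lambda>x. I +> x) ` carrier M" "\<zero>\<^bsub>quot M I\<^esub> = I"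
  "\<one>\<^bsub>quot M I\<^esub> = I +> \<one>" "X \<otimes>\<^bsub>quot M I\<^esub> Y = rcoset_mult M I X Y"
  by (auto simp: quot_def A_RCOSETS_def' a_r_coset_def')

lemma quot_add: "\<lbrakk>x \<in> carrier M; y \<in> carrier M\<rbrakk> \<Longrightarrow> (I +> x) \<oplus>\<^bsub>quot M I\<^esub> (I +> y) = I +> (x \<oplus> y)"
  by (simp add: quot_def a_rcos_sum)

lemma coset_eq_iff:
  assumes "x \<in> carrier M" "y \<in> carrier M"
  shows "I +> x = I +> y \<longleftrightarrow> x \<ominus> y \<in> I"
proof -
  have "I +> x = I +> y \<longleftrightarrow> x \<in> I +> y"
    using a_rcos_self[of x] a_repr_independence'[of x y] assms by metis
  also have "\<dots> \<longleftrightarrow> x \<ominus> y \<in> I"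
    using a_rcos_module[of y x] assms by (simp add: minus_eq)
  finally show ?thesis .
qed

lemma coset_memD:
  assumes "x \<in> carrier M" "y \<in> I +> x"
  shows "y \<in> carrier M" "I +> y = I +> x"
  using a_elemrcos_carrier[OF assms] a_repr_independence'[OF assms(2,1)] by simp_all

lemma quot_smult:
  assumes "x \<in> carrier M"
  shows "c \<odot>\<^bsub>quot M I\<^esub> (I +> x) = I +> (c \<odot> x)"
proof -
  have "I +> (c \<odot> y) = I +> (c \<odot> x)" if "y \<in> I +> x" for y
  proof -
    have y: "y \<in> carrier M" "y \<ominus> x \<in> I"
      using coset_memD[OF assms that] coset_eq_iff assms by auto
    have "c \<odot> y \<ominus> c \<odot> x = c \<odot> (y \<ominus> x)"
      using y(1) assms
      by (simp add: minus_eq smult_r_distr smult_commute[of _ "-1" c] flip: smult_minus_one)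
    then show ?thesis using coset_eq_iff y assms sub_smult by auto
  qed
  then have "(\<Union>y\<in>I +> x. I +> (c \<odot> y)) = (\<Union>y\<in>I +> x. I +> (c \<odot> x))" by simp
  also have "\<dots> = I +> (c \<odot> x)"
    using a_rcos_self[OF assms] by blast
  finally show ?thesis by (simp add: quot_def)
qed

lemma cvs_quot: "cvs (quot M I)"
proof -
  have I0: "I +> \<zero> = I"
    using a_subset a_coset_add_zero by blast
  have I1: "(I +> x) \<oplus>\<^bsub>quot M I\<^esub> I = I +> x" "I \<oplus>\<^bsub>quot M I\<^esub> (I +> x) = I +> x"
    if "x \<in> carrier M" for x
    using quot_add[of x \<zero>] quot_add[of \<zero> x] that by (auto simp: I0)
  have "abelian_group (quot M I)"
  proof (rule abelian_groupI)
    fix X assume "X \<in> carrier (quot M I)"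
    then obtain x where "x \<in> carrier M" "X = I +> x" by (auto simp: quot_simps)
    then show "\<exists>Y\<in>carrier (quot M I). Y \<oplus>\<^bsub>quot M I\<^esub> X = \<zero>\<^bsub>quot M I\<^esub>"
      by (intro bexI[of _ "I +> \<ominus> x"]) (auto simp: quot_simps quot_add l_neg I0)
  qed (use I0 in \<open>auto simp: quot_simps quot_add a_ac I1\<close>)
  then show ?thesis
    by (intro cvs.intro cvs_axioms.intro)
      (auto simp: quot_simps quot_smult quot_add smult_l_distr smult_r_distr smult_assoc1)
qed

lemma coset_lin: "(\<lambda>x. I +> x) \<in> lin M (quot M I)"
  by (rule linI) (simp_all add: quot_simps quot_smult quot_add)

lemma coset_zero_iff: "x \<in> carrier M \<Longrightarrow> I +> x = I \<longleftrightarrow> x \<in> I"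
  using coset_eq_iff[of x \<zero>] a_coset_add_zero[OF a_subset] by (simp add: minus_eq flip: smult_minus_one)

lemma quot_lift_lin:
  assumes "cvs Z" "L \<in> lin M Z" "\<And>x. x \<in> I \<Longrightarrow> L x = \<zero>\<^bsub>Z\<^esub>"
    and F: "\<And>x. x \<in> carrier M \<Longrightarrow> F (I +> x) = L x"
  shows "F \<in> lin (quot M I) Z"
  by (rule linI)
    (auto simp: quot_simps quot_smult quot_add F lin_closed[OF assms(2)] lin_add[OF assms(2)] lin_smult[OF assms(2)])

text \<open>This is what makes the choice of a representative by \<open>SOME\<close> harmless: a
  linear map that kills \<open>I\<close> does not see which element of the coset was chosen.\<close>

lemma lin_const_on_coset:
  assumes "cvs Z" "L \<in> lin M Z" "\<And>x. x \<in> I \<Longrightarrow> L x = \<zero>\<^bsub>Z\<^esub>"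
    and x: "x \<in> carrier M" and y: "y \<in> I +> x"
  shows "L y = L x"
proof -
  interpret Z: cvs Z by fact
  obtain i where i: "i \<in> I" "y = i \<oplus> x" using y by (auto simp: a_r_coset_def')
  then show ?thesis
    using assms sub_carrier lin_add[OF assms(2), of i x] lin_closed[OF assms(2) x] by auto
qed

lemma quot_span:
  assumes "carrier M = lspan M X" "X \<subseteq> carrier M"
  shows "carrier (quot M I) = lspan (quot M I) ((\<lambda>x. I +> x) ` X)"
proof (intro equalityI subsetI)
  fix P assume "P \<in> carrier (quot M I)"
  then obtain x where "x \<in> carrier M" "P = I +> x" by (auto simp: quot_simps)
  then show "P \<in> lspan (quot M I) ((\<lambda>x. I +> x) ` X)"
    using lin_image_lspan[OF cvs_axioms cvs_quot coset_lin assms(2)] assms(1) by auto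
next
  fix P assume "P \<in> lspan (quot M I) ((\<lambda>x. I +> x) ` X)"
  then show "P \<in> carrier (quot M I)"
    by (rule lspan_closed[OF cvs_quot, rotated]) (use assms(2) in \<open>auto simp: quot_simps\<close>)
qed

end

subsection \<open>Tensor products\<close>

text \<open>The condition under which a bilinear map factors through the additional relations. It is
  stated by linear extension because the elements of \<open>Rel\<close> are formal combinations of
  pairs.\<close>

definition descends ::
  "(complex, 'c) module \<Rightarrow> ('a \<Rightarrow> 'b \<Rightarrow> 'c) \<Rightarrow> ('a \<times> 'b \<Rightarrow>\<^sub>0 complex) set \<Rightarrow> bool" where
  "descends Z f Rel \<longleftrightarrow> (\<forall>r\<in>Rel. flin Z (\<lambda>k. f (fst k) (snd k)) r = \<zero>\<^bsub>Z\<^esub>)"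

lemma descends_empty [simp]: "descends Z f {}"
  by (simp add: descends_def)

lemma flin_diff:
  assumes "cvs Z" "\<And>k. k \<in> X \<Longrightarrow> f k \<in> carrier Z" "Poly_Mapping.keys p \<subseteq> X" "Poly_Mapping.keys r \<subseteq> X"
  shows "flin Z f (p - r) = flin Z f p \<ominus>\<^bsub>Z\<^esub> flin Z f r"
proof -
  interpret Z: cvs Z by fact
  have L: "flin Z f \<in> lin (free_vs X) Z" using assms(2) by (rule Z.flin_lin)
  have "p - r = p + fscale (-1) r"
    by (auto intro!: poly_mapping_eqI simp: lookup_fscale lookup_add lookup_minus)
  moreover have "flin Z f (p + fscale (-1) r) = flin Z f p \<oplus>\<^bsub>Z\<^esub> (-1) \<odot>\<^bsub>Z\<^esub> flin Z f r"
    using lin_add[OF L, of p "fscale (-1) r"] lin_smult[OF L, of r "-1"] assms(3,4) keys_fscale[of "-1" r]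
    by auto
  ultimately show ?thesis
    using lin_closed[OF L, of r] assms(4) by (simp add: Z.smult_minus_one Z.minus_eq)
qed

text \<open>One treatment of all tensor products that occur: \<open>Rel\<close> is empty for tensor
  products over the complex numbers and a balancing relation for those over B. The condition on
  \<open>Rel\<close> keeps the null space inside the free vector space on \<open>X\<close>.\<close>

locale tensor_rel = M: cvs M + N: cvs N
  for M :: "(complex, 'a) module" and N :: "(complex, 'b) module" +
  fixes Rel :: "('a \<times> 'b \<Rightarrow>\<^sub>0 complex) set"
  assumes Rel_carrier: "Rel \<subseteq> carrier (free_vs (carrier M \<times> carrier N))"
begin

abbreviation "X \<equiv> carrier M \<times> carrier N"
abbreviation "T \<equiv> tensor M N Rel"
abbreviation "tp \<equiv> pure M N Rel"

lemma bilin_rel_carrier: "bilin_rel M N \<subseteq> carrier (free_vs X)"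
proof -
  have *: "Poly_Mapping.keys (a - b) \<subseteq> X"
    if "Poly_Mapping.keys a \<subseteq> X" "Poly_Mapping.keys b \<subseteq> X" for a b :: "'a \<times> 'b \<Rightarrow>\<^sub>0 complex"
    using keys_diff[of a b] that by blast
  show ?thesis
  proof
    fix r assume "r \<in> bilin_rel M N"
    then show "r \<in> carrier (free_vs X)"
      unfolding bilin_rel_def by (elim UnE CollectE exE conjE) (simp_all add: *)
  qed
qed

sublocale F: subspace "free_vs X" "tensor_null M N Rel"
proof (rule subspace.intro[OF cvs_free_vs], unfold_locales)
  have "fvs.subspace {p. Poly_Mapping.keys p \<subseteq> X}"
  proof (rule fvs.subspaceI)
    show "p + r \<in> {p. Poly_Mapping.keys p \<subseteq> X}"
      if "p \<in> {p. Poly_Mapping.keys p \<subseteq> X}" "r \<in> {p. Poly_Mapping.keys p \<subseteq> X}" for p r :: "'a \<times> 'b \<Rightarrow>\<^sub>0 complex"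
      using keys_add[of p r] that by auto
    show "fscale c p \<in> {p. Poly_Mapping.keys p \<subseteq> X}"
      if "p \<in> {p. Poly_Mapping.keys p \<subseteq> X}" for c and p :: "'a \<times> 'b \<Rightarrow>\<^sub>0 complex"
      using keys_fscale[of c p] that by auto
  qed simp
  then have "fvs.span (bilin_rel M N \<union> Rel) \<subseteq> {p. Poly_Mapping.keys p \<subseteq> X}"
    using bilin_rel_carrier Rel_carrier by (intro fvs.span_minimal) auto
  then show "tensor_null M N Rel \<subseteq> carrier (free_vs X)"
    by (simp add: tensor_null_def)
qed (auto simp: tensor_null_def fvs.span_zero fvs.span_add fvs.span_scale)

lemma tensor_cvs: "cvs T"
  unfolding tensor_def by (rule F.cvs_quot)

sublocale T: cvs T by (rule tensor_cvs)

lemma pure_closed [simp, intro]: "x \<in> carrier M \<Longrightarrow> y \<in> carrier N \<Longrightarrow> tp x y \<in> carrier T"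
  by (simp add: pure_def tensor_def F.quot_simps)

lemma relation_eq:
  assumes "r - s \<in> tensor_null M N Rel" "Poly_Mapping.keys r \<subseteq> X" "Poly_Mapping.keys s \<subseteq> X"
  shows "tensor_null M N Rel +>\<^bsub>free_vs X\<^esub> r = tensor_null M N Rel +>\<^bsub>free_vs X\<^esub> s"
proof -
  have "\<ominus>\<^bsub>free_vs X\<^esub> s = - s"
    using assms(3) by (intro F.minus_equality) auto
  then show ?thesis using F.coset_eq_iff[of r s] assms by (simp add: F.minus_eq)
qed

lemma pure_eq:
  assumes "Poly_Mapping.single (x, y) 1 - Poly_Mapping.single (x', y') 1 \<in> Rel"
    "x \<in> carrier M" "y \<in> carrier N" "x' \<in> carrier M" "y' \<in> carrier N"
  shows "tp x y = tp x' y'"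
  unfolding pure_def
  by (rule relation_eq) (use assms in \<open>auto simp: tensor_null_def intro: fvs.span_base\<close>)

lemma pure_bilin: "bilin M N T tp"
proof (rule bilinI; rule linI)
  have null: "r \<in> tensor_null M N Rel" if "r \<in> bilin_rel M N" for r
    unfolding tensor_null_def using that by (auto intro: fvs.span_base)
  have add: "(tensor_null M N Rel +>\<^bsub>free_vs X\<^esub> r) \<oplus>\<^bsub>T\<^esub> (tensor_null M N Rel +>\<^bsub>free_vs X\<^esub> s)
      = tensor_null M N Rel +>\<^bsub>free_vs X\<^esub> (r + s)"
    if "Poly_Mapping.keys r \<subseteq> X" "Poly_Mapping.keys s \<subseteq> X" for r s
    using F.quot_add[of r s] that by (simp add: tensor_def)
  have smult: "c \<odot>\<^bsub>T\<^esub> (tensor_null M N Rel +>\<^bsub>free_vs X\<^esub> r) = tensor_null M N Rel +>\<^bsub>free_vs X\<^esub> (fscale c r)"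
    if "Poly_Mapping.keys r \<subseteq> X" for r c
    using F.quot_smult[of r c] that by (simp add: tensor_def)
  have keys2: "Poly_Mapping.keys (Poly_Mapping.single u 1 + Poly_Mapping.single v (1::complex)) \<subseteq> X"
    if "u \<in> X" "v \<in> X" for u v :: "'a \<times> 'b"
  proof -
    have "Poly_Mapping.keys (Poly_Mapping.single u 1 + Poly_Mapping.single v (1::complex)) \<subseteq> {u, v}"
      using keys_add[of "Poly_Mapping.single u (1::complex)" "Poly_Mapping.single v 1"] by auto
    then show ?thesis using that by blast
  qed
  {
    fix x x' y assume *: "x \<in> carrier M" "x' \<in> carrier M" "y \<in> carrier N"
    have "Poly_Mapping.single (x \<oplus>\<^bsub>M\<^esub> x', y) 1 - (Poly_Mapping.single (x, y) 1 + Poly_Mapping.single (x', y) 1)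
        \<in> bilin_rel M N"
      unfolding bilin_rel_def using * by (auto simp: diff_diff_eq)
    then show "tp (x \<oplus>\<^bsub>M\<^esub> x') y = tp x y \<oplus>\<^bsub>T\<^esub> tp x' y"
      unfolding pure_def using * keys2[of "(x, y)" "(x', y)"]
      by (subst add) (simp_all add: relation_eq null)
  next
    fix x y y' assume *: "x \<in> carrier M" "y \<in> carrier N" "y' \<in> carrier N"
    have "Poly_Mapping.single (x, y \<oplus>\<^bsub>N\<^esub> y') 1 - (Poly_Mapping.single (x, y) 1 + Poly_Mapping.single (x, y') 1)
        \<in> bilin_rel M N"
      unfolding bilin_rel_def using * by (auto simp: diff_diff_eq)
    then show "tp x (y \<oplus>\<^bsub>N\<^esub> y') = tp x y \<oplus>\<^bsub>T\<^esub> tp x y'"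
      unfolding pure_def using * keys2[of "(x, y)" "(x, y')"]
      by (subst add) (simp_all add: relation_eq null)
  next
    fix x y c assume *: "x \<in> carrier M" "y \<in> carrier N"
    have "Poly_Mapping.single (c \<odot>\<^bsub>M\<^esub> x, y) 1 - Poly_Mapping.single (x, y) c \<in> bilin_rel M N"
      "Poly_Mapping.single (x, c \<odot>\<^bsub>N\<^esub> y) 1 - Poly_Mapping.single (x, y) c \<in> bilin_rel M N"
      unfolding bilin_rel_def using * by blast+
    note * = * this
    show "tp (c \<odot>\<^bsub>M\<^esub> x) y = c \<odot>\<^bsub>T\<^esub> tp x y"
      unfolding pure_def using *
      by (subst smult) (simp_all add: relation_eq null)
    show "tp x (c \<odot>\<^bsub>N\<^esub> y) = c \<odot>\<^bsub>T\<^esub> tp x y"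
      unfolding pure_def using *
      by (subst smult) (simp_all add: relation_eq null)
  }
qed (auto simp: pure_closed)

lemma tensor_span: "carrier T = lspan T {tp x y | x y. x \<in> carrier M \<and> y \<in> carrier N}"
proof -
  define c where "c = (\<lambda>r. tensor_null M N Rel +>\<^bsub>free_vs X\<^esub> r)"
  have "carrier T = lspan T (c ` ((\<lambda>x. Poly_Mapping.single x 1) ` X))"
    unfolding tensor_def c_def using F.quot_span[OF free_vs_span] by fastforce
  also have "c ` ((\<lambda>x. Poly_Mapping.single x 1) ` X) = {c (Poly_Mapping.single (x, y) 1) | x y. x \<in> carrier M \<and> y \<in> carrier N}"
    by auto
  finally show ?thesis by (simp add: c_def pure_def)
qed

lemma tensor_eqI:
  assumes "cvs Z" "f \<in> lin T Z" "g \<in> lin T Z"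
    and eq: "\<And>x y. \<lbrakk>x \<in> carrier M; y \<in> carrier N\<rbrakk> \<Longrightarrow> f (tp x y) = g (tp x y)"
    and "P \<in> carrier T"
  shows "f P = g P"
proof (rule lin_eqI[OF tensor_cvs assms(1-3)])
  show "P \<in> lspan T {tp x y | x y. x \<in> carrier M \<and> y \<in> carrier N}"
    using assms(5) tensor_span by simp
  fix x assume "x \<in> {tp x y |x y. x \<in> carrier M \<and> y \<in> carrier N}"
  then obtain a b where ab: "a \<in> carrier M" "b \<in> carrier N" "x = tp a b" by blast
  then show "f x = g x" using eq by simp
next
  show "{tp x y |x y. x \<in> carrier M \<and> y \<in> carrier N} \<subseteq> carrier T"
    using pure_closed by blast
qed

text \<open>The universal property of the tensor product: the four families of
  \<open>bilin_rel\<close> die by linearity in each slot, the remaining relations by assumption. The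
  span induction carries the support condition along because \<open>flin\<close> is known to be
  linear only on functions supported in \<open>X\<close>.\<close>

lemma flin_null:
  assumes "cvs Z" "bilin M N Z f" "descends Z f Rel" "r \<in> tensor_null M N Rel"
  shows "flin Z (\<lambda>k. f (fst k) (snd k)) r = \<zero>\<^bsub>Z\<^esub>"
proof -
  interpret Z: cvs Z by fact
  define L where "L = flin Z (\<lambda>k. f (fst k) (snd k))"
  have c: "f x y \<in> carrier Z" if "x \<in> carrier M" "y \<in> carrier N" for x y
    using bilin_closed[OF assms(2)] that .
  have L: "L \<in> lin (free_vs X) Z"
    unfolding L_def by (rule Z.flin_lin) (auto simp: c)
  have diff: "L (r - s) = L r \<ominus>\<^bsub>Z\<^esub> L s" if "Poly_Mapping.keys r \<subseteq> X" "Poly_Mapping.keys s \<subseteq> X" for r s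
    unfolding L_def using that by (intro flin_diff[of Z X]) (auto simp: c assms)
  have single: "L (Poly_Mapping.single (x, y) a) = a \<odot>\<^bsub>Z\<^esub> f x y"
    if "x \<in> carrier M" "y \<in> carrier N" for x y a
    unfolding L_def using c that by simp
  have keys2: "Poly_Mapping.keys (Poly_Mapping.single u 1 - Poly_Mapping.single v (1::complex)) \<subseteq> X"
    if "u \<in> X" "v \<in> X" for u v :: "'a \<times> 'b"
  proof -
    have "Poly_Mapping.keys (Poly_Mapping.single u 1 - Poly_Mapping.single v (1::complex)) \<subseteq> {u, v}"
      using keys_diff[of "Poly_Mapping.single u (1::complex)" "Poly_Mapping.single v 1"] by auto
    then show ?thesis using that by blast
  qed
  have cancel: "(a \<oplus>\<^bsub>Z\<^esub> b) \<ominus>\<^bsub>Z\<^esub> a \<ominus>\<^bsub>Z\<^esub> b = \<zero>\<^bsub>Z\<^esub>" if "a \<in> carrier Z" "b \<in> carrier Z" for a b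
  proof -
    have "(a \<oplus>\<^bsub>Z\<^esub> b) \<ominus>\<^bsub>Z\<^esub> a \<ominus>\<^bsub>Z\<^esub> b = (a \<oplus>\<^bsub>Z\<^esub> b) \<oplus>\<^bsub>Z\<^esub> (\<ominus>\<^bsub>Z\<^esub> (a \<oplus>\<^bsub>Z\<^esub> b))"
      using that by (simp add: Z.minus_eq Z.minus_add Z.a_ac)
    then show ?thesis using that by (simp add: Z.r_neg)
  qed
  have self: "a \<ominus>\<^bsub>Z\<^esub> a = \<zero>\<^bsub>Z\<^esub>" if "a \<in> carrier Z" for a
    unfolding Z.minus_eq using that by (rule Z.r_neg)
  have zero: "L r = \<zero>\<^bsub>Z\<^esub>" if "r \<in> bilin_rel M N" for r
    using that unfolding bilin_rel_def
    by (elim UnE CollectE exE conjE) (simp_all add: diff single keys2 c lin_add[OF bilin_left[OF assms(2)]] lin_add[OF bilin_right[OF assms(2)]]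
       lin_smult[OF bilin_left[OF assms(2)]] lin_smult[OF bilin_right[OF assms(2)]] cancel self)
  have "Poly_Mapping.keys r \<subseteq> X \<and> L r = \<zero>\<^bsub>Z\<^esub>"
    using assms(4) unfolding tensor_null_def
  proof (induction rule: fvs.span_induct_alt)
    case base
    then show ?case using lin_zero[OF cvs_free_vs assms(1) L] by simp
  next
    case (step c r s)
    have r: "Poly_Mapping.keys r \<subseteq> X" "L r = \<zero>\<^bsub>Z\<^esub>"
    proof -
      show "L r = \<zero>\<^bsub>Z\<^esub>"
        using step.hyps zero assms(3) by (auto simp: descends_def L_def)
      have "r \<in> carrier (free_vs X)"
        using step.hyps bilin_rel_carrier Rel_carrier by blast
      then show "Poly_Mapping.keys r \<subseteq> X" by simp
    qed
    have cr: "Poly_Mapping.keys (fscale c r) \<subseteq> X" using r(1) keys_fscale[of c r] by (rule order.trans[rotated])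
    have "Poly_Mapping.keys (fscale c r + s) \<subseteq> X"
      using keys_add[of "fscale c r" s] cr step.IH by (meson Un_least order.trans)
    moreover have "L (fscale c r + s) = \<zero>\<^bsub>Z\<^esub>"
      using lin_add[OF L, of "fscale c r" s] lin_smult[OF L, of r c] r cr step.IH by simp
    ultimately show ?case ..
  qed
  then show ?thesis by (simp add: L_def)
qed

text \<open>Replaces the representative picked by \<open>SOME\<close> by any representative
  \<open>r\<close> at hand.\<close>

lemma sweedler_coset:
  assumes "cvs Z" "bilin M N Z f" "descends Z f Rel" "Poly_Mapping.keys r \<subseteq> X"
  shows "sweedler Z f (tensor_null M N Rel +>\<^bsub>free_vs X\<^esub> r) = flin Z (\<lambda>k. f (fst k) (snd k)) r"
proof -
  have "(SOME s. s \<in> tensor_null M N Rel +>\<^bsub>free_vs X\<^esub> r) \<in> tensor_null M N Rel +>\<^bsub>free_vs X\<^esub> r"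
    using F.a_rcos_self[of r] assms(4) by (intro someI) auto
  then show ?thesis
    unfolding sweedler_def Let_def flin_def[symmetric]
    by (intro F.lin_const_on_coset[OF assms(1) cvs.flin_lin[OF assms(1)]])
      (use assms flin_null[OF assms(1-3)] bilin_closed[OF assms(2)] in auto)
qed

lemma sweedler_pure:
  assumes "cvs Z" "bilin M N Z f" "descends Z f Rel" "x \<in> carrier M" "y \<in> carrier N"
  shows "sweedler Z f (tp x y) = f x y"
proof -
  interpret Z: cvs Z by fact
  show ?thesis
    unfolding pure_def using assms bilin_closed[OF assms(2)] by (subst sweedler_coset) auto
qed

lemma sweedler_lin:
  assumes "cvs Z" "bilin M N Z f" "descends Z f Rel"
  shows "sweedler Z f \<in> lin T Z"
  unfolding tensor_def
proof (rule F.quot_lift_lin[OF assms(1)])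
  show "flin Z (\<lambda>k. f (fst k) (snd k)) \<in> lin (free_vs X) Z"
    by (rule cvs.flin_lin[OF assms(1)]) (use bilin_closed[OF assms(2)] in auto)
qed (use assms in \<open>auto simp: flin_null sweedler_coset\<close>)

text \<open>Elements of the tensor product are cosets of finitely supported functions on \<open>X\<close>, so that
  \<^const>\<open>sweedler\<close> only evaluates its argument on \<open>X\<close>.\<close>

lemma some_carrier:
  assumes "P \<in> carrier T"
  shows "Poly_Mapping.keys (SOME r. r \<in> P) \<subseteq> X"
proof -
  obtain r where r: "Poly_Mapping.keys r \<subseteq> X" "P = tensor_null M N Rel +>\<^bsub>free_vs X\<^esub> r"
    using assms by (auto simp: tensor_def F.quot_simps)
  have "(SOME r. r \<in> P) \<in> P"
    using F.a_rcos_self[of r] r by (intro someI) auto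
  then show ?thesis
    using F.coset_memD(1)[of r] r by simp
qed

lemma sweedler_cong:
  assumes "P \<in> carrier T" "cvs Z"
    "\<And>x y. \<lbrakk>x \<in> carrier M; y \<in> carrier N\<rbrakk> \<Longrightarrow> f x y = g x y"
    "\<And>x y. \<lbrakk>x \<in> carrier M; y \<in> carrier N\<rbrakk> \<Longrightarrow> g x y \<in> carrier Z"
  shows "sweedler Z f P = sweedler Z g P"
  unfolding sweedler_def Let_def flin_def[symmetric]
  by (rule cvs.flin_cong[OF assms(2)]) (use some_carrier[OF assms(1)] assms(3,4) in auto)

text \<open>With \<open>P\<close> its representative is fixed as well, so the value is a fixed
  linear combination of the terms \<open>f w x y\<close>. This handles the outer variables of nested
  Sweedler formulas.\<close>

lemma sweedler_fun_lin:
  assumes "P \<in> carrier T" "cvs Z" "cvs W"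
    "\<And>x y. \<lbrakk>x \<in> carrier M; y \<in> carrier N\<rbrakk> \<Longrightarrow> (\<lambda>w. f w x y) \<in> lin W Z"
  shows "(\<lambda>w. sweedler Z (f w) P) \<in> lin W Z"
  unfolding sweedler_def Let_def flin_def[symmetric]
  by (rule cvs.flin_fun_lin[OF assms(2,3)]) (use some_carrier[OF assms(1)] assms(4) in auto)

end

lemma bilin_lin_comp1: "bilin M N Z f \<Longrightarrow> g \<in> lin W M \<Longrightarrow> y \<in> carrier N \<Longrightarrow> (\<lambda>w. f (g w) y) \<in> lin W Z"
  using bilin_left lin_comp by fast

lemma bilin_lin_comp2: "bilin M N Z f \<Longrightarrow> g \<in> lin W N \<Longrightarrow> x \<in> carrier M \<Longrightarrow> (\<lambda>w. f x (g w)) \<in> lin W Z"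
  using bilin_right lin_comp by fast

context tensor_rel
begin

lemma tensor_span_lspan:
  assumes "carrier M = lspan M A" "carrier N = lspan N B" "A \<subseteq> carrier M" "B \<subseteq> carrier N"
  shows "carrier T = lspan T {tp x y | x y. x \<in> A \<and> y \<in> B}"
proof -
  let ?S = "lspan T {tp x y | x y. x \<in> A \<and> y \<in> B}"
  have 1: "tp x y \<in> ?S" if "x \<in> A" "y \<in> carrier N" for x y
  proof -
    have "tp x \<in> lin N T" using bilin_right[OF pure_bilin] that assms(3) by blast
    then have "tp x y \<in> lspan T (tp x ` B)"
      using that assms(2) by (intro lin_image_lspan[OF N.cvs_axioms tensor_cvs _ assms(4)]) auto
    then show ?thesis
      using that by (elim rev_subsetD, intro lspan_subset) (auto intro: lspan.incl)
  qed
  have 2: "tp x y \<in> ?S" if "x \<in> carrier M" "y \<in> carrier N" for x y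
  proof -
    have "(\<lambda>x. tp x y) \<in> lin M T" using bilin_left[OF pure_bilin] that by blast
    then have "tp x y \<in> lspan T ((\<lambda>x. tp x y) ` A)"
      using that assms(1) by (intro lin_image_lspan[OF M.cvs_axioms tensor_cvs _ assms(3)]) auto
    then show ?thesis
      using that 1 by (elim rev_subsetD, intro lspan_subset) auto
  qed
  have "carrier T \<subseteq> ?S"
    unfolding tensor_span by (rule lspan_subset) (use 2 in auto)
  moreover have "{tp x y | x y. x \<in> A \<and> y \<in> B} \<subseteq> carrier T"
    using assms(3,4) pure_closed by blast
  then have "?S \<subseteq> carrier T"
    using lspan_closed[OF tensor_cvs] by blast
  ultimately show ?thesis by blast
qed

end

lemma tens_tensor_rel: "cvs M \<Longrightarrow> cvs N \<Longrightarrow> tensor_rel M N {}"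
  by (simp add: tensor_rel_def tensor_rel_axioms_def)

lemma tens_cvs: "cvs M \<Longrightarrow> cvs N \<Longrightarrow> cvs (tens M N)"
  using tensor_rel.tensor_cvs tens_tensor_rel .

lemma tpure_closed: "cvs M \<Longrightarrow> cvs N \<Longrightarrow> x \<in> carrier M \<Longrightarrow> y \<in> carrier N \<Longrightarrow> tpure M N x y \<in> carrier (tens M N)"
  using tensor_rel.pure_closed tens_tensor_rel .

lemma tpure_lin1:
  "cvs M \<Longrightarrow> cvs N \<Longrightarrow> g \<in> lin W M \<Longrightarrow> y \<in> carrier N \<Longrightarrow> (\<lambda>w. tpure M N (g w) y) \<in> lin W (tens M N)"
  using bilin_lin_comp1 tensor_rel.pure_bilin tens_tensor_rel by metis

lemma tpure_lin2:
  "cvs M \<Longrightarrow> cvs N \<Longrightarrow> g \<in> lin W N \<Longrightarrow> x \<in> carrier M \<Longrightarrow> (\<lambda>w. tpure M N x (g w)) \<in> lin W (tens M N)"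
  using bilin_lin_comp2 tensor_rel.pure_bilin tens_tensor_rel by metis

lemma tpure_smult1:
  "cvs M \<Longrightarrow> cvs N \<Longrightarrow> x \<in> carrier M \<Longrightarrow> y \<in> carrier N \<Longrightarrow>
   tpure M N (c \<odot>\<^bsub>M\<^esub> x) y = c \<odot>\<^bsub>tens M N\<^esub> tpure M N x y"
  using lin_smult[OF tpure_lin1[OF _ _ lin_id]] by metis

lemma tpure_smult2:
  "cvs M \<Longrightarrow> cvs N \<Longrightarrow> x \<in> carrier M \<Longrightarrow> y \<in> carrier N \<Longrightarrow>
   tpure M N x (c \<odot>\<^bsub>N\<^esub> y) = c \<odot>\<^bsub>tens M N\<^esub> tpure M N x y"
  using lin_smult[OF tpure_lin2[OF _ _ lin_id]] by metis

lemma tens_sweedler_pure: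
  "cvs M \<Longrightarrow> cvs N \<Longrightarrow> cvs Z \<Longrightarrow> bilin M N Z f \<Longrightarrow> x \<in> carrier M \<Longrightarrow> y \<in> carrier N \<Longrightarrow>
   sweedler Z f (tpure M N x y) = f x y"
  using tensor_rel.sweedler_pure tens_tensor_rel descends_empty by metis

lemma tens_sweedler_lin:
  "cvs M \<Longrightarrow> cvs N \<Longrightarrow> cvs Z \<Longrightarrow> bilin M N Z f \<Longrightarrow> g \<in> lin W (tens M N) \<Longrightarrow>
   (\<lambda>w. sweedler Z f (g w)) \<in> lin W Z"
  using tensor_rel.sweedler_lin tens_tensor_rel descends_empty lin_comp by metis

lemma tens_eqI:
  assumes "cvs M" "cvs N" "cvs Z" "f \<in> lin (tens M N) Z" "g \<in> lin (tens M N) Z"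
    and "\<And>x y. \<lbrakk>x \<in> carrier M; y \<in> carrier N\<rbrakk> \<Longrightarrow> f (tpure M N x y) = g (tpure M N x y)"
    and "P \<in> carrier (tens M N)"
  shows "f P = g P"
  using tensor_rel.tensor_eqI[OF tens_tensor_rel[OF assms(1,2)] assms(3-5)] assms(6,7) by simp

subsection \<open>Algebras\<close>

lemma (in calg) mult_bilin: "bilin A A A (\<otimes>)"
  by (intro bilinI linI) (simp_all add: l_distr r_distr smult_assoc2 smult_assoc3)

lemma mult_lin1: "calg A \<Longrightarrow> g \<in> lin W A \<Longrightarrow> y \<in> carrier A \<Longrightarrow> (\<lambda>w. g w \<otimes>\<^bsub>A\<^esub> y) \<in> lin W A"
  using bilin_lin_comp1 calg.mult_bilin by metis

lemma mult_lin2: "calg A \<Longrightarrow> g \<in> lin W A \<Longrightarrow> x \<in> carrier A \<Longrightarrow> (\<lambda>w. x \<otimes>\<^bsub>A\<^esub> g w) \<in> lin W A"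
  using bilin_lin_comp2 calg.mult_bilin by metis

lemma calgI:
  assumes "cvs A" "bilin A A A (mult A)" "\<one>\<^bsub>A\<^esub> \<in> carrier A"
    "\<And>x y z. \<lbrakk>x \<in> carrier A; y \<in> carrier A; z \<in> carrier A\<rbrakk> \<Longrightarrow> (x \<otimes>\<^bsub>A\<^esub> y) \<otimes>\<^bsub>A\<^esub> z = x \<otimes>\<^bsub>A\<^esub> (y \<otimes>\<^bsub>A\<^esub> z)"
    "\<And>x. x \<in> carrier A \<Longrightarrow> \<one>\<^bsub>A\<^esub> \<otimes>\<^bsub>A\<^esub> x = x" "\<And>x. x \<in> carrier A \<Longrightarrow> x \<otimes>\<^bsub>A\<^esub> \<one>\<^bsub>A\<^esub> = x"
  shows "calg A"
proof -
  interpret cvs A by fact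
  have "ring A"
    by (intro ringI monoidI abelian_group_axioms)
      (simp_all add: assms bilin_closed[OF assms(2)]
         lin_add[OF bilin_left[OF assms(2)]] lin_add[OF bilin_right[OF assms(2)]])
  then show ?thesis
    by (intro calg.intro calg_axioms.intro assms(1))
      (simp_all add: lin_smult[OF bilin_left[OF assms(2)]] lin_smult[OF bilin_right[OF assms(2)]])
qed

lemma calg_cvs: "calg A \<Longrightarrow> cvs A"
  by (rule calg.axioms)

text \<open>Passing to the opposite algebra, or equipping a space with a product and a unit, changes
  only the fields that the vector space structure ignores.\<close>

lemma cvs_cong:
  assumes "cvs M" "carrier N = carrier M" "\<zero>\<^bsub>N\<^esub> = \<zero>\<^bsub>M\<^esub>" "add N = add M" "smult N = smult M"
  shows "cvs N"
proof -
  interpret cvs M by fact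
  show ?thesis
  proof (intro cvs.intro cvs_axioms.intro abelian_groupI)
    fix x assume "x \<in> carrier N"
    then show "\<exists>y\<in>carrier N. y \<oplus>\<^bsub>N\<^esub> x = \<zero>\<^bsub>N\<^esub>"
      using assms(2-5) l_neg by (intro bexI[of _ "\<ominus>\<^bsub>M\<^esub> x"]) auto
  qed (simp_all add: assms(2-5) smult_l_distr smult_r_distr smult_assoc1 a_ac)
qed

lemma cvs_sub:
  assumes "cvs M" "C \<subseteq> carrier M" "\<zero>\<^bsub>M\<^esub> \<in> C" "\<And>x y. \<lbrakk>x \<in> C; y \<in> C\<rbrakk> \<Longrightarrow> x \<oplus>\<^bsub>M\<^esub> y \<in> C"
    "\<And>c x. x \<in> C \<Longrightarrow> c \<odot>\<^bsub>M\<^esub> x \<in> C"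
  shows "cvs (M\<lparr>carrier := C\<rparr>)"
proof -
  interpret cvs M by fact
  note in_carrier = subsetD[OF assms(2)]
  show ?thesis
  proof (intro cvs.intro cvs_axioms.intro abelian_groupI)
    fix x assume "x \<in> carrier (M\<lparr>carrier := C\<rparr>)"
    then show "\<exists>y\<in>carrier (M\<lparr>carrier := C\<rparr>). y \<oplus>\<^bsub>M\<lparr>carrier := C\<rparr>\<^esub> x = \<zero>\<^bsub>M\<lparr>carrier := C\<rparr>\<^esub>"
      using assms(5)[of x "-1"] in_carrier[of x] l_neg
      by (intro bexI[of _ "\<ominus>\<^bsub>M\<^esub> x"]) (auto simp: smult_minus_one)
  qed (simp_all add: assms(3-5) in_carrier smult_l_distr smult_r_distr smult_assoc1 a_ac)
qed

lemma calg_sub: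
  assumes "calg A" "C \<subseteq> carrier A" "\<zero>\<^bsub>A\<^esub> \<in> C" "\<one>\<^bsub>A\<^esub> \<in> C" "\<And>x y. \<lbrakk>x \<in> C; y \<in> C\<rbrakk> \<Longrightarrow> x \<oplus>\<^bsub>A\<^esub> y \<in> C"
    "\<And>c x. x \<in> C \<Longrightarrow> c \<odot>\<^bsub>A\<^esub> x \<in> C" "\<And>x y. \<lbrakk>x \<in> C; y \<in> C\<rbrakk> \<Longrightarrow> x \<otimes>\<^bsub>A\<^esub> y \<in> C"
  shows "calg (A\<lparr>carrier := C\<rparr>)"
proof -
  interpret calg A by fact
  note in_carrier = subsetD[OF assms(2)]
  have "cvs (A\<lparr>carrier := C\<rparr>)" by (rule cvs_sub) (use assms cvs_axioms in auto)
  then show ?thesis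
    by (rule calgI; (intro bilinI linI)?)
      (simp_all add: assms(3-7) in_carrier l_distr r_distr smult_assoc2 smult_assoc3 m_assoc)
qed

lemma cvs_opp: "cvs A \<Longrightarrow> cvs (opp A)"
  by (erule cvs_cong) (simp_all add: opp_def)

lemma opp_simps [simp]:
  "carrier (opp A) = carrier A" "\<zero>\<^bsub>opp A\<^esub> = \<zero>\<^bsub>A\<^esub>" "add (opp A) = add A" "smult (opp A) = smult A"
  "\<one>\<^bsub>opp A\<^esub> = \<one>\<^bsub>A\<^esub>" "x \<otimes>\<^bsub>opp A\<^esub> y = y \<otimes>\<^bsub>A\<^esub> x"
  by (simp_all add: opp_def)

lemma calg_opp: "calg A \<Longrightarrow> calg (opp A)"
proof -
  assume "calg A"
  then interpret calg A .
  show ?thesis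
    by (rule calgI[OF cvs_opp[OF cvs_axioms]]; (intro bilinI linI)?)
      (simp_all add: l_distr r_distr smult_assoc2 smult_assoc3 m_assoc)
qed

lemma tens_alg_simps [simp]:
  "carrier (tens_alg A B) = carrier (tens A B)" "\<zero>\<^bsub>tens_alg A B\<^esub> = \<zero>\<^bsub>tens A B\<^esub>"
  "add (tens_alg A B) = add (tens A B)" "smult (tens_alg A B) = smult (tens A B)"
  "\<one>\<^bsub>tens_alg A B\<^esub> = tpure A B \<one>\<^bsub>A\<^esub> \<one>\<^bsub>B\<^esub>"
  by (simp_all add: tens_alg_def)

section \<open>Tensor products of algebras\<close>

locale two_calg = A: calg A + B: calg B
  for A :: "(complex, 'a) module" and B :: "(complex, 'b) module"
begin

abbreviation "AB \<equiv> tens A B"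

lemmas cvs2 = A.cvs_axioms B.cvs_axioms

lemma AB_cvs: "cvs AB" by (rule tens_cvs[OF cvs2])

lemma mult_inner_bilin:
  assumes "a \<in> carrier A" "b \<in> carrier B"
  shows "bilin A B AB (\<lambda>a' b'. tpure A B (a \<otimes>\<^bsub>A\<^esub> a') (b \<otimes>\<^bsub>B\<^esub> b'))"
  using assms
  by (intro bilinI tpure_lin1 tpure_lin2 mult_lin2 lin_id cvs2 A.calg_axioms B.calg_axioms) auto

lemma mult_outer_bilin:
  assumes "Q \<in> carrier AB"
  shows "bilin A B AB (\<lambda>a b. sweedler AB (\<lambda>a' b'. tpure A B (a \<otimes>\<^bsub>A\<^esub> a') (b \<otimes>\<^bsub>B\<^esub> b')) Q)"
  using assms
  by (intro bilinI tensor_rel.sweedler_fun_lin[OF tens_tensor_rel[OF cvs2]] cvs2 AB_cvs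
      tpure_lin1 tpure_lin2 mult_lin1 lin_id A.calg_axioms B.calg_axioms) auto

lemma tens_mult_bilin: "bilin AB AB AB (mult (tens_alg A B))"
proof (rule bilinI)
  fix Q assume "Q \<in> carrier AB"
  then show "(\<lambda>P. P \<otimes>\<^bsub>tens_alg A B\<^esub> Q) \<in> lin AB AB"
    by (simp add: tens_alg_def tens_sweedler_lin[OF cvs2 AB_cvs mult_outer_bilin lin_id])
next
  fix P assume "P \<in> carrier AB"
  then have "(\<lambda>Q. sweedler AB (\<lambda>a b. sweedler AB (\<lambda>a' b'. tpure A B (a \<otimes>\<^bsub>A\<^esub> a') (b \<otimes>\<^bsub>B\<^esub> b')) Q) P) \<in> lin AB AB"
    by (rule tensor_rel.sweedler_fun_lin[OF tens_tensor_rel[OF cvs2] _ AB_cvs AB_cvs])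
      (rule tens_sweedler_lin[OF cvs2 AB_cvs mult_inner_bilin lin_id])
  then show "(\<otimes>\<^bsub>tens_alg A B\<^esub>) P \<in> lin AB AB"
    by (simp add: tens_alg_def)
qed

lemma tens_mult_pure:
  assumes "a \<in> carrier A" "b \<in> carrier B" "a' \<in> carrier A" "b' \<in> carrier B"
  shows "tpure A B a b \<otimes>\<^bsub>tens_alg A B\<^esub> tpure A B a' b' = tpure A B (a \<otimes>\<^bsub>A\<^esub> a') (b \<otimes>\<^bsub>B\<^esub> b')"
  using assms tpure_closed[OF cvs2]
  by (simp add: tens_alg_def tens_sweedler_pure[OF cvs2 AB_cvs mult_outer_bilin]
      tens_sweedler_pure[OF cvs2 AB_cvs mult_inner_bilin])

text \<open>The unit and associativity laws are inherited from the factors on pure tensors. Both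
  sides of each law are linear in every argument, so the laws extend to general tensors one argument
  at a time.\<close>

lemma calg_tens_alg: "calg (tens_alg A B)"
proof (rule calgI)
  show cvs: "cvs (tens_alg A B)" by (rule cvs_cong[OF AB_cvs]) simp_all
  have lin_eq: "lin (tens_alg A B) (tens_alg A B) = lin AB AB"
    by (auto simp: lin_def)
  show "bilin (tens_alg A B) (tens_alg A B) (tens_alg A B) (mult (tens_alg A B))"
    using tens_mult_bilin by (simp add: bilin_def lin_eq)
  show "\<one>\<^bsub>tens_alg A B\<^esub> \<in> carrier (tens_alg A B)"
    by (simp add: tpure_closed[OF cvs2])
  note l1 = bilin_lin_comp1[OF tens_mult_bilin] and l2 = bilin_lin_comp2[OF tens_mult_bilin]
  note c = bilin_closed[OF tens_mult_bilin] tpure_closed[OF cvs2]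
  note eqI = tens_eqI[OF cvs2 AB_cvs]
  fix x assume "x \<in> carrier (tens_alg A B)"
  then have x: "x \<in> carrier AB" by simp
  have one: "tpure A B \<one>\<^bsub>A\<^esub> \<one>\<^bsub>B\<^esub> \<in> carrier AB" by (simp add: c)
  show "\<one>\<^bsub>tens_alg A B\<^esub> \<otimes>\<^bsub>tens_alg A B\<^esub> x = x"
    unfolding tens_alg_simps
    by (rule eqI[OF l2[OF lin_id one] lin_id _ x]) (simp add: tens_mult_pure)
  show "x \<otimes>\<^bsub>tens_alg A B\<^esub> \<one>\<^bsub>tens_alg A B\<^esub> = x"
    unfolding tens_alg_simps
    by (rule eqI[OF l1[OF lin_id one] lin_id _ x]) (simp add: tens_mult_pure)
next
  note l1 = bilin_lin_comp1[OF tens_mult_bilin] and l2 = bilin_lin_comp2[OF tens_mult_bilin]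
  note c = bilin_closed[OF tens_mult_bilin] tpure_closed[OF cvs2]
  note eqI = tens_eqI[OF cvs2 AB_cvs]
  fix x y z
  assume "x \<in> carrier (tens_alg A B)" "y \<in> carrier (tens_alg A B)" "z \<in> carrier (tens_alg A B)"
  then have x: "x \<in> carrier AB" "y \<in> carrier AB" "z \<in> carrier AB" by simp_all
  let ?m = "mult (tens_alg A B)"
  have 1: "?m (?m (tpure A B a b) (tpure A B a' b')) z = ?m (tpure A B a b) (?m (tpure A B a' b') z)"
    if "a \<in> carrier A" "b \<in> carrier B" "a' \<in> carrier A" "b' \<in> carrier B" for a b a' b'
    by (rule eqI[OF l2[OF lin_id] l2[OF l2[OF lin_id]] _ x(3)])
      (use that in \<open>simp_all add: c tens_mult_pure A.m_assoc B.m_assoc\<close>)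
  have 2: "?m (?m (tpure A B a b) y) z = ?m (tpure A B a b) (?m y z)"
    if "a \<in> carrier A" "b \<in> carrier B" for a b
    by (rule eqI[OF l1[OF l2[OF lin_id]] l2[OF l1[OF lin_id]] _ x(2)])
      (use that x in \<open>simp_all add: c 1\<close>)
  show "?m (?m x y) z = ?m x (?m y z)"
    by (rule eqI[OF l1[OF l1[OF lin_id]] l1[OF lin_id] _ x(1)])
      (use x in \<open>simp_all add: c 2\<close>)
qed

end

section \<open>Monoid algebras, with the free algebra and the Laurent polynomials as
  instances\<close>

lemma fscale_mult_left: "fscale c p * q = fscale c (p * q)"
  for p q :: "'k :: monoid_add \<Rightarrow>\<^sub>0 complex"
  by (simp add: fscale_def mult_map_scale_conv_mult mult.assoc)

text \<open>Scaling is left multiplication by \<open>single 0 c\<close>. Concatenation of words is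
  not commutative, so the centrality of this element has to be checked, which is done on the
  basis.\<close>

lemma fscale_mult_right: "p * fscale c q = fscale c (p * q)"
  for p q :: "'k :: monoid_add \<Rightarrow>\<^sub>0 complex"
proof -
  have "p * Poly_Mapping.single 0 c = fscale c p"
  proof (rule lin_eqI[where f = "\<lambda>p. p * Poly_Mapping.single 0 c" and g = "fscale c", OF cvs_free_vs cvs_free_vs])
    show "p \<in> lspan (free_vs UNIV) ((\<lambda>x. Poly_Mapping.single x 1) ` UNIV)"
      using free_vs_span[of UNIV] by auto
    show "(\<lambda>p. p * Poly_Mapping.single 0 c) \<in> lin (free_vs UNIV) (free_vs UNIV)"
      by (rule linI) (simp_all add: distrib_right fscale_mult_left)
    show "fscale c \<in> lin (free_vs UNIV) (free_vs UNIV)"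
      by (rule linI) (simp_all add: fvs.scale_right_distrib mult.commute)
  qed (auto simp: mult_single)
  then show ?thesis
    by (simp add: fscale_def mult_map_scale_conv_mult flip: mult.assoc)
qed

lemma calg_monoid_algebra:
  fixes X :: "'k :: monoid_add set"
  assumes "0 \<in> X" "\<And>x y. \<lbrakk>x \<in> X; y \<in> X\<rbrakk> \<Longrightarrow> x + y \<in> X"
  shows "calg ((free_vs X)\<lparr>mult := (*), one := 1\<rparr>)" (is "calg ?A")
proof (rule calgI)
  have "Poly_Mapping.keys (p * r) \<subseteq> X"
    if "Poly_Mapping.keys p \<subseteq> X" "Poly_Mapping.keys r \<subseteq> X" for p r :: "'k \<Rightarrow>\<^sub>0 complex"
    using keys_mult[of p r] assms(2) that by blast
  then show "bilin ?A ?A ?A (mult ?A)"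
    by (intro bilinI linI)
      (simp_all add: distrib_left distrib_right fscale_mult_left fscale_mult_right)
  show "cvs ?A" by (rule cvs_cong[OF cvs_free_vs[of X]]) simp_all
qed (use assms in \<open>simp_all add: mult.assoc\<close>)

lemma OU1_simps [simp]:
  "carrier OU1 = UNIV" "\<zero>\<^bsub>OU1\<^esub> = 0" "x \<oplus>\<^bsub>OU1\<^esub> y = x + y" "c \<odot>\<^bsub>OU1\<^esub> x = fscale c x"
  "\<one>\<^bsub>OU1\<^esub> = 1" "x \<otimes>\<^bsub>OU1\<^esub> y = x * y"
  by (simp_all add: OU1_def)

lemma calg_OU1: "calg OU1"
  unfolding OU1_def by (rule calg_monoid_algebra) simp_all

lemmas cvs_OU1 = calg_cvs[OF calg_OU1]

lemma OU1_span: "carrier OU1 = lspan OU1 (range (\<lambda>k. Poly_Mapping.single k 1))"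
proof -
  have "x \<in> lspan OU1 X" if "x \<in> lspan (free_vs UNIV) X" for x X
    using that
  proof induction
    case zero then show ?case using lspan.zero[of OU1 X] by simp
  next
    case (add x y) then show ?case using lspan.add[of x OU1 X y] by simp
  next
    case (smult x c) then show ?case using lspan.smult[of x OU1 X c] by simp
  qed (auto intro: lspan.incl)
  then show ?thesis using free_vs_span[of "UNIV :: int set"] by auto
qed

lemma lin_OU1_eq [simp]: "lin (free_vs UNIV) Z = lin OU1 Z"
  by (simp add: lin_def)

subsection \<open>Sums over lists of pairs\<close>

text \<open>A list of pairs is a concrete expression \<Sum> x \<otimes> y, to be evaluated under any
  \<open>F\<close> without passing to cosets. Lists allow repeated terms, and concatenation
  corresponds to addition.\<close>

definition lsum :: "(complex, 'c) module \<Rightarrow> ('a \<Rightarrow> 'b \<Rightarrow> 'c) \<Rightarrow> ('a \<times> 'b) list \<Rightarrow> 'c" where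
  "lsum Z F xs = foldr (\<lambda>(x, y) s. F x y \<oplus>\<^bsub>Z\<^esub> s) xs \<zero>\<^bsub>Z\<^esub>"

lemma lsum_simps [simp]:
  "lsum Z F [] = \<zero>\<^bsub>Z\<^esub>" "lsum Z F ((x, y) # xs) = F x y \<oplus>\<^bsub>Z\<^esub> lsum Z F xs"
  by (simp_all add: lsum_def)

lemma lsum_closed:
  assumes "cvs Z" "\<And>x y. (x, y) \<in> set xs \<Longrightarrow> F x y \<in> carrier Z"
  shows "lsum Z F xs \<in> carrier Z"
proof -
  interpret cvs Z by fact
  show ?thesis using assms(2) by (induction xs) auto
qed

lemma lsum_cong:
  assumes "\<And>x y. (x, y) \<in> set xs \<Longrightarrow> F x y = F' x y"
  shows "lsum Z F xs = lsum Z F' xs"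
  using assms by (induction xs) auto

lemma lin_lsum:
  assumes "cvs Z" "cvs Z'" "L \<in> lin Z Z'" "\<And>x y. (x, y) \<in> set xs \<Longrightarrow> F x y \<in> carrier Z"
  shows "L (lsum Z F xs) = lsum Z' (\<lambda>x y. L (F x y)) xs"
  using assms(4)
proof (induction xs)
  case Nil
  then show ?case using lin_zero[OF assms(1-3)] by simp
next
  case (Cons p xs)
  obtain x y where "p = (x, y)" by (cases p)
  with Cons show ?case
    using lsum_closed[OF assms(1), of xs F] by (auto simp: lin_add[OF assms(3)])
qed

lemma lsum_append:
  assumes "cvs Z" "\<And>x y. (x, y) \<in> set xs \<union> set ys \<Longrightarrow> F x y \<in> carrier Z"
  shows "lsum Z F (xs @ ys) = lsum Z F xs \<oplus>\<^bsub>Z\<^esub> lsum Z F ys"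
proof -
  interpret cvs Z by fact
  have "lsum Z F ys \<in> carrier Z" using assms by (intro lsum_closed) auto
  moreover have "lsum Z F xs \<in> carrier Z" using assms by (intro lsum_closed) auto
  ultimately show ?thesis using assms(2)
  proof (induction xs)
    case (Cons p xs)
    obtain x y where "p = (x, y)" by (cases p)
    with Cons show ?case
      using lsum_closed[OF assms(1), of xs F] by (auto simp: a_assoc)
  qed simp
qed

lemma lsum_lin:
  assumes "cvs Z" "cvs W" "\<And>x y. (x, y) \<in> set xs \<Longrightarrow> (\<lambda>w. F w x y) \<in> lin W Z"
  shows "(\<lambda>w. lsum Z (F w) xs) \<in> lin W Z"
  using assms(3)
proof (induction xs)
  case Nil
  then show ?case by (simp add: lin_const_zero assms)
next
  case (Cons p xs)
  obtain x y where "p = (x, y)" by (cases p)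
  with Cons show ?case by (auto intro!: lin_plus assms(1,2))
qed

subsection \<open>Balanced tensor products\<close>

lemma bal_tensor_rel:
  assumes "cvs M" "cvs N"
    "\<And>x b. \<lbrakk>x \<in> carrier M; b \<in> carrier B\<rbrakk> \<Longrightarrow> ra x b \<in> carrier M"
    "\<And>y b. \<lbrakk>y \<in> carrier N; b \<in> carrier B\<rbrakk> \<Longrightarrow> la b y \<in> carrier N"
  shows "tensor_rel M N (bal_rel B ra la M N)"
proof (intro tensor_rel.intro tensor_rel_axioms.intro subsetI)
  fix r assume "r \<in> bal_rel B ra la M N"
  then obtain x b y where *: "x \<in> carrier M" "b \<in> carrier B" "y \<in> carrier N"
      "r = Poly_Mapping.single (ra x b, y) 1 - Poly_Mapping.single (x, la b y) 1"
    by (auto simp: bal_rel_def)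
  have "Poly_Mapping.keys r \<subseteq> {(ra x b, y), (x, la b y)}"
    using keys_diff[of "Poly_Mapping.single (ra x b, y) (1::complex)" "Poly_Mapping.single (x, la b y) 1"] *(4)
    by auto
  then show "r \<in> carrier (free_vs (carrier M \<times> carrier N))" using * assms by auto
qed (use assms in auto)

lemma bal_pure_eq:
  assumes "tensor_rel M N (bal_rel B ra la M N)"
    "x \<in> carrier M" "b \<in> carrier B" "y \<in> carrier N" "ra x b \<in> carrier M" "la b y \<in> carrier N"
  shows "pure M N (bal_rel B ra la M N) (ra x b) y = pure M N (bal_rel B ra la M N) x (la b y)"
  by (rule tensor_rel.pure_eq[OF assms(1)]) (use assms in \<open>auto simp: bal_rel_def\<close>)

lemma descends_bal:
  assumes "cvs Z" "bilin M N Z f"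
    "\<And>x b. \<lbrakk>x \<in> carrier M; b \<in> carrier B\<rbrakk> \<Longrightarrow> ra x b \<in> carrier M"
    "\<And>y b. \<lbrakk>y \<in> carrier N; b \<in> carrier B\<rbrakk> \<Longrightarrow> la b y \<in> carrier N"
    "\<And>x b y. \<lbrakk>x \<in> carrier M; b \<in> carrier B; y \<in> carrier N\<rbrakk> \<Longrightarrow> f (ra x b) y = f x (la b y)"
  shows "descends Z f (bal_rel B ra la M N)"
  unfolding descends_def
proof
  interpret Z: cvs Z by fact
  fix r assume "r \<in> bal_rel B ra la M N"
  then obtain x b y where *: "x \<in> carrier M" "b \<in> carrier B" "y \<in> carrier N"
      "r = Poly_Mapping.single (ra x b, y) 1 - Poly_Mapping.single (x, la b y) 1"
    by (auto simp: bal_rel_def)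
  have c: "f x (la b y) \<in> carrier Z" "f (ra x b) y \<in> carrier Z"
    using * assms(3,4) bilin_closed[OF assms(2)] by auto
  have "flin Z (\<lambda>k. f (fst k) (snd k)) r =
      flin Z (\<lambda>k. f (fst k) (snd k)) (Poly_Mapping.single (ra x b, y) 1)
      \<ominus>\<^bsub>Z\<^esub> flin Z (\<lambda>k. f (fst k) (snd k)) (Poly_Mapping.single (x, la b y) 1)"
    unfolding *(4) using assms(1,3,4) * bilin_closed[OF assms(2)]
    by (intro flin_diff[of Z "carrier M \<times> carrier N"]) auto
  also have "\<dots> = f x (la b y) \<ominus>\<^bsub>Z\<^esub> f x (la b y)"
    using c assms(5)[OF *(1-3)] by simp
  also have "\<dots> = \<zero>\<^bsub>Z\<^esub>"
    unfolding Z.minus_eq using c(1) by (rule Z.r_neg)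
  finally show "flin Z (\<lambda>k. f (fst k) (snd k)) r = \<zero>\<^bsub>Z\<^esub>" .
qed

section \<open>Strongly graded algebras\<close>

definition homog ::
  "(complex, 'a) module \<Rightarrow> ('a \<Rightarrow> ('a \<times> (int \<Rightarrow>\<^sub>0 complex) \<Rightarrow>\<^sub>0 complex) set) \<Rightarrow> int \<Rightarrow> 'a set" where
  "homog A rho k = {a \<in> carrier A. rho a = tpure A OU1 a (Poly_Mapping.single k 1)}"

lemma alg_hom_lin: "f \<in> alg_hom A B \<Longrightarrow> f \<in> lin A B"
  by (auto simp: alg_hom_def ring_hom_def lin_def)

lemma alg_hom_mult: "f \<in> alg_hom A B \<Longrightarrow> x \<in> carrier A \<Longrightarrow> y \<in> carrier A \<Longrightarrow> f (x \<otimes>\<^bsub>A\<^esub> y) = f x \<otimes>\<^bsub>B\<^esub> f y"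
  and alg_hom_one: "f \<in> alg_hom A B \<Longrightarrow> f \<one>\<^bsub>A\<^esub> = \<one>\<^bsub>B\<^esub>"
  by (auto simp: alg_hom_def ring_hom_def)

lemma alg_homI:
  assumes "f \<in> lin A B" "f \<one>\<^bsub>A\<^esub> = \<one>\<^bsub>B\<^esub>"
    "\<And>x y. \<lbrakk>x \<in> carrier A; y \<in> carrier A\<rbrakk> \<Longrightarrow> f (x \<otimes>\<^bsub>A\<^esub> y) = f x \<otimes>\<^bsub>B\<^esub> f y"
  shows "f \<in> alg_hom A B"
  using assms by (auto simp: alg_hom_def ring_hom_def lin_def)

locale strongly_graded = calg A for A :: "(complex, 'a) module" (structure) +
  fixes rho :: "'a \<Rightarrow> ('a \<times> (int \<Rightarrow>\<^sub>0 complex) \<Rightarrow>\<^sub>0 complex) set"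
  assumes rho_hom: "rho \<in> alg_hom A (tens_alg A OU1)"
    and homog_span: "carrier A = lspan A (\<Union>k. homog A rho k)"
    and one_plus: "\<one> \<in> lspan A {x \<otimes> y | x y. x \<in> homog A rho 1 \<and> y \<in> homog A rho (-1)}"
    and one_minus: "\<one> \<in> lspan A {x \<otimes> y | x y. x \<in> homog A rho (-1) \<and> y \<in> homog A rho 1}"
begin

abbreviation "G \<equiv> homog A rho"
abbreviation U :: "int \<Rightarrow> int \<Rightarrow>\<^sub>0 complex" where "U k \<equiv> Poly_Mapping.single k 1"
abbreviation "B \<equiv> coinv A OU1 rho"
abbreviation "AA \<equiv> tens A A"
abbreviation "AH \<equiv> tens A OU1"
abbreviation aa (infixl "\<star>" 72) where "x \<star> y \<equiv> tpure A A x y"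

sublocale AH: two_calg A OU1
  by (intro two_calg.intro calg_axioms calg_OU1)

lemmas cvsA = cvs_axioms
lemmas cvsAA = tens_cvs[OF cvsA cvsA]
lemmas cvsAH = tens_cvs[OF cvsA cvs_OU1]

lemma rho_lin: "rho \<in> lin A AH"
  using alg_hom_lin[OF rho_hom] by (simp add: lin_def)

lemma G_carrier: "a \<in> G k \<Longrightarrow> a \<in> carrier A"
  and G_rho: "a \<in> G k \<Longrightarrow> rho a = tpure A OU1 a (U k)"
  by (simp_all add: homog_def)

lemma G_I: "a \<in> carrier A \<Longrightarrow> rho a = tpure A OU1 a (U k) \<Longrightarrow> a \<in> G k"
  by (simp add: homog_def)

lemma coinv_simps [simp]: "carrier B = G 0"
  by (auto simp: coinv_def homog_def)

lemma G_one: "\<one> \<in> G 0"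
  using alg_hom_one[OF rho_hom] by (intro G_I) simp_all

lemma G_mult: "a \<in> G k \<Longrightarrow> b \<in> G l \<Longrightarrow> a \<otimes> b \<in> G (k + l)"
  using alg_hom_mult[OF rho_hom, of a b] AH.tens_mult_pure[of a "U k" b "U l"]
  by (intro G_I) (simp_all add: G_carrier G_rho mult_single)

lemma G_smult: "a \<in> G k \<Longrightarrow> c \<odot> a \<in> G k"
  using lin_smult[OF rho_lin, of a c]
  by (intro G_I) (simp_all add: G_carrier G_rho tpure_smult1 cvsA cvs_OU1)

lemma G_mult_eq: "a \<in> G k \<Longrightarrow> b \<in> G l \<Longrightarrow> m = k + l \<Longrightarrow> a \<otimes> b \<in> G m"
  using G_mult by simp

text \<open>Such a list represents the value of the translation map at \<open>u\<^sup>k\<close>.\<close>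

definition unit_decomp :: "int \<Rightarrow> ('a \<times> 'a) list \<Rightarrow> bool" where
  "unit_decomp k xs \<longleftrightarrow> set xs \<subseteq> G (-k) \<times> G k \<and> lsum A (\<otimes>) xs = \<one>"

abbreviation "prods k \<equiv> {x \<otimes> y | x y. x \<in> G (-k) \<and> y \<in> G k}"

lemma prods_carrier: "prods k \<subseteq> carrier A"
  by (auto intro: G_carrier)

text \<open>Insert the decomposition of 1 for \<open>l\<close> between the factors of the one for
  \<open>k\<close>: x y = \<Sum> x x' y' y, where x x' has degree -(k + l) and y' y has degree k +
  l.\<close>

lemma one_in_prods_step:
  assumes "\<one> \<in> lspan A (prods k)" "\<one> \<in> lspan A (prods l)"
  shows "\<one> \<in> lspan A (prods (k + l))"
proof -
  have "x \<otimes> y \<in> lspan A (prods (k + l))" if x: "x \<in> G (-k)" and y: "y \<in> G k" for x y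
  proof -
    have "(\<lambda>d. x \<otimes> d \<otimes> y) \<in> lin A A"
      by (intro mult_lin1 mult_lin2 lin_id calg_axioms G_carrier[OF x] G_carrier[OF y])
    from lin_image_lspan[OF cvsA cvsA this prods_carrier assms(2)]
    have "x \<otimes> \<one> \<otimes> y \<in> lspan A ((\<lambda>d. x \<otimes> d \<otimes> y) ` prods l)" .
    also have "\<dots> \<subseteq> lspan A (prods (k + l))"
    proof (rule lspan_subset, safe)
      fix x' y' assume *: "x' \<in> G (-l)" "y' \<in> G l"
      have "x \<otimes> (x' \<otimes> y') \<otimes> y = (x \<otimes> x') \<otimes> (y' \<otimes> y)"
        using * x y G_carrier by (simp add: m_assoc)
      moreover have "x \<otimes> x' \<in> G (-(k + l))" "y' \<otimes> y \<in> G (k + l)"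
        using x y * by (auto intro: G_mult_eq)
      ultimately show "x \<otimes> (x' \<otimes> y') \<otimes> y \<in> lspan A (prods (k + l))"
        by (intro lspan.incl) auto
    qed
    finally show ?thesis using G_carrier[OF x] by simp
  qed
  then have "lspan A (prods k) \<subseteq> lspan A (prods (k + l))"
    by (intro lspan_subset) auto
  with assms(1) show ?thesis by auto
qed

lemma one_in_prods: "\<one> \<in> lspan A (prods k)"
proof (induction k rule: int_induct[of _ 0])
  case base
  have "\<one> \<otimes> \<one> \<in> lspan A (prods 0)" using G_one by (intro lspan.incl) force
  then show ?case by simp
next
  case (step1 i)
  then show ?case using one_in_prods_step[of i 1] one_minus by simp
next
  case (step2 i)
  then show ?case using one_in_prods_step[of i "-1"] one_plus by simp
qed

text \<open>An element of the span becomes a sum of products over a list: addition is concatenation,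
  and scalars are absorbed into the first entries, which keep their degree.\<close>

lemma unit_decomp_exists: "\<exists>xs. unit_decomp k xs"
proof -
  have "\<exists>xs. set xs \<subseteq> G (-k) \<times> G k \<and> lsum A (\<otimes>) xs = d" if "d \<in> lspan A (prods k)" for d
    using that
  proof induction
    case zero
    show ?case by (rule exI[of _ "[]"]) simp
  next
    case (incl d)
    then obtain x y where "x \<in> G (-k)" "y \<in> G k" "d = x \<otimes> y" by auto
    then show ?case by (intro exI[of _ "[(x, y)]"]) (simp add: G_carrier)
  next
    case (add d e)
    then obtain xs ys where *: "set xs \<subseteq> G (-k) \<times> G k" "lsum A (\<otimes>) xs = d"
      "set ys \<subseteq> G (-k) \<times> G k" "lsum A (\<otimes>) ys = e" by blast
    have "x \<otimes> y \<in> carrier A" if "(x, y) \<in> set xs \<union> set ys" for x y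
      using that *(1,3) by (blast intro: G_carrier m_closed)
    then have "lsum A (\<otimes>) (xs @ ys) = lsum A (\<otimes>) xs \<oplus> lsum A (\<otimes>) ys"
      by (rule lsum_append[OF cvsA])
    then show ?case
      using * by (intro exI[of _ "xs @ ys"]) simp
  next
    case (smult d c)
    then obtain xs where *: "set xs \<subseteq> G (-k) \<times> G k" "lsum A (\<otimes>) xs = d" by blast
    have xs: "x \<in> G (-k) \<and> y \<in> G k" if "(x, y) \<in> set xs" for x y using that * by blast
    have "lsum A (\<otimes>) (map (\<lambda>(x, y). (c \<odot> x, y)) xs) = lsum A (\<lambda>x y. c \<odot> (x \<otimes> y)) xs"
      using xs
    proof (induction xs)
      case (Cons p xs)
      obtain x y where p: "p = (x, y)" by (cases p)
      then have "x \<in> carrier A" "y \<in> carrier A" using Cons.prems by (auto intro: G_carrier)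
      moreover have "lsum A (\<otimes>) (map (\<lambda>(x, y). (c \<odot> x, y)) xs) = lsum A (\<lambda>x y. c \<odot> (x \<otimes> y)) xs"
        by (rule Cons.IH) (use Cons.prems in auto)
      ultimately show ?case using p by (simp add: smult_assoc2)
    qed simp
    also have "\<dots> = c \<odot> d"
      unfolding *(2)[symmetric]
      by (rule lin_lsum[OF cvsA cvsA lin_smult_const[OF cvsA lin_id], symmetric])
        (auto dest!: xs intro: G_carrier)
    finally show ?case
      using xs by (intro exI[of _ "map (\<lambda>(x, y). (c \<odot> x, y)) xs"]) (auto intro: G_smult)
  qed
  then show ?thesis using one_in_prods unfolding unit_decomp_def by blast
qed

text \<open>An arbitrary choice of decomposition. Its class in A \<otimes>_B A is nevertheless
  determined, since \<open>chi_trn\<close> and \<open>chi_inj\<close> identify it as the only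
  preimage of 1 \<otimes> u^k under the canonical map.\<close>

definition tau :: "int \<Rightarrow> ('a \<times> 'a) list" where
  "tau k = (SOME xs. unit_decomp k xs)"

lemma tau: "(x, y) \<in> set (tau k) \<Longrightarrow> x \<in> G (-k)" "(x, y) \<in> set (tau k) \<Longrightarrow> y \<in> G k"
  "lsum A (\<otimes>) (tau k) = \<one>"
proof -
  have "unit_decomp k (tau k)"
    unfolding tau_def by (rule someI_ex[OF unit_decomp_exists])
  then show "(x, y) \<in> set (tau k) \<Longrightarrow> x \<in> G (-k)" "(x, y) \<in> set (tau k) \<Longrightarrow> y \<in> G k"
    "lsum A (\<otimes>) (tau k) = \<one>"
    unfolding unit_decomp_def by auto
qed

lemmas tau_carrier = tau(1)[THEN G_carrier] tau(2)[THEN G_carrier]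

text \<open>The form in which \<Sum> x y = 1 enters all computations: once balancing has brought x
  and y next to each other, each term depends linearly on the product x y alone, and the sum is the
  value at 1.\<close>

lemma tau_collapse:
  assumes "cvs Z" "L \<in> lin A Z" "\<And>x y. (x, y) \<in> set (tau k) \<Longrightarrow> F x y = L (x \<otimes> y)"
  shows "lsum Z F (tau k) = L \<one>"
proof -
  have "lsum Z F (tau k) = lsum Z (\<lambda>x y. L (x \<otimes> y)) (tau k)"
    by (rule lsum_cong) (rule assms(3))
  also have "\<dots> = L (lsum A (\<otimes>) (tau k))"
    by (rule lin_lsum[OF cvsA assms(1,2), symmetric]) (auto dest: tau_carrier)
  finally show ?thesis by (simp add: tau(3))
qed

lemma lin_eq_homog:
  assumes "cvs Z" "f \<in> lin A Z" "g \<in> lin A Z" "\<And>k a. a \<in> G k \<Longrightarrow> f a = g a" "a \<in> carrier A"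
  shows "f a = g a"
  by (rule lin_eqI[OF cvsA assms(1-3), of "\<Union>k. G k"])
    (use assms(4,5) homog_span in \<open>auto intro: G_carrier\<close>)

subsection \<open>The translation map\<close>

abbreviation "CT \<equiv> tensor A A (can_rel A OU1 rho)"
abbreviation "cp \<equiv> pure A A (can_rel A OU1 rho)"

sublocale CT: tensor_rel A A "can_rel A OU1 rho"
  unfolding can_rel_def by (rule bal_tensor_rel) (auto simp: cvsA dest: G_carrier)

lemma cp_balanced:
  assumes "a \<in> carrier A" "b \<in> G 0" "a' \<in> carrier A"
  shows "cp (a \<otimes> b) a' = cp a (b \<otimes> a')"
  using assms bal_pure_eq[of A A B "(\<otimes>)" "(\<otimes>)" a b a'] CT.tensor_rel_axioms
  by (simp add: can_rel_def G_carrier)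

definition chi_fun :: "'a \<Rightarrow> 'a \<Rightarrow> _" where
  "chi_fun a a' = sweedler AH (\<lambda>a0' a1'. tpure A OU1 (a \<otimes> a0') a1') (rho a')"

lemma chi_inner_bilin: "a \<in> carrier A \<Longrightarrow> bilin A OU1 AH (\<lambda>a0' a1'. tpure A OU1 (a \<otimes> a0') a1')"
  by (intro bilinI tpure_lin1 tpure_lin2 mult_lin2 lin_id cvsA cvs_OU1 calg_axioms m_closed)

lemma chi_fun_bilin: "bilin A A AH chi_fun"
proof (rule bilinI)
  fix a assume "a \<in> carrier A"
  then have "chi_fun a = (\<lambda>a'. sweedler AH (\<lambda>a0' a1'. tpure A OU1 (a \<otimes> a0') a1') (rho a'))"
    by (simp add: chi_fun_def fun_eq_iff)
  then show "chi_fun a \<in> lin A AH"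
    using \<open>a \<in> carrier A\<close>
    by (simp add: tens_sweedler_lin[OF cvsA cvs_OU1 cvsAH chi_inner_bilin rho_lin])
next
  fix a' assume "a' \<in> carrier A"
  then have "rho a' \<in> carrier AH" by (rule lin_closed[OF rho_lin])
  then show "(\<lambda>a. chi_fun a a') \<in> lin A AH"
    unfolding chi_fun_def
    by (intro tensor_rel.sweedler_fun_lin[OF tens_tensor_rel[OF cvsA cvs_OU1]] cvsAH cvsA
        tpure_lin1 mult_lin1 lin_id calg_axioms cvs_OU1)
qed

lemma chi_fun_homog: "a \<in> carrier A \<Longrightarrow> a' \<in> G k \<Longrightarrow> chi_fun a a' = tpure A OU1 (a \<otimes> a') (U k)"
  by (simp add: chi_fun_def G_rho tens_sweedler_pure[OF cvsA cvs_OU1 cvsAH chi_inner_bilin] G_carrier)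

text \<open>By linearity a' may be taken homogeneous; multiplying it by an element of degree 0 does
  not change the power of u that the coaction attaches to it.\<close>

lemma chi_fun_balanced:
  assumes "a \<in> carrier A" "b \<in> G 0" "a' \<in> carrier A"
  shows "chi_fun (a \<otimes> b) a' = chi_fun a (b \<otimes> a')"
proof (rule lin_eq_homog[OF cvsAH _ _ _ assms(3)])
  have b: "b \<in> carrier A" using assms(2) by (rule G_carrier)
  show "chi_fun (a \<otimes> b) \<in> lin A AH"
    using assms b by (intro bilin_right[OF chi_fun_bilin]) simp
  show "(\<lambda>a'. chi_fun a (b \<otimes> a')) \<in> lin A AH"
    using assms b by (intro bilin_lin_comp2[OF chi_fun_bilin] mult_lin2 lin_id calg_axioms)
  fix k a' assume a': "a' \<in> G k"
  then have "b \<otimes> a' \<in> G k" using assms(2) by (auto intro: G_mult_eq)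
  then show "chi_fun (a \<otimes> b) a' = chi_fun a (b \<otimes> a')"
    using assms(1) b a' by (simp add: chi_fun_homog G_carrier m_assoc)
qed

lemma chi_fun_descends: "descends AH chi_fun (can_rel A OU1 rho)"
  unfolding can_rel_def
  by (rule descends_bal[OF cvsAH chi_fun_bilin]) (auto simp: chi_fun_balanced dest: G_carrier)

lemma can_map_eq: "can_map A OU1 rho = sweedler AH chi_fun"
  by (simp add: fun_eq_iff can_map_def chi_fun_def[abs_def])

lemma chi_lin: "can_map A OU1 rho \<in> lin CT AH"
  unfolding can_map_eq by (rule CT.sweedler_lin[OF cvsAH chi_fun_bilin chi_fun_descends])

lemma chi_pure: "a \<in> carrier A \<Longrightarrow> a' \<in> carrier A \<Longrightarrow> can_map A OU1 rho (cp a a') = chi_fun a a'"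
  unfolding can_map_eq by (rule CT.sweedler_pure[OF cvsAH chi_fun_bilin chi_fun_descends])

text \<open>The candidate for the translation map, prescribed on the basis u^k of the Laurent
  polynomials; \<open>transl_eq\<close> confirms it.\<close>

definition trn :: "(int \<Rightarrow>\<^sub>0 complex) \<Rightarrow> _" where
  "trn = flin CT (\<lambda>k. lsum CT cp (tau k))"

lemma trn_sum_closed: "lsum CT cp (tau k) \<in> carrier CT"
  by (rule lsum_closed[OF CT.tensor_cvs]) (auto dest: tau_carrier)

lemma trn_lin: "trn \<in> lin OU1 CT"
  unfolding trn_def using CT.T.flin_lin[of UNIV "\<lambda>k. lsum CT cp (tau k)"] trn_sum_closed by simp

lemma trn_single: "trn (U k) = lsum CT cp (tau k)"
  unfolding trn_def using CT.T.flin_single[where f = "\<lambda>k. lsum CT cp (tau k)" and k = k and c = 1] trn_sum_closed by simp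

text \<open>Induces the inverse of the canonical map.\<close>

definition psi_fun :: "'a \<Rightarrow> (int \<Rightarrow>\<^sub>0 complex) \<Rightarrow> _" where
  "psi_fun a = flin CT (\<lambda>k. lsum CT (\<lambda>x y. cp (a \<otimes> x) y) (tau k))"

lemma psi_sum_closed: "a \<in> carrier A \<Longrightarrow> lsum CT (\<lambda>x y. cp (a \<otimes> x) y) (tau k) \<in> carrier CT"
  by (rule lsum_closed[OF CT.tensor_cvs]) (auto dest: tau_carrier)

lemma psi_fun_bilin: "bilin A OU1 CT psi_fun"
proof (rule bilinI)
  fix h show "(\<lambda>a. psi_fun a h) \<in> lin A CT"
    unfolding psi_fun_def
    by (intro CT.T.flin_fun_lin lsum_lin bilin_lin_comp1[OF CT.pure_bilin] mult_lin1 lin_id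
        CT.tensor_cvs cvsA calg_axioms) (auto dest: tau_carrier)
next
  fix a assume "a \<in> carrier A"
  then show "psi_fun a \<in> lin OU1 CT"
    unfolding psi_fun_def using CT.T.flin_lin[of UNIV "\<lambda>k. lsum CT (\<lambda>x y. cp (a \<otimes> x) y) (tau k)"] psi_sum_closed by simp
qed

text \<open>The map induced by \<open>psi_fun\<close> is a left inverse. For a' of degree k it
  returns \<Sum> a a' x \<otimes>_B y. Here a' x has degree 0, hence lies in B and may cross the
  tensor sign, which leaves a \<otimes>_B a' \<Sum> x y = a \<otimes>_B a'.\<close>

lemma chi_inj: "inj_on (can_map A OU1 rho) (carrier CT)"
proof (rule inj_on_inverseI)
  fix P assume P: "P \<in> carrier CT"
  have psi_lin: "sweedler CT psi_fun \<in> lin AH CT"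
    using tens_sweedler_lin[OF cvsA cvs_OU1 CT.tensor_cvs psi_fun_bilin lin_id] .
  have comp: "(\<lambda>P. sweedler CT psi_fun (can_map A OU1 rho P)) \<in> lin CT CT"
    by (rule lin_comp[OF chi_lin psi_lin])
  show "sweedler CT psi_fun (can_map A OU1 rho P) = P"
  proof (rule CT.tensor_eqI[OF CT.tensor_cvs comp lin_id _ P])
    fix a a' assume a: "a \<in> carrier A" "a' \<in> carrier A"
    show "sweedler CT psi_fun (can_map A OU1 rho (cp a a')) = cp a a'"
    proof (rule lin_eq_homog[OF CT.tensor_cvs _ _ _ a(2)])
      show "(\<lambda>a'. sweedler CT psi_fun (can_map A OU1 rho (cp a a'))) \<in> lin A CT"
        by (rule lin_comp[OF bilin_right[OF CT.pure_bilin a(1)] comp])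
      show "cp a \<in> lin A CT" by (rule bilin_right[OF CT.pure_bilin a(1)])
      fix k a' assume a': "a' \<in> G k"
      then have c: "a' \<in> carrier A" "a \<otimes> a' \<in> carrier A" using a(1) by (auto intro: G_carrier)
      have "sweedler CT psi_fun (can_map A OU1 rho (cp a a')) = psi_fun (a \<otimes> a') (U k)"
        using a(1) a' c tens_sweedler_pure[OF cvsA cvs_OU1 CT.tensor_cvs psi_fun_bilin]
        by (simp add: chi_pure chi_fun_homog)
      also have "\<dots> = lsum CT (\<lambda>x y. cp (a \<otimes> a' \<otimes> x) y) (tau k)"
        unfolding psi_fun_def using c psi_sum_closed by simp
      also have "\<dots> = cp a (a' \<otimes> \<one>)"
      proof (rule tau_collapse[OF CT.tensor_cvs])
        show "(\<lambda>t. cp a (a' \<otimes> t)) \<in> lin A CT"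
          by (intro bilin_lin_comp2[OF CT.pure_bilin] mult_lin2 lin_id calg_axioms a(1) c(1))
        fix x y assume xy: "(x, y) \<in> set (tau k)"
        have "a' \<otimes> x \<in> G 0" using a' tau(1)[OF xy] by (auto intro: G_mult_eq)
        then have "cp (a \<otimes> (a' \<otimes> x)) y = cp a (a' \<otimes> x \<otimes> y)"
          using a(1) tau_carrier[OF xy] by (intro cp_balanced)
        then show "cp (a \<otimes> a' \<otimes> x) y = cp a (a' \<otimes> (x \<otimes> y))"
          using a(1) c(1) tau_carrier[OF xy] by (simp add: m_assoc)
      qed
      finally show "sweedler CT psi_fun (can_map A OU1 rho (cp a a')) = cp a a'"
        using c by simp
    qed
  qed
qed

text \<open>At h = u^k each y in \<open>tau k\<close> has degree k, so the value is \<Sum> x y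
  \<otimes> u^k, and the first leg sums to 1.\<close>

lemma chi_trn: "can_map A OU1 rho (trn h) = tpure A OU1 \<one> h"
proof (rule lin_eqI[where g = "tpure A OU1 \<one>", OF cvs_OU1 cvsAH lin_comp[OF trn_lin chi_lin]])
  show "h \<in> lspan OU1 (range U)" using OU1_span by auto
  show "tpure A OU1 \<one> \<in> lin OU1 AH"
    using tpure_lin2[OF cvsA cvs_OU1 lin_id] by simp
  fix h assume "h \<in> range U"
  then obtain k where h: "h = U k" by auto
  have "can_map A OU1 rho (trn h) = lsum AH (\<lambda>x y. can_map A OU1 rho (cp x y)) (tau k)"
    unfolding h trn_single by (rule lin_lsum[OF CT.tensor_cvs cvsAH chi_lin]) (auto dest: tau_carrier)
  also have "\<dots> = tpure A OU1 \<one> (U k)"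
  proof (rule tau_collapse[OF cvsAH tpure_lin1[OF cvsA cvs_OU1 lin_id]])
    fix x y assume "(x, y) \<in> set (tau k)"
    then show "can_map A OU1 rho (cp x y) = tpure A OU1 (x \<otimes> y) (U k)"
      using tau(1,2)[of x y k] tau_carrier[of x y k] by (simp add: chi_pure chi_fun_homog)
  qed simp
  finally show "can_map A OU1 rho (trn h) = tpure A OU1 \<one> h" by (simp add: h)
qed simp

text \<open>Injectivity of the canonical map together with the explicit preimage
  \<open>trn h\<close> determines the value of \<open>inv_into\<close>.\<close>

lemma transl_eq: "transl A OU1 rho h = trn h"
  unfolding transl_def
  using lin_closed[OF trn_lin] by (intro inv_into_f_eq[OF chi_inj]) (simp_all add: chi_trn)

end

section \<open>The Ehresmann--Schauenburg bialgebroid of a strongly graded algebra\<close>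

lemma tens_opp [simp]: "tens A (opp A') = tens A A'" "tpure A (opp A') = tpure A A'"
  by (simp_all add: tensor_def pure_def tensor_null_def bilin_rel_def fun_eq_iff)

lemma lspan_cong:
  assumes "\<zero>\<^bsub>M\<^esub> = \<zero>\<^bsub>N\<^esub>" "add M = add N" "smult M = smult N"
  shows "lspan M X = lspan N X"
proof (intro equalityI subsetI)
  show "x \<in> lspan N X" if "x \<in> lspan M X" for x
    using that by induction (simp_all add: assms lspan.intros)
  show "x \<in> lspan M X" if "x \<in> lspan N X" for x
    using that by induction (simp_all add: lspan.intros flip: assms)
qed

context strongly_graded
begin

abbreviation "E \<equiv> env_alg A"
abbreviation "C \<equiv> es_alg A OU1 rho"

sublocale E: two_calg A "opp A"
  by (intro two_calg.intro calg_axioms calg_opp)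

lemma E_simps [simp]:
  "carrier E = carrier AA" "\<zero>\<^bsub>E\<^esub> = \<zero>\<^bsub>AA\<^esub>" "add E = add AA" "smult E = smult AA" "\<one>\<^bsub>E\<^esub> = \<one> \<star> \<one>"
  by (simp_all add: env_alg_def)

lemma C_simps [simp]:
  "\<zero>\<^bsub>C\<^esub> = \<zero>\<^bsub>AA\<^esub>" "add C = add AA" "smult C = smult AA" "\<one>\<^bsub>C\<^esub> = \<one> \<star> \<one>" "mult C = mult E"
  by (simp_all add: env_alg_def es_alg_def)

lemma calg_E: "calg E"
  unfolding env_alg_def by (rule E.calg_tens_alg)

abbreviation emult (infixl "\<bullet>" 70) where "P \<bullet> Q \<equiv> P \<otimes>\<^bsub>E\<^esub> Q"

abbreviation "cop \<equiv> es_coprod A OU1 rho"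
abbreviation "big_cop \<equiv> es_coprod_big A OU1 rho"

lemma E_mult:
  "\<lbrakk>a \<in> carrier A; b \<in> carrier A; c \<in> carrier A; d \<in> carrier A\<rbrakk> \<Longrightarrow>
   (a \<star> b) \<bullet> (c \<star> d) = (a \<otimes> c) \<star> (d \<otimes> b)"
  using E.tens_mult_pure[of a b c d] by (simp add: env_alg_def)

lemma star_closed [simp]: "\<lbrakk>a \<in> carrier A; b \<in> carrier A\<rbrakk> \<Longrightarrow> a \<star> b \<in> carrier AA"
  by (rule tpure_closed[OF cvsA cvsA])

lemma star_lin1: "g \<in> lin W A \<Longrightarrow> b \<in> carrier A \<Longrightarrow> (\<lambda>w. g w \<star> b) \<in> lin W AA"
  and star_lin2: "g \<in> lin W A \<Longrightarrow> a \<in> carrier A \<Longrightarrow> (\<lambda>w. a \<star> g w) \<in> lin W AA"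
  by (rule tpure_lin1[OF cvsA cvsA], assumption+) (rule tpure_lin2[OF cvsA cvsA], assumption+)

lemma rho_sweedler_lin:
  "cvs Z \<Longrightarrow> bilin A OU1 Z f \<Longrightarrow> (\<lambda>a. sweedler Z f (rho a)) \<in> lin A Z"
  by (rule tens_sweedler_lin[OF cvsA cvs_OU1 _ _ rho_lin])

lemma rho_sweedler_homog:
  "cvs Z \<Longrightarrow> bilin A OU1 Z f \<Longrightarrow> a \<in> G k \<Longrightarrow> sweedler Z f (rho a) = f a (U k)"
  by (simp add: G_rho G_carrier tens_sweedler_pure[OF cvsA cvs_OU1])

lemma rho_sweedler_fun_lin:
  assumes "cvs Z" "cvs W" "a \<in> carrier A" "\<And>x h. x \<in> carrier A \<Longrightarrow> (\<lambda>w. f w x h) \<in> lin W Z"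
  shows "(\<lambda>w. sweedler Z (f w) (rho a)) \<in> lin W Z"
  using assms
  by (intro tensor_rel.sweedler_fun_lin[OF tens_tensor_rel[OF cvsA cvs_OU1]] lin_closed[OF rho_lin]) auto

subsection \<open>Coinvariants of the diagonal coaction\<close>

abbreviation "A3 \<equiv> tens A AH"

lemmas cvsA3 = tens_cvs[OF cvsA cvsAH]

definition diag_fun :: "'a \<Rightarrow> 'a \<Rightarrow> _" where
  "diag_fun a a' = sweedler A3 (\<lambda>a0 a1. sweedler A3 (\<lambda>a0' a1'.
     tpure A AH a0 (tpure A OU1 a0' (a1 \<otimes>\<^bsub>OU1\<^esub> a1'))) (rho a')) (rho a)"

text \<open>\<open>diag\<close> is the diagonal coaction on A \<otimes> A, and \<open>ext\<close>
  below is P \<mapsto> P \<otimes> 1. The carrier of C is the set on which the two agree.\<close>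

definition "diag = sweedler A3 diag_fun"

definition "ext = sweedler A3 (\<lambda>a a'. tpure A AH a (tpure A OU1 a' \<one>\<^bsub>OU1\<^esub>))"

lemma carrier_C: "carrier C = {P \<in> carrier AA. diag P = ext P}"
  by (simp add: es_alg_def env_alg_def diag_def ext_def diag_fun_def[abs_def])

lemma diag_inner_bilin:
  assumes "a0 \<in> carrier A"
  shows "bilin A OU1 A3 (\<lambda>a0' a1'. tpure A AH a0 (tpure A OU1 a0' (a1 \<otimes>\<^bsub>OU1\<^esub> a1')))"
  using assms
  by (intro bilinI tpure_lin2 tpure_lin1 mult_lin2 lin_id calg_OU1 cvsA cvsAH cvs_OU1) auto

lemma diag_outer_bilin:
  assumes "a' \<in> carrier A"
  shows "bilin A OU1 A3 (\<lambda>a0 a1. sweedler A3 (\<lambda>a0' a1'.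
     tpure A AH a0 (tpure A OU1 a0' (a1 \<otimes>\<^bsub>OU1\<^esub> a1'))) (rho a'))"
  using assms tpure_closed[OF cvsA cvs_OU1]
  by (intro bilinI rho_sweedler_fun_lin tpure_lin2 tpure_lin1 mult_lin1 lin_id calg_OU1 cvsA cvsA3 cvsAH cvs_OU1) auto

lemma diag_fun_bilin: "bilin A A A3 diag_fun"
  unfolding diag_fun_def
  by (intro bilinI rho_sweedler_lin[OF cvsA3 diag_outer_bilin] rho_sweedler_fun_lin cvsA3 cvsA
      rho_sweedler_lin[OF cvsA3 diag_inner_bilin])

lemma diag_fun_homog:
  assumes "a \<in> G k" "a' \<in> G l"
  shows "diag_fun a a' = tpure A AH a (tpure A OU1 a' (U (k + l)))"
proof -
  have "diag_fun a a' = sweedler A3 (\<lambda>a0' a1'. tpure A AH a (tpure A OU1 a0' (U k \<otimes>\<^bsub>OU1\<^esub> a1'))) (rho a')"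
    unfolding diag_fun_def
    by (rule rho_sweedler_homog[OF cvsA3 diag_outer_bilin assms(1)]) (rule G_carrier[OF assms(2)])
  also have "\<dots> = tpure A AH a (tpure A OU1 a' (U k \<otimes>\<^bsub>OU1\<^esub> U l))"
    by (rule rho_sweedler_homog[OF cvsA3 diag_inner_bilin assms(2)]) (rule G_carrier[OF assms(1)])
  finally show ?thesis by (simp add: mult_single)
qed

lemma diag_lin: "diag \<in> lin AA A3"
  unfolding diag_def by (rule tens_sweedler_lin[OF cvsA cvsA cvsA3 diag_fun_bilin lin_id])

lemma diag_homog: "a \<in> G k \<Longrightarrow> a' \<in> G l \<Longrightarrow> diag (a \<star> a') = tpure A AH a (tpure A OU1 a' (U (k + l)))"
  unfolding diag_def
  by (simp add: tens_sweedler_pure[OF cvsA cvsA cvsA3 diag_fun_bilin] G_carrier diag_fun_homog)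

lemma ext_bilin: "bilin A A A3 (\<lambda>a a'. tpure A AH a (tpure A OU1 a' \<one>\<^bsub>OU1\<^esub>))"
  using tpure_closed[OF cvsA cvs_OU1]
  by (intro bilinI tpure_lin2 tpure_lin1 lin_id cvsA cvsAH cvs_OU1) auto

lemma ext_lin: "ext \<in> lin AA A3"
  unfolding ext_def by (rule tens_sweedler_lin[OF cvsA cvsA cvsA3 ext_bilin lin_id])

lemma ext_pure: "a \<in> carrier A \<Longrightarrow> a' \<in> carrier A \<Longrightarrow> ext (a \<star> a') = tpure A AH a (tpure A OU1 a' 1)"
  unfolding ext_def using tens_sweedler_pure[OF cvsA cvsA cvsA3 ext_bilin, of a a'] by simp

text \<open>This is the identity of A tensored with the Haar functional of the Laurent polynomials,
  which picks out the coefficient of u^0. Composing the diagonal coaction with it averages over the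
  circle and so projects onto the coinvariants.\<close>

definition "coeff0 = sweedler A (\<lambda>a' h. Poly_Mapping.lookup h 0 \<odot> a')"

lemma coeff0_bilin: "bilin A OU1 A (\<lambda>a' h. Poly_Mapping.lookup h (0 :: int) \<odot> a')"
  by (intro bilinI lin_smult_const lin_id cvsA; rule linI)
    (simp_all add: lookup_add lookup_fscale smult_l_distr smult_assoc1)

lemma coeff0_lin: "coeff0 \<in> lin AH A"
  unfolding coeff0_def by (rule tens_sweedler_lin[OF cvsA cvs_OU1 cvsA coeff0_bilin lin_id])

lemma coeff0_pure: "a \<in> carrier A \<Longrightarrow> coeff0 (tpure A OU1 a (U k)) = (if k = 0 then a else \<zero>)"
  unfolding coeff0_def by (simp add: tens_sweedler_pure[OF cvsA cvs_OU1 cvsA coeff0_bilin] lookup_single)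

definition "proj = sweedler AA (\<lambda>a y. a \<star> coeff0 y)"

lemma proj_bilin: "bilin A AH AA (\<lambda>a y. a \<star> coeff0 y)"
  by (intro bilinI star_lin1 star_lin2 lin_id coeff0_lin lin_closed[OF coeff0_lin])

lemma proj_lin: "proj \<in> lin A3 AA"
  unfolding proj_def by (rule tens_sweedler_lin[OF cvsA cvsAH cvsAA proj_bilin lin_id])

lemma proj_pure: "a \<in> carrier A \<Longrightarrow> y \<in> carrier AH \<Longrightarrow> proj (tpure A AH a y) = a \<star> coeff0 y"
  unfolding proj_def by (rule tens_sweedler_pure[OF cvsA cvsAH cvsAA proj_bilin])

text \<open>The projection of \<open>A \<otimes> A\<close> onto total degree zero retracts it onto \<open>C\<close> and is linear over source and
  target, so that \<open>C \<otimes>\<^sub>B C\<close> embeds into \<open>(A \<otimes> A) \<otimes>\<^sub>B (A \<otimes> A)\<close>.\<close>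

definition deg0 :: "('a \<times> 'a \<Rightarrow>\<^sub>0 complex) set \<Rightarrow> ('a \<times> 'a \<Rightarrow>\<^sub>0 complex) set" where
  "deg0 P = proj (diag P)"

lemma deg0_lin: "deg0 \<in> lin AA AA"
  unfolding deg0_def[abs_def] by (rule lin_comp[OF diag_lin proj_lin])

lemma star_zero: "a \<in> carrier A \<Longrightarrow> a \<star> \<zero> = \<zero>\<^bsub>AA\<^esub>"
  using lin_zero[OF cvsA cvsAA star_lin2[OF lin_id]] .

lemma deg0_homog:
  "a \<in> G k \<Longrightarrow> a' \<in> G l \<Longrightarrow> deg0 (a \<star> a') = (if k + l = 0 then a \<star> a' else \<zero>\<^bsub>AA\<^esub>)"
  by (simp add: deg0_def diag_homog proj_pure G_carrier tpure_closed[OF cvsA cvs_OU1] coeff0_pure star_zero)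

lemma proj_ext:
  assumes "P \<in> carrier AA"
  shows "proj (ext P) = P"
proof (rule tens_eqI[OF cvsA cvsA cvsAA lin_comp[OF ext_lin proj_lin] lin_id _ assms])
  fix x y assume xy: "x \<in> carrier A" "y \<in> carrier A"
  then show "proj (ext (x \<star> y)) = x \<star> y"
    using coeff0_pure[of y 0]
    by (simp add: ext_pure proj_pure tpure_closed[OF cvsA cvs_OU1])
qed

lemma deg0_C: "P \<in> carrier C \<Longrightarrow> deg0 P = P"
  by (simp add: carrier_C deg0_def proj_ext)

abbreviation "homC \<equiv> {a \<star> a' | a a'. \<exists>k. a \<in> G k \<and> a' \<in> G (-k)}"

lemma AA_span_homog: "carrier AA = lspan AA {a \<star> a' | a a'. a \<in> (\<Union>k. G k) \<and> a' \<in> (\<Union>k. G k)}"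
  by (rule tensor_rel.tensor_span_lspan[OF tens_tensor_rel[OF cvsA cvsA] homog_span homog_span])
    (auto intro: G_carrier)

text \<open>Apply \<open>deg0\<close> to an expression of P by the spanning set of A \<otimes> A: P
  is fixed, terms of total degree 0 are kept, and all others vanish. The spanning sets
  \<open>X k\<close> are left open so that both the full homogeneous components and the monomials of
  each degree can be used.\<close>

lemma carrier_C_span:
  assumes X: "\<And>k. X k \<subseteq> G k" "carrier A = lspan A (\<Union>k. X k)"
  shows "carrier C = lspan AA {a \<star> a' | a a'. \<exists>k. a \<in> X k \<and> a' \<in> X (-k)}"
proof (intro equalityI subsetI)
  let ?Y = "{a \<star> a' | a a'. \<exists>k. a \<in> X k \<and> a' \<in> X (-k)}"
  let ?XX = "{a \<star> a' | a a'. a \<in> (\<Union>k. X k) \<and> a' \<in> (\<Union>k. X k)}"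
  have XA: "(\<Union>k. X k) \<subseteq> carrier A" using X(1) by (auto intro: G_carrier)
  fix P assume P: "P \<in> carrier C"
  then have "P \<in> carrier AA" by (simp add: carrier_C)
  then have "P \<in> lspan AA ?XX"
    using tensor_rel.tensor_span_lspan[OF tens_tensor_rel[OF cvsA cvsA] X(2) X(2) XA XA] by simp
  from lin_image_lspan[OF cvsAA cvsAA deg0_lin _ this]
  have "deg0 P \<in> lspan AA (deg0 ` ?XX)" using XA star_closed by blast
  also have "\<dots> \<subseteq> lspan AA ?Y"
  proof (rule lspan_subset, safe)
    fix a a' k l assume a: "a \<in> X k" "a' \<in> X l"
    then have kl: "a \<in> G k" "a' \<in> G l" using X(1) by blast+
    show "deg0 (a \<star> a') \<in> lspan AA ?Y"
    proof (cases "k + l = 0")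
      case True
      then have "l = -k" by simp
      then have "a \<star> a' \<in> ?Y" using a kl by blast
      then show ?thesis using True deg0_homog[OF kl] by (simp add: lspan.incl)
    next
      case False
      then show ?thesis using deg0_homog[OF kl] by (simp add: lspan.zero)
    qed
  qed
  finally show "P \<in> lspan AA ?Y" using deg0_C[OF P] by simp
next
  fix P assume "P \<in> lspan AA {a \<star> a' | a a'. \<exists>k. a \<in> X k \<and> a' \<in> X (-k)}"
  then have "P \<in> carrier AA \<and> diag P = ext P"
  proof induction
    case zero
    then show ?case
      using lin_zero[OF cvsAA cvsA3 diag_lin] lin_zero[OF cvsAA cvsA3 ext_lin] cvs.axioms(1)[OF cvsAA]
      by (simp add: abelian_group_def abelian_monoid.zero_closed)
  next
    case (incl P)
    then obtain a a' k where "P = a \<star> a'" "a \<in> G k" "a' \<in> G (-k)" using X(1) by blast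
    then show ?case by (simp add: diag_homog ext_pure G_carrier)
  next
    case (add P Q)
    interpret AA: cvs AA by (rule cvsAA)
    show ?case using add by (simp add: lin_add[OF diag_lin] lin_add[OF ext_lin])
  next
    case (smult P c)
    interpret AA: cvs AA by (rule cvsAA)
    show ?case using smult by (simp add: lin_smult[OF diag_lin] lin_smult[OF ext_lin])
  qed
  then show "P \<in> carrier C" by (simp add: carrier_C)
qed

lemma carrier_C_homC: "carrier C = lspan AA homC"
  by (rule carrier_C_span[OF subset_refl homog_span])

lemma carrier_C_lspan: "carrier C = lspan C homC"
  unfolding carrier_C_homC by (rule lspan_cong) simp_all

lemma homC_C: "a \<in> G k \<Longrightarrow> a' \<in> G (-k) \<Longrightarrow> a \<star> a' \<in> carrier C"
  unfolding carrier_C_homC by (rule lspan.incl) blast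

lemma homC_C': "a \<in> G k \<Longrightarrow> a' \<in> G l \<Longrightarrow> k + l = 0 \<Longrightarrow> a \<star> a' \<in> carrier C"
  using homC_C[of a k a'] by (simp add: add_eq_0_iff)

lemma C_AA: "P \<in> carrier C \<Longrightarrow> P \<in> carrier AA"
  by (simp add: carrier_C)

lemma homC_mult: "P \<in> homC \<Longrightarrow> Q \<in> homC \<Longrightarrow> P \<bullet> Q \<in> homC"
proof -
  assume "P \<in> homC" "Q \<in> homC"
  then obtain a a' k c c' l where
    *: "P = a \<star> a'" "a \<in> G k" "a' \<in> G (-k)" "Q = c \<star> c'" "c \<in> G l" "c' \<in> G (-l)" by blast
  then have "P \<bullet> Q = (a \<otimes> c) \<star> (c' \<otimes> a')" by (simp add: E_mult G_carrier)
  moreover have "a \<otimes> c \<in> G (k + l)" "c' \<otimes> a' \<in> G (-(k + l))"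
    using * by (auto intro: G_mult_eq)
  ultimately show ?thesis by blast
qed

lemma linE: "lin E Z = lin AA Z" "lin Z E = lin Z AA" "lin C Z \<supseteq> lin AA Z"
  by (auto simp: lin_def C_AA Pi_iff)

lemma C_mult_closed:
  assumes "P \<in> carrier C" "Q \<in> carrier C"
  shows "P \<bullet> Q \<in> carrier C"
proof -
  have hom: "homC \<subseteq> carrier AA" using G_carrier star_closed by blast
  have 1: "P \<bullet> Q \<in> carrier C" if P: "P \<in> homC" and Q: "Q \<in> carrier C" for P Q
  proof -
    have "(\<lambda>Q. P \<bullet> Q) \<in> lin AA AA"
      using mult_lin2[OF calg_E lin_id, of P] subsetD[OF hom P] by (simp add: linE)
    from lin_image_lspan[OF cvsAA cvsAA this hom] Q
    have "P \<bullet> Q \<in> lspan AA ((\<lambda>Q. P \<bullet> Q) ` homC)" by (simp add: carrier_C_homC)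
    also have "\<dots> \<subseteq> lspan AA homC"
      using homC_mult[OF P] by (intro lspan_subset subsetI, elim imageE) (simp only: lspan.incl)
    finally show ?thesis by (simp add: carrier_C_homC)
  qed
  have "(\<lambda>P. P \<bullet> Q) \<in> lin AA AA"
    using mult_lin1[OF calg_E lin_id, of Q] assms(2) by (simp add: linE C_AA)
  from lin_image_lspan[OF cvsAA cvsAA this hom] assms(1)
  have "P \<bullet> Q \<in> lspan AA ((\<lambda>P. P \<bullet> Q) ` homC)" by (simp add: carrier_C_homC)
  also have "\<dots> \<subseteq> lspan AA homC"
    using 1[OF _ assms(2)] carrier_C_homC by (intro lspan_subset subsetI, elim imageE) (simp only:)
  finally show ?thesis by (simp add: carrier_C_homC)
qed

lemma C_eq_sub: "C = E\<lparr>carrier := carrier C\<rparr>"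
  by (simp add: es_alg_def)

lemma calg_C: "calg C"
proof -
  have "calg (E\<lparr>carrier := carrier C\<rparr>)"
  proof (rule calg_sub[OF calg_E])
    show "\<one>\<^bsub>E\<^esub> \<in> carrier C" using homC_C[of \<one> 0 \<one>] G_one by simp
    show "P \<bullet> Q \<in> carrier C" if "P \<in> carrier C" "Q \<in> carrier C" for P Q
      using that by (rule C_mult_closed)
    show "carrier C \<subseteq> carrier E" using C_AA by auto
  qed (simp_all add: carrier_C_homC lspan.intros)
  then show ?thesis by (simp only: C_eq_sub[symmetric])
qed

lemmas cvsC = calg_cvs[OF calg_C]

lemma deg0_in_C: "P \<in> carrier AA \<Longrightarrow> deg0 P \<in> carrier C"
proof -
  assume "P \<in> carrier AA"
  let ?XX = "{a \<star> a' | a a'. a \<in> (\<Union>k. G k) \<and> a' \<in> (\<Union>k. G k)}"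
  have "?XX \<subseteq> carrier AA" using G_carrier star_closed by blast
  then have "deg0 P \<in> lspan AA (deg0 ` ?XX)"
    using \<open>P \<in> carrier AA\<close> AA_span_homog
    by (intro lin_image_lspan[OF cvsAA cvsAA deg0_lin]) simp_all
  also have "\<dots> \<subseteq> lspan AA homC"
  proof (rule lspan_subset, safe)
    fix a a' k l assume kl: "a \<in> G k" "a' \<in> G l"
    show "deg0 (a \<star> a') \<in> lspan AA homC"
      using deg0_homog[OF kl] homC_C'[OF kl] by (simp add: carrier_C_homC lspan.zero)
  qed
  finally show ?thesis by (simp add: carrier_C_homC)
qed

lemma deg0_lin_C: "deg0 \<in> lin AA C"
  using deg0_lin deg0_in_C by (auto simp: lin_def)

lemma C_lin_eqI:
  assumes "cvs Z" "f \<in> lin C Z" "g \<in> lin C Z"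
    "\<And>a a' k. \<lbrakk>a \<in> G k; a' \<in> G (-k)\<rbrakk> \<Longrightarrow> f (a \<star> a') = g (a \<star> a')" "P \<in> carrier C"
  shows "f P = g P"
proof (rule lin_eqI[OF cvsC assms(1-3)])
  show "P \<in> lspan C homC" using assms(5) carrier_C_lspan by simp
  show "homC \<subseteq> carrier C" using homC_C by blast
  show "f P = g P" if "P \<in> homC" for P using that assms(4) by blast
qed

lemma AA_lin_eqI:
  assumes "cvs Z" "f \<in> lin AA Z" "g \<in> lin AA Z"
    "\<And>a a' k l. \<lbrakk>a \<in> G k; a' \<in> G l\<rbrakk> \<Longrightarrow> f (a \<star> a') = g (a \<star> a')" "P \<in> carrier AA"
  shows "f P = g P"
proof (rule lin_eqI[OF cvsAA assms(1-3)])
  show "P \<in> lspan AA {a \<star> a' | a a'. a \<in> (\<Union>k. G k) \<and> a' \<in> (\<Union>k. G k)}"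
    using assms(5) AA_span_homog by simp
  show "{a \<star> a' | a a'. a \<in> (\<Union>k. G k) \<and> a' \<in> (\<Union>k. G k)} \<subseteq> carrier AA"
    using G_carrier star_closed by blast
  show "f P = g P" if "P \<in> {a \<star> a' | a a'. a \<in> (\<Union>k. G k) \<and> a' \<in> (\<Union>k. G k)}" for P
    using that assms(4) by blast
qed


subsection \<open>Balanced tensor products of the bialgebroid\<close>

abbreviation "D \<equiv> es_bialgebroid A OU1 rho"

abbreviation "BT \<equiv> tensor C C (st_rel B C (es_src A) (es_tgt A))"
abbreviation "bp \<equiv> pure C C (st_rel B C (es_src A) (es_tgt A))"
abbreviation "BIG \<equiv> tensor E E (es_big_rel A OU1 rho)"
abbreviation "bigp \<equiv> pure E E (es_big_rel A OU1 rho)"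

lemma D_simps [simp]:
  "b_base D = B" "b_total D = C" "b_src D = es_src A" "b_tgt D = es_tgt A"
  "b_coprod D = cop" "btensor D = BT" "bpure D = bp"
  by (simp_all add: es_bialgebroid_def btensor_def bpure_def)

lemma src_C: "b \<in> G 0 \<Longrightarrow> es_src A b \<in> carrier C"
  and tgt_C: "b \<in> G 0 \<Longrightarrow> es_tgt A b \<in> carrier C"
  using homC_C'[of b 0 \<one> 0] homC_C'[of \<one> 0 b 0] G_one by (simp_all add: es_src_def es_tgt_def)

lemma src_mult: "\<lbrakk>b \<in> G 0; x \<in> carrier A; y \<in> carrier A\<rbrakk> \<Longrightarrow> es_src A b \<bullet> (x \<star> y) = (b \<otimes> x) \<star> y"
  and tgt_mult: "\<lbrakk>b \<in> G 0; x \<in> carrier A; y \<in> carrier A\<rbrakk> \<Longrightarrow> es_tgt A b \<bullet> (x \<star> y) = x \<star> (y \<otimes> b)"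
  by (simp_all add: es_src_def es_tgt_def E_mult G_carrier)

sublocale BT: tensor_rel C C "st_rel B C (es_src A) (es_tgt A)"
  unfolding st_rel_def
  by (rule bal_tensor_rel[OF cvsC cvsC]) (simp_all add: C_mult_closed src_C tgt_C)

lemma E_mult_closed: "P \<in> carrier AA \<Longrightarrow> Q \<in> carrier AA \<Longrightarrow> P \<bullet> Q \<in> carrier AA"
  using monoid.m_closed[OF ring.is_monoid[OF calg.axioms(2)[OF calg_E]]] by simp

lemmas cvsE = calg_cvs[OF calg_E]

sublocale BIG: tensor_rel E E "es_big_rel A OU1 rho"
  unfolding st_rel_def es_big_rel_def
  by (rule bal_tensor_rel[OF cvsE cvsE]) (simp_all add: E_mult_closed C_AA src_C tgt_C)

lemma bp_balanced:
  assumes "P \<in> carrier C" "b \<in> G 0" "Q \<in> carrier C"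
  shows "bp (es_tgt A b \<bullet> P) Q = bp P (es_src A b \<bullet> Q)"
proof -
  have "tensor_rel C C (bal_rel B (\<lambda>h b. es_tgt A b \<bullet> h) (\<lambda>b h. es_src A b \<bullet> h) C C)"
    using BT.tensor_rel_axioms by (simp add: st_rel_def)
  from bal_pure_eq[OF this, of P b Q] show ?thesis
    using assms by (simp add: st_rel_def C_mult_closed src_C tgt_C)
qed

lemma bigp_balanced:
  assumes "P \<in> carrier AA" "b \<in> G 0" "Q \<in> carrier AA"
  shows "bigp (es_tgt A b \<bullet> P) Q = bigp P (es_src A b \<bullet> Q)"
proof -
  have "tensor_rel E E (bal_rel B (\<lambda>h b. es_tgt A b \<bullet> h) (\<lambda>b h. es_src A b \<bullet> h) E E)"
    using BIG.tensor_rel_axioms by (simp add: st_rel_def es_big_rel_def)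
  from bal_pure_eq[OF this, of P b Q] show ?thesis
    using assms by (simp add: st_rel_def es_big_rel_def E_mult_closed C_AA src_C tgt_C)
qed

text \<open>The target map acts on the second leg from the right, since that leg lives in the
  opposite algebra; the source map acts on the next leg from the left. A factor of degree 0 thus
  passes between the two inner legs.\<close>

lemma bp_move:
  assumes "x \<in> G k" "y \<in> G (-k)" "b \<in> G 0" "x' \<in> G l" "y' \<in> G (-l)"
  shows "bp (x \<star> (y \<otimes> b)) (x' \<star> y') = bp (x \<star> y) ((b \<otimes> x') \<star> y')"
  using bp_balanced[OF homC_C[OF assms(1,2)] assms(3) homC_C[OF assms(4,5)]] assms
  by (simp add: src_mult tgt_mult G_carrier)

lemma descends_BT:
  assumes "cvs Z" "bilin C C Z f"
    "\<And>P b Q. \<lbrakk>P \<in> carrier C; b \<in> G 0; Q \<in> carrier C\<rbrakk> \<Longrightarrow> f (es_tgt A b \<bullet> P) Q = f P (es_src A b \<bullet> Q)"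
  shows "descends Z f (st_rel B C (es_src A) (es_tgt A))"
  unfolding st_rel_def
  by (rule descends_bal[OF assms(1,2)]) (simp_all add: C_mult_closed src_C tgt_C assms(3))

lemma descends_BIG:
  assumes "cvs Z" "bilin E E Z f"
    "\<And>P b Q. \<lbrakk>P \<in> carrier AA; b \<in> G 0; Q \<in> carrier AA\<rbrakk> \<Longrightarrow> f (es_tgt A b \<bullet> P) Q = f P (es_src A b \<bullet> Q)"
  shows "descends Z f (es_big_rel A OU1 rho)"
  unfolding st_rel_def es_big_rel_def
  by (rule descends_bal[OF assms(1,2)]) (simp_all add: E_mult_closed C_AA src_C tgt_C assms(3))

subsection \<open>The coproduct\<close>

lemma bigp_bilin: "bilin AA AA BIG bigp"
  using BIG.pure_bilin by (simp add: bilin_def linE)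

text \<open>\<open>cop0\<close>, \<open>cop1\<close> and \<open>cop2\<close> are the three nested
  summands of \<open>es_coprod_big\<close>, from the inside out. The fixed arguments come first so
  that each layer can be stated as a function of the two variables of its own Sweedler sum.\<close>

definition cop0 :: "'a \<Rightarrow> 'a \<Rightarrow> 'a \<Rightarrow> 'a \<Rightarrow> _" where
  "cop0 a0 a' x y = bigp (a0 \<star> x) (y \<star> a')"

lemma cop0_bilin: "a0 \<in> carrier A \<Longrightarrow> a' \<in> carrier A \<Longrightarrow> bilin A A BIG (cop0 a0 a')"
  unfolding cop0_def
  by (intro bilinI bilin_lin_comp1[OF bigp_bilin] bilin_lin_comp2[OF bigp_bilin] star_lin1 star_lin2 lin_id)
    simp_all

text \<open>The two balancings match: a0 \<otimes> x b is the target of b times a0 \<otimes> x, and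
  b y \<otimes> a' is the source of b times y \<otimes> a'.\<close>

lemma cop0_descends:
  assumes "a0 \<in> carrier A" "a' \<in> carrier A"
  shows "descends BIG (cop0 a0 a') (can_rel A OU1 rho)"
  unfolding can_rel_def
proof (rule descends_bal[OF BIG.tensor_cvs cop0_bilin[OF assms]])
  fix x b y assume *: "x \<in> carrier A" "b \<in> carrier B" "y \<in> carrier A"
  then show "cop0 a0 a' (x \<otimes> b) y = cop0 a0 a' x (b \<otimes> y)"
    using bigp_balanced[of "a0 \<star> x" b "y \<star> a'"] assms
    by (simp add: cop0_def src_mult tgt_mult)
qed (simp_all add: G_carrier)

definition cop1 :: "'a \<Rightarrow> 'a \<Rightarrow> (int \<Rightarrow>\<^sub>0 complex) \<Rightarrow> _" where
  "cop1 a' a0 h = sweedler BIG (cop0 a0 a') (trn h)"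

lemma trn_closed: "trn h \<in> carrier CT"
  using lin_closed[OF trn_lin, of h] by simp

lemma cop1_bilin:
  assumes "a' \<in> carrier A"
  shows "bilin A OU1 BIG (cop1 a')"
proof (rule bilinI)
  fix h show "(\<lambda>a0. cop1 a' a0 h) \<in> lin A BIG"
    unfolding cop1_def cop0_def using assms
    by (intro CT.sweedler_fun_lin trn_closed BIG.tensor_cvs cvsA bilin_lin_comp1[OF bigp_bilin]
        star_lin1 lin_id) simp_all
next
  fix a0 assume a0: "a0 \<in> carrier A"
  have "(\<lambda>h. sweedler BIG (cop0 a0 a') (trn h)) \<in> lin OU1 BIG"
    by (rule lin_comp[OF trn_lin CT.sweedler_lin[OF BIG.tensor_cvs]])
      (use a0 assms in \<open>simp_all add: cop0_bilin cop0_descends\<close>)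
  then show "cop1 a' a0 \<in> lin OU1 BIG" by (simp add: cop1_def[abs_def])
qed

definition cop2 :: "'a \<Rightarrow> 'a \<Rightarrow> _" where
  "cop2 a a' = sweedler BIG (cop1 a') (rho a)"

lemma cop2_bilin: "bilin A A BIG cop2"
proof (rule bilinI)
  fix a' assume "a' \<in> carrier A"
  then show "(\<lambda>a. cop2 a a') \<in> lin A BIG"
    unfolding cop2_def by (intro rho_sweedler_lin BIG.tensor_cvs cop1_bilin)
next
  fix a assume a: "a \<in> carrier A"
  have "(\<lambda>a'. sweedler BIG (cop1 a') (rho a)) \<in> lin A BIG"
    using a unfolding cop1_def cop0_def
    by (intro rho_sweedler_fun_lin CT.sweedler_fun_lin trn_closed BIG.tensor_cvs cvsA
        bilin_lin_comp2[OF bigp_bilin] star_lin2 lin_id) simp_all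
  then show "cop2 a \<in> lin A BIG" by (simp add: cop2_def[abs_def])
qed

lemma coprod_big_eq: "big_cop = sweedler BIG cop2"
  by (simp add: fun_eq_iff es_coprod_big_def cop2_def[abs_def] cop1_def[abs_def] cop0_def[abs_def]
      transl_eq es_big_def es_big_pure_def)

lemma coprod_big_lin: "big_cop \<in> lin AA BIG"
  unfolding coprod_big_eq by (rule tens_sweedler_lin[OF cvsA cvsA BIG.tensor_cvs cop2_bilin lin_id])

lemma coprod_big_homog:
  assumes "a \<in> G k" "a' \<in> carrier A"
  shows "big_cop (a \<star> a') = lsum BIG (\<lambda>x y. bigp (a \<star> x) (y \<star> a')) (tau k)"
proof -
  have a: "a \<in> carrier A" using assms(1) by (rule G_carrier)
  have "big_cop (a \<star> a') = cop2 a a'"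
    unfolding coprod_big_eq by (rule tens_sweedler_pure[OF cvsA cvsA BIG.tensor_cvs cop2_bilin a assms(2)])
  also have "\<dots> = sweedler BIG (cop0 a a') (lsum CT cp (tau k))"
    unfolding cop2_def rho_sweedler_homog[OF BIG.tensor_cvs cop1_bilin[OF assms(2)] assms(1)]
    by (simp add: cop1_def trn_single)
  also have "\<dots> = lsum BIG (\<lambda>x y. sweedler BIG (cop0 a a') (cp x y)) (tau k)"
    by (rule lin_lsum[OF CT.tensor_cvs BIG.tensor_cvs CT.sweedler_lin[OF BIG.tensor_cvs]])
      (use a assms(2) in \<open>auto simp: cop0_bilin cop0_descends dest: tau_carrier\<close>)
  also have "\<dots> = lsum BIG (\<lambda>x y. bigp (a \<star> x) (y \<star> a')) (tau k)"
  proof (rule lsum_cong)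
    fix x y assume "(x, y) \<in> set (tau k)"
    then have "x \<in> carrier A" "y \<in> carrier A" by (auto dest: tau_carrier)
    then show "sweedler BIG (cop0 a a') (cp x y) = bigp (a \<star> x) (y \<star> a')"
      using CT.sweedler_pure[OF BIG.tensor_cvs cop0_bilin cop0_descends] a assms(2)
      by (simp add: cop0_def)
  qed
  finally show ?thesis .
qed

definition retr_fun where "retr_fun P Q = bp (deg0 P) (deg0 Q)"

lemma retr_fun_bilin: "bilin E E BT retr_fun"
  unfolding retr_fun_def linE bilin_def
  by (intro conjI ballI bilin_lin_comp1[OF BT.pure_bilin] bilin_lin_comp2[OF BT.pure_bilin] deg0_lin_C deg0_in_C)
    simp_all

text \<open>Source and target multiply one leg by an element of degree 0 and leave the degrees of
  both legs unchanged. Hence \<open>deg0\<close> applied to both factors respects the balancing and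
  defines the retraction \<open>retr\<close>.\<close>

lemma deg0_balanced:
  assumes "P \<in> carrier AA" "b \<in> G 0"
  shows "deg0 (es_tgt A b \<bullet> P) = es_tgt A b \<bullet> deg0 P" "deg0 (es_src A b \<bullet> P) = es_src A b \<bullet> deg0 P"
proof -
  have lin: "(\<lambda>P. R \<bullet> P) \<in> lin AA AA" if "R \<in> carrier AA" for R
    using mult_lin2[OF calg_E lin_id, of R] that by (simp add: linE)
  have st: "es_tgt A b \<in> carrier AA" "es_src A b \<in> carrier AA"
    using assms(2) src_C tgt_C C_AA by auto
  have zero: "R \<bullet> \<zero>\<^bsub>AA\<^esub> = \<zero>\<^bsub>AA\<^esub>" if "R \<in> carrier AA" for R
    using lin_zero[OF cvsAA cvsAA lin[OF that]] .
  show "deg0 (es_tgt A b \<bullet> P) = es_tgt A b \<bullet> deg0 P"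
  proof (rule AA_lin_eqI[OF cvsAA lin_comp[OF lin[OF st(1)] deg0_lin] lin_comp[OF deg0_lin lin[OF st(1)]] _ assms(1)])
    fix a a' k l assume *: "a \<in> G k" "a' \<in> G l"
    then have "a' \<otimes> b \<in> G l" using assms(2) by (auto intro: G_mult_eq)
    then show "deg0 (es_tgt A b \<bullet> (a \<star> a')) = es_tgt A b \<bullet> deg0 (a \<star> a')"
      using * assms(2) st zero by (simp add: tgt_mult G_carrier deg0_homog[of _ k _ l])
  qed
  show "deg0 (es_src A b \<bullet> P) = es_src A b \<bullet> deg0 P"
  proof (rule AA_lin_eqI[OF cvsAA lin_comp[OF lin[OF st(2)] deg0_lin] lin_comp[OF deg0_lin lin[OF st(2)]] _ assms(1)])
    fix a a' k l assume *: "a \<in> G k" "a' \<in> G l"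
    then have "b \<otimes> a \<in> G k" using assms(2) by (auto intro: G_mult_eq)
    then show "deg0 (es_src A b \<bullet> (a \<star> a')) = es_src A b \<bullet> deg0 (a \<star> a')"
      using * assms(2) st zero by (simp add: src_mult G_carrier deg0_homog[of _ k _ l])
  qed
qed

lemma retr_fun_descends: "descends BT retr_fun (es_big_rel A OU1 rho)"
  by (rule descends_BIG[OF BT.tensor_cvs retr_fun_bilin])
    (simp add: retr_fun_def deg0_balanced bp_balanced deg0_in_C)

abbreviation "retr \<equiv> sweedler BT retr_fun"
abbreviation "incl \<equiv> sweedler BIG bigp"

lemma retr_lin: "retr \<in> lin BIG BT"
  by (rule BIG.sweedler_lin[OF BT.tensor_cvs retr_fun_bilin retr_fun_descends])

lemma retr_pure: "P \<in> carrier AA \<Longrightarrow> Q \<in> carrier AA \<Longrightarrow> retr (bigp P Q) = bp (deg0 P) (deg0 Q)"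
  using BIG.sweedler_pure[OF BT.tensor_cvs retr_fun_bilin retr_fun_descends, of P Q]
  by (simp add: retr_fun_def)

lemma incl_bilin: "bilin C C BIG bigp"
  unfolding bilin_def
  using bilin_left[OF bigp_bilin] bilin_right[OF bigp_bilin] linE(3) C_AA by blast

lemma incl_descends: "descends BIG bigp (st_rel B C (es_src A) (es_tgt A))"
  by (rule descends_BT[OF BIG.tensor_cvs incl_bilin]) (simp add: bigp_balanced C_AA)

lemma incl_lin: "incl \<in> lin BT BIG"
  by (rule BT.sweedler_lin[OF BIG.tensor_cvs incl_bilin incl_descends])

lemma incl_pure: "P \<in> carrier C \<Longrightarrow> Q \<in> carrier C \<Longrightarrow> incl (bp P Q) = bigp P Q"
  by (rule BT.sweedler_pure[OF BIG.tensor_cvs incl_bilin incl_descends])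

text \<open>\<open>deg0\<close> fixes C, so the inclusion-induced map has a left inverse and is
  injective. This is the uniqueness demanded by the definition of the coproduct.\<close>

lemma retr_incl:
  assumes "X \<in> carrier BT"
  shows "retr (incl X) = X"
  by (rule BT.tensor_eqI[OF BT.tensor_cvs lin_comp[OF incl_lin retr_lin] lin_id _ assms])
    (simp add: incl_pure retr_pure C_AA deg0_C)

lemma retr_coprod_big_homog:
  assumes "a \<in> G k" "a' \<in> G (-k)"
  shows "retr (big_cop (a \<star> a')) = lsum BT (\<lambda>x y. bp (a \<star> x) (y \<star> a')) (tau k)"
proof -
  have cl: "a \<star> x \<in> carrier C" "y \<star> a' \<in> carrier C" if "(x, y) \<in> set (tau k)" for x y
    using that assms by (auto intro!: homC_C' dest: tau(1,2))
  have "retr (big_cop (a \<star> a')) = lsum BT (\<lambda>x y. retr (bigp (a \<star> x) (y \<star> a'))) (tau k)"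
    unfolding coprod_big_homog[OF assms(1) G_carrier[OF assms(2)]]
    by (rule lin_lsum[OF BIG.tensor_cvs BT.tensor_cvs retr_lin])
      (simp add: BIG.pure_closed cl C_AA)
  also have "\<dots> = lsum BT (\<lambda>x y. bp (a \<star> x) (y \<star> a')) (tau k)"
    by (rule lsum_cong) (simp add: retr_pure C_AA deg0_C cl)
  finally show ?thesis .
qed

lemma coprod_big_lin_C: "big_cop \<in> lin C BIG"
  using coprod_big_lin linE(3) by blast

text \<open>Existence: for a of degree k and a' of degree -k the factors a \<otimes> x and y
  \<otimes> a' have total degree 0, so the formula for the coproduct already consists of terms from
  C, and retracting and including again changes nothing. Uniqueness is
  \<open>retr_incl\<close>.\<close>

lemma coprod_eq:
  assumes "P \<in> carrier C"
  shows "cop P = retr (big_cop P)"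
proof -
  have incl_retr: "incl (retr (big_cop P)) = big_cop P"
  proof (rule C_lin_eqI[OF BIG.tensor_cvs lin_comp[OF lin_comp[OF coprod_big_lin_C retr_lin] incl_lin]
        coprod_big_lin_C _ assms])
    fix a a' k assume *: "a \<in> G k" "a' \<in> G (-k)"
    have cl: "a \<star> x \<in> carrier C" "y \<star> a' \<in> carrier C" if "(x, y) \<in> set (tau k)" for x y
      using that * by (auto intro!: homC_C' dest: tau(1,2))
    have "incl (retr (big_cop (a \<star> a'))) = lsum BIG (\<lambda>x y. incl (bp (a \<star> x) (y \<star> a'))) (tau k)"
      unfolding retr_coprod_big_homog[OF *]
      by (rule lin_lsum[OF BT.tensor_cvs BIG.tensor_cvs incl_lin]) (use cl in auto)
    also have "\<dots> = lsum BIG (\<lambda>x y. bigp (a \<star> x) (y \<star> a')) (tau k)"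
      by (rule lsum_cong) (use cl in \<open>simp add: incl_pure\<close>)
    also have "\<dots> = big_cop (a \<star> a')"
      using coprod_big_homog[OF *(1) G_carrier[OF *(2)]] by simp
    finally show "incl (retr (big_cop (a \<star> a'))) = big_cop (a \<star> a')" .
  qed
  have closed: "retr (big_cop P) \<in> carrier BT"
    using lin_closed[OF lin_comp[OF coprod_big_lin_C retr_lin] assms] .
  show ?thesis
    unfolding es_coprod_def es_big_def es_big_pure_def
  proof (rule the_equality)
    show "retr (big_cop P) \<in> carrier BT \<and>
        incl (retr (big_cop P)) = big_cop P"
      using closed incl_retr by blast
    show "Q = retr (big_cop P)"
      if "Q \<in> carrier BT \<and> incl Q = big_cop P" for Q
      using that retr_incl[of Q] by simp
  qed
qed

lemma coprod_lin: "cop \<in> lin C BT"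
  by (rule lin_cong[OF lin_comp[OF coprod_big_lin_C retr_lin] cvsC]) (simp add: coprod_eq)

lemma coprod_homog:
  assumes "a \<in> G k" "a' \<in> G (-k)"
  shows "cop (a \<star> a') = lsum BT (\<lambda>x y. bp (a \<star> x) (y \<star> a')) (tau k)"
  using coprod_eq[OF homC_C[OF assms]] retr_coprod_big_homog[OF assms] by simp

end

section \<open>The antipode\<close>

locale graded_automorphism = strongly_graded A rho
  for A :: "(complex, 'a) module" (structure) and rho +
  fixes th th' :: "'a \<Rightarrow> 'a"
  assumes th_hom: "th \<in> alg_hom A A" and th'_hom: "th' \<in> alg_hom A A"
    and th_th': "a \<in> carrier A \<Longrightarrow> th (th' a) = a" and th'_th: "a \<in> carrier A \<Longrightarrow> th' (th a) = a"
    and th_G: "a \<in> homog A rho k \<Longrightarrow> th a \<in> homog A rho k"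
    and th'_G: "a \<in> homog A rho k \<Longrightarrow> th' a \<in> homog A rho k"
begin

lemmas th_lin = alg_hom_lin[OF th_hom] and th'_lin = alg_hom_lin[OF th'_hom]
lemmas th_closed = lin_closed[OF th_lin] and th'_closed = lin_closed[OF th'_lin]

text \<open>Both maps are defined on all of A \<otimes> A, where linear extension is available. They
  preserve C because a flip keeps the total degree and the automorphisms have degree zero.\<close>

definition "S = sweedler AA (\<lambda>a a'. a' \<star> th a)"
definition "T = sweedler AA (\<lambda>a a'. th' a' \<star> a)"

lemma S_bilin: "bilin A A AA (\<lambda>a a'. a' \<star> th a)"
  by (intro bilinI star_lin1 star_lin2 lin_id th_lin th_closed)

lemma T_bilin: "bilin A A AA (\<lambda>a a'. th' a' \<star> a)"
  by (intro bilinI star_lin1 star_lin2 lin_id th'_lin th'_closed)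

lemma S_lin: "S \<in> lin AA AA"
  unfolding S_def by (rule tens_sweedler_lin[OF cvsA cvsA cvsAA S_bilin lin_id])

lemma T_lin: "T \<in> lin AA AA"
  unfolding T_def by (rule tens_sweedler_lin[OF cvsA cvsA cvsAA T_bilin lin_id])

lemma S_pure: "a \<in> carrier A \<Longrightarrow> a' \<in> carrier A \<Longrightarrow> S (a \<star> a') = a' \<star> th a"
  unfolding S_def by (rule tens_sweedler_pure[OF cvsA cvsA cvsAA S_bilin])

lemma T_pure: "a \<in> carrier A \<Longrightarrow> a' \<in> carrier A \<Longrightarrow> T (a \<star> a') = th' a' \<star> a"
  unfolding T_def by (rule tens_sweedler_pure[OF cvsA cvsA cvsAA T_bilin])

lemma lspan_lin_closed:
  assumes f: "f \<in> lin AA AA" and "\<And>a a' k. \<lbrakk>a \<in> G k; a' \<in> G (-k)\<rbrakk> \<Longrightarrow> f (a \<star> a') \<in> carrier C"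
    and P: "P \<in> carrier C"
  shows "f P \<in> carrier C"
proof -
  have "homC \<subseteq> carrier AA" using G_carrier star_closed by blast
  then have "f P \<in> lspan AA (f ` homC)"
    using P by (intro lin_image_lspan[OF cvsAA cvsAA f]) (simp_all add: carrier_C_homC)
  also have "\<dots> \<subseteq> lspan AA homC"
  proof (rule lspan_subset, rule subsetI, elim imageE)
    fix Q R assume "R \<in> homC" "Q = f R"
    then show "Q \<in> lspan AA homC" using assms(2) carrier_C_homC by blast
  qed
  finally show ?thesis by (simp add: carrier_C_homC)
qed

lemma S_C: "P \<in> carrier C \<Longrightarrow> S P \<in> carrier C"
proof (rule lspan_lin_closed[OF S_lin])
  fix a a' k assume "a \<in> G k" "a' \<in> G (-k)"
  then show "S (a \<star> a') \<in> carrier C" using th_G[of a k] by (simp add: S_pure G_carrier homC_C')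
qed

lemma T_C: "P \<in> carrier C \<Longrightarrow> T P \<in> carrier C"
proof (rule lspan_lin_closed[OF T_lin])
  fix a a' k assume "a \<in> G k" "a' \<in> G (-k)"
  then show "T (a \<star> a') \<in> carrier C" using th'_G[of a' "-k"] by (simp add: T_pure G_carrier homC_C')
qed

lemma S_lin_C: "S \<in> lin C C"
  using S_lin S_C by (auto simp: lin_def C_AA)

lemma T_lin_C: "T \<in> lin C C"
  using T_lin T_C by (auto simp: lin_def C_AA)

lemma T_S: "P \<in> carrier C \<Longrightarrow> T (S P) = P"
  by (rule C_lin_eqI[OF cvsC lin_comp[OF S_lin_C T_lin_C] lin_id])
    (simp_all add: S_pure T_pure G_carrier th_closed th'_th)

lemma S_T: "P \<in> carrier C \<Longrightarrow> S (T P) = P"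
  by (rule C_lin_eqI[OF cvsC lin_comp[OF T_lin_C S_lin_C] lin_id])
    (simp_all add: S_pure T_pure G_carrier th'_closed th_th')

lemma S_bij: "bij_betw S (carrier C) (carrier C)"
  by (rule bij_betwI[of _ _ _ T]) (auto simp: S_C T_C T_S S_T)

lemma inv_S: "P \<in> carrier C \<Longrightarrow> inv_into (carrier C) S P = T P"
  using S_T T_C S_bij by (intro inv_into_f_eq) (auto simp: bij_betw_def)

text \<open>On pure tensors the image of (a \<otimes> a')(c \<otimes> c') = a c \<otimes> c' a' is
  c' a' \<otimes> \<open>th\<close> a \<open>th\<close> c. The product of the images in reverse
  order is (c' \<otimes> \<open>th\<close> c)(a' \<otimes> \<open>th\<close> a), which is the same
  because the second leg multiplies in the opposite order.\<close>

lemma S_anti_hom: "S \<in> anti_alg_hom C C"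
  unfolding anti_alg_hom_def
proof (rule alg_homI)
  show "S \<in> lin C (opp C)" using S_lin_C by (simp add: lin_def)
  show "S \<one>\<^bsub>C\<^esub> = \<one>\<^bsub>opp C\<^esub>"
    using alg_hom_one[OF th_hom] by (simp add: S_pure)
next
  have l1: "(\<lambda>P. P \<bullet> R) \<in> lin C C" if "R \<in> carrier C" for R
    using mult_lin1[OF calg_C lin_id that] by simp
  have l2: "(\<lambda>P. R \<bullet> P) \<in> lin C C" if "R \<in> carrier C" for R
    using mult_lin2[OF calg_C lin_id that] by simp
  fix P Q assume P: "P \<in> carrier C" and Q: "Q \<in> carrier C"
  have "S (P \<bullet> Q) = S Q \<bullet> S P"
  proof (rule C_lin_eqI[OF cvsC lin_comp[OF l1[OF Q] S_lin_C] lin_comp[OF S_lin_C l2[OF S_C[OF Q]]] _ P])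
    fix a a' k assume a: "a \<in> G k" "a' \<in> G (-k)"
    have aC: "a \<star> a' \<in> carrier C" using a by (rule homC_C)
    show "S (a \<star> a' \<bullet> Q) = S Q \<bullet> S (a \<star> a')"
    proof (rule C_lin_eqI[OF cvsC lin_comp[OF l2[OF aC] S_lin_C] lin_comp[OF S_lin_C l1[OF S_C[OF aC]]] _ Q])
      fix c c' l assume c: "c \<in> G l" "c' \<in> G (-l)"
      show "S (a \<star> a' \<bullet> (c \<star> c')) = S (c \<star> c') \<bullet> S (a \<star> a')"
        using a c by (simp add: G_carrier E_mult S_pure th_closed alg_hom_mult[OF th_hom])
    qed
  qed
  then show "S (P \<otimes>\<^bsub>C\<^esub> Q) = S P \<otimes>\<^bsub>opp C\<^esub> S Q" by simp
qed

lemma S_tgt: "b \<in> G 0 \<Longrightarrow> S (es_tgt A b) = es_src A b"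
  using alg_hom_one[OF th_hom] by (simp add: es_tgt_def es_src_def S_pure G_carrier)

lemma E_assoc:
  "\<lbrakk>P \<in> carrier C; Q \<in> carrier C; R \<in> carrier C\<rbrakk> \<Longrightarrow> (P \<bullet> Q) \<bullet> R = P \<bullet> (Q \<bullet> R)"
  using monoid.m_assoc[OF ring.is_monoid[OF calg.axioms(2)[OF calg_C]]] by simp

lemma C_mult_lin1: "g \<in> lin W C \<Longrightarrow> R \<in> carrier C \<Longrightarrow> (\<lambda>w. g w \<bullet> R) \<in> lin W C"
  and C_mult_lin2: "g \<in> lin W C \<Longrightarrow> R \<in> carrier C \<Longrightarrow> (\<lambda>w. R \<bullet> g w) \<in> lin W C"
  using mult_lin1[OF calg_C, of g W R] mult_lin2[OF calg_C, of g W R] by simp_all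

lemmas bp_lin1 = bilin_lin_comp1[OF BT.pure_bilin] and bp_lin2 = bilin_lin_comp2[OF BT.pure_bilin]

lemma coprod_closed: "P \<in> carrier C \<Longrightarrow> cop P \<in> carrier BT"
  by (rule lin_closed[OF coprod_lin])

subsection \<open>The first antipode axiom\<close>

definition lmul :: "_ \<Rightarrow> _ \<Rightarrow> _ \<Rightarrow> _" where "lmul h2 x y = bp (x \<bullet> h2) y"

lemma lmul_bilin: "h2 \<in> carrier C \<Longrightarrow> bilin C C BT (lmul h2)"
  unfolding lmul_def by (intro bilinI bp_lin1 bp_lin2 C_mult_lin1 lin_id C_mult_closed)

text \<open>The target acts by left multiplication and therefore commutes with the right
  multiplication by h2.\<close>

lemma lmul_descends:
  assumes "h2 \<in> carrier C"
  shows "descends BT (lmul h2) (st_rel B C (es_src A) (es_tgt A))"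
proof (rule descends_BT[OF BT.tensor_cvs lmul_bilin[OF assms]])
  fix P b Q assume "P \<in> carrier C" "b \<in> G 0" "Q \<in> carrier C"
  then show "lmul h2 (es_tgt A b \<bullet> P) Q = lmul h2 P (es_src A b \<bullet> Q)"
    using assms by (simp add: lmul_def E_assoc tgt_C bp_balanced C_mult_closed)
qed

definition F1 :: "_ \<Rightarrow> _ \<Rightarrow> _" where "F1 h1 h2 = sweedler BT (lmul h2) (cop (S h1))"

lemma F1_bilin: "bilin C C BT F1"
proof (rule bilinI)
  fix h2 assume h2: "h2 \<in> carrier C"
  show "(\<lambda>h1. F1 h1 h2) \<in> lin C BT"
    unfolding F1_def
    by (rule lin_comp[OF lin_comp[OF S_lin_C coprod_lin] BT.sweedler_lin[OF BT.tensor_cvs lmul_bilin[OF h2] lmul_descends[OF h2]]])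
next
  fix h1 assume "h1 \<in> carrier C"
  then have "(\<lambda>h2. sweedler BT (lmul h2) (cop (S h1))) \<in> lin C BT"
    unfolding lmul_def
    by (intro BT.sweedler_fun_lin coprod_closed S_C BT.tensor_cvs cvsC bp_lin1 C_mult_lin2 lin_id)
  then show "F1 h1 \<in> lin C BT" by (simp add: F1_def[abs_def])
qed

lemma F1_homog:
  assumes "a \<in> G k" "x \<in> G (-k)" "h2 \<in> carrier C"
  shows "F1 (a \<star> x) h2 = lsum BT (\<lambda>u v. bp ((x \<star> u) \<bullet> h2) (v \<star> th a)) (tau (-k))"
proof -
  have cl: "x \<star> u \<in> carrier C" "v \<star> th a \<in> carrier C" if "(u, v) \<in> set (tau (-k))" for u v
    using that assms th_G by (auto intro!: homC_C' dest: tau(1,2))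
  have "F1 (a \<star> x) h2 = sweedler BT (lmul h2) (lsum BT (\<lambda>u v. bp (x \<star> u) (v \<star> th a)) (tau (-k)))"
    unfolding F1_def using assms th_G[OF assms(1)] by (simp add: S_pure G_carrier coprod_homog)
  also have "\<dots> = lsum BT (\<lambda>u v. sweedler BT (lmul h2) (bp (x \<star> u) (v \<star> th a))) (tau (-k))"
    by (rule lin_lsum[OF BT.tensor_cvs BT.tensor_cvs
          BT.sweedler_lin[OF BT.tensor_cvs lmul_bilin[OF assms(3)] lmul_descends[OF assms(3)]]])
      (simp add: cl)
  also have "\<dots> = lsum BT (\<lambda>u v. bp ((x \<star> u) \<bullet> h2) (v \<star> th a)) (tau (-k))"
    by (rule lsum_cong)
      (simp add: cl BT.sweedler_pure[OF BT.tensor_cvs lmul_bilin[OF assms(3)] lmul_descends[OF assms(3)]] lmul_def)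
  finally show ?thesis .
qed

text \<open>Multiplying a \<otimes> x by the target of b turns x into x b. After \<open>S\<close>
  and the coproduct the first factor is x b \<otimes> u, which is x \<otimes> u times the source of
  b on its right; that source is then absorbed on the left of Q.\<close>

lemma F1_descends: "descends BT F1 (st_rel B C (es_src A) (es_tgt A))"
proof (rule descends_BT[OF BT.tensor_cvs F1_bilin])
  fix P b Q assume P: "P \<in> carrier C" and b: "b \<in> G 0" and Q: "Q \<in> carrier C"
  show "F1 (es_tgt A b \<bullet> P) Q = F1 P (es_src A b \<bullet> Q)"
  proof (rule C_lin_eqI[OF BT.tensor_cvs _ _ _ P])
    show "(\<lambda>P. F1 (es_tgt A b \<bullet> P) Q) \<in> lin C BT"
      by (intro bilin_lin_comp1[OF F1_bilin] C_mult_lin2 lin_id tgt_C b Q)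
    show "(\<lambda>P. F1 P (es_src A b \<bullet> Q)) \<in> lin C BT"
      by (intro bilin_lin_comp1[OF F1_bilin] lin_id C_mult_closed src_C b Q)
    fix a x k assume ax: "a \<in> G k" "x \<in> G (-k)"
    then have xb: "x \<otimes> b \<in> G (-k)" using b by (auto intro: G_mult_eq)
    have "F1 (es_tgt A b \<bullet> (a \<star> x)) Q
        = lsum BT (\<lambda>u v. bp (((x \<otimes> b) \<star> u) \<bullet> Q) (v \<star> th a)) (tau (-k))"
      using ax b by (simp add: tgt_mult G_carrier F1_homog[OF ax(1) xb Q])
    also have "\<dots> = lsum BT (\<lambda>u v. bp ((x \<star> u) \<bullet> (es_src A b \<bullet> Q)) (v \<star> th a)) (tau (-k))"
    proof (rule lsum_cong)
      fix u v assume uv: "(u, v) \<in> set (tau (-k))"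
      then have "x \<star> u \<in> carrier C" using ax by (auto intro!: homC_C' dest: tau(1,2))
      then have "(x \<star> u) \<bullet> (es_src A b \<bullet> Q) = ((x \<star> u) \<bullet> es_src A b) \<bullet> Q"
        using b Q by (simp add: E_assoc src_C)
      also have "(x \<star> u) \<bullet> es_src A b = (x \<otimes> b) \<star> u"
        using ax b tau_carrier[OF uv] by (simp add: es_src_def E_mult G_carrier)
      finally show "bp (((x \<otimes> b) \<star> u) \<bullet> Q) (v \<star> th a)
          = bp ((x \<star> u) \<bullet> (es_src A b \<bullet> Q)) (v \<star> th a)" by simp
    qed
    also have "\<dots> = F1 (a \<star> x) (es_src A b \<bullet> Q)"
      by (rule F1_homog[OF ax, symmetric]) (intro C_mult_closed src_C b Q)
    finally show "F1 (es_tgt A b \<bullet> (a \<star> x)) Q = F1 (a \<star> x) (es_src A b \<bullet> Q)" .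
  qed
qed

text \<open>The coproduct of S(a \<otimes> x) = x \<otimes> \<open>th\<close> a has the terms (x
  \<otimes> u) \<otimes>_B (v \<otimes> \<open>th\<close> a), summed over \<open>tau (-k)\<close>
  because x has degree -k. Multiplying the first factor by y \<otimes> a' gives x y \<otimes> a' u.
  The element a' u lies in B and crosses over, and \<Sum> u v = 1 leaves a' \<otimes>
  \<open>th\<close> a. The \<open>deg0\<close> in the result is idle here; it puts the value into
  the form that the outer sum over x and y needs.\<close>

lemma F1_value:
  assumes "a \<in> G k" "a' \<in> G (-k)" "x \<in> G (-k)" "y \<in> G k"
  shows "F1 (a \<star> x) (y \<star> a') = bp (deg0 ((x \<otimes> y) \<star> \<one>)) (a' \<star> th a)"
proof -
  have xy: "x \<otimes> y \<in> G 0" using assms by (auto intro: G_mult_eq)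
  have xyC: "(x \<otimes> y) \<star> \<one> \<in> carrier C" using xy G_one by (intro homC_C') auto
  have tha: "th a \<in> G k" using assms(1) by (rule th_G)
  note cA = assms[THEN G_carrier] tha[THEN G_carrier]
  have "F1 (a \<star> x) (y \<star> a') = lsum BT (\<lambda>u v. bp ((x \<star> u) \<bullet> (y \<star> a')) (v \<star> th a)) (tau (-k))"
    using assms by (intro F1_homog homC_C')  auto
  also have "\<dots> = bp ((x \<otimes> y) \<star> \<one>) (deg0 ((a' \<otimes> \<one>) \<star> th a))"
  \<comment> \<open>\<open>L\<close> has to be linear on all of A, but the pure tensor
    \<open>bp\<close> is linear only in arguments from C. Applying \<open>deg0\<close> brings the
    second argument into C for every t and changes nothing at t = u v, where the total degree is
    0.\<close>
  proof (rule tau_collapse[where L = "\<lambda>t. bp ((x \<otimes> y) \<star> \<one>) (deg0 ((a' \<otimes> t) \<star> th a))", OF BT.tensor_cvs])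
    show "(\<lambda>t. bp ((x \<otimes> y) \<star> \<one>) (deg0 ((a' \<otimes> t) \<star> th a))) \<in> lin A BT"
      by (intro bp_lin2 xyC lin_comp[OF _ deg0_lin_C] star_lin1 mult_lin2 lin_id calg_axioms cA)
    fix u v assume uv: "(u, v) \<in> set (tau (-k))"
    have u: "u \<in> G k" and v: "v \<in> G (-k)" using tau(1,2)[OF uv] by simp_all
    have a'u: "a' \<otimes> u \<in> G 0" and a'uv: "a' \<otimes> u \<otimes> v \<in> G (-k)"
      using assms u v by (auto intro!: G_mult_eq[of _ 0] G_mult_eq[of a' "-k" u k])
    have "(x \<star> u) \<bullet> (y \<star> a') = (x \<otimes> y) \<star> (\<one> \<otimes> (a' \<otimes> u))"
      using cA tau_carrier[OF uv] by (simp add: E_mult)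
    then have "bp ((x \<star> u) \<bullet> (y \<star> a')) (v \<star> th a) = bp ((x \<otimes> y) \<star> \<one>) ((a' \<otimes> u \<otimes> v) \<star> th a)"
      using bp_move[OF xy _ a'u v] G_one tha by simp
    also have "a' \<otimes> u \<otimes> v = a' \<otimes> (u \<otimes> v)" using cA tau_carrier[OF uv] by (simp add: m_assoc)
    also have "(a' \<otimes> (u \<otimes> v)) \<star> th a = deg0 ((a' \<otimes> (u \<otimes> v)) \<star> th a)"
      using a'uv cA tau_carrier[OF uv] deg0_homog[OF a'uv tha] by (simp add: m_assoc)
    finally show "bp ((x \<star> u) \<bullet> (y \<star> a')) (v \<star> th a)
        = bp ((x \<otimes> y) \<star> \<one>) (deg0 ((a' \<otimes> (u \<otimes> v)) \<star> th a))" .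
  qed
  also have "\<dots> = bp (deg0 ((x \<otimes> y) \<star> \<one>)) (a' \<star> th a)"
    using deg0_C[OF xyC] deg0_homog[OF assms(2) tha] cA by simp
  finally show ?thesis .
qed

text \<open>After the inner sum has been evaluated by \<open>F1_value\<close>, the outer sum over
  \<open>tau k\<close> depends only on x y in its first leg and collapses to 1 \<otimes> 1.\<close>

lemma antipode1:
  assumes "P \<in> carrier C"
  shows "sweedler BT F1 (cop P) = bp (\<one> \<star> \<one>) (S P)"
proof -
  have oneC: "\<one> \<star> \<one> \<in> carrier C" using G_one by (intro homC_C') auto
  have F1_lin: "sweedler BT F1 \<in> lin BT BT"
    by (rule BT.sweedler_lin[OF BT.tensor_cvs F1_bilin F1_descends])
  show ?thesis
  proof (rule C_lin_eqI[OF BT.tensor_cvs lin_comp[OF coprod_lin F1_lin] bp_lin2[OF S_lin_C oneC] _ assms])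
    fix a a' k assume a: "a \<in> G k" "a' \<in> G (-k)"
    have tha: "th a \<in> G k" using a(1) by (rule th_G)
    have a'C: "a' \<star> th a \<in> carrier C" using a tha by (intro homC_C') auto
    have cl: "a \<star> x \<in> carrier C" "y \<star> a' \<in> carrier C" if "(x, y) \<in> set (tau k)" for x y
      using that a by (auto intro!: homC_C' dest: tau(1,2))
    have "sweedler BT F1 (cop (a \<star> a')) = lsum BT (\<lambda>x y. sweedler BT F1 (bp (a \<star> x) (y \<star> a'))) (tau k)"
      unfolding coprod_homog[OF a]
      by (rule lin_lsum[OF BT.tensor_cvs BT.tensor_cvs F1_lin]) (simp add: cl)
    also have "\<dots> = bp (deg0 (\<one> \<star> \<one>)) (a' \<star> th a)"
    proof (rule tau_collapse[where L = "\<lambda>t. bp (deg0 (t \<star> \<one>)) (a' \<star> th a)", OF BT.tensor_cvs])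
      show "(\<lambda>t. bp (deg0 (t \<star> \<one>)) (a' \<star> th a)) \<in> lin A BT"
        by (intro bp_lin1 a'C lin_comp[OF _ deg0_lin_C] star_lin1 lin_id one_closed)
      fix x y assume xy: "(x, y) \<in> set (tau k)"
      show "sweedler BT F1 (bp (a \<star> x) (y \<star> a')) = bp (deg0 ((x \<otimes> y) \<star> \<one>)) (a' \<star> th a)"
        using F1_value[OF a tau(1,2)[OF xy]] BT.sweedler_pure[OF BT.tensor_cvs F1_bilin F1_descends cl[OF xy]]
        by simp
    qed
    also have "\<dots> = bp (\<one> \<star> \<one>) (S (a \<star> a'))"
      using deg0_C[OF oneC] a by (simp add: S_pure G_carrier)
    finally show "sweedler BT F1 (cop (a \<star> a')) = bp (\<one> \<star> \<one>) (S (a \<star> a'))" .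
  qed
qed

subsection \<open>The second antipode axiom\<close>

definition rmul :: "_ \<Rightarrow> _ \<Rightarrow> _ \<Rightarrow> _" where "rmul h1 x y = bp x (y \<bullet> h1)"

lemma rmul_bilin: "h1 \<in> carrier C \<Longrightarrow> bilin C C BT (rmul h1)"
  unfolding rmul_def by (intro bilinI bp_lin1 bp_lin2 C_mult_lin1 lin_id C_mult_closed)

lemma rmul_descends:
  assumes "h1 \<in> carrier C"
  shows "descends BT (rmul h1) (st_rel B C (es_src A) (es_tgt A))"
proof (rule descends_BT[OF BT.tensor_cvs rmul_bilin[OF assms]])
  fix P b Q assume "P \<in> carrier C" "b \<in> G 0" "Q \<in> carrier C"
  then show "rmul h1 (es_tgt A b \<bullet> P) Q = rmul h1 P (es_src A b \<bullet> Q)"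
    using assms by (simp add: rmul_def E_assoc src_C bp_balanced C_mult_closed)
qed

definition F2 :: "_ \<Rightarrow> _ \<Rightarrow> _" where "F2 h1 h2 = sweedler BT (rmul h1) (cop (T h2))"

lemma F2_bilin: "bilin C C BT F2"
proof (rule bilinI)
  fix h1 assume h1: "h1 \<in> carrier C"
  have "(\<lambda>h2. sweedler BT (rmul h1) (cop (T h2))) \<in> lin C BT"
    by (rule lin_comp[OF lin_comp[OF T_lin_C coprod_lin] BT.sweedler_lin[OF BT.tensor_cvs rmul_bilin[OF h1] rmul_descends[OF h1]]])
  then show "F2 h1 \<in> lin C BT" by (simp add: F2_def[abs_def])
next
  fix h2 assume "h2 \<in> carrier C"
  then show "(\<lambda>h1. F2 h1 h2) \<in> lin C BT"
    unfolding F2_def rmul_def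
    by (intro BT.sweedler_fun_lin coprod_closed T_C BT.tensor_cvs cvsC bp_lin2 C_mult_lin2 lin_id)
qed

lemma F2_homog:
  assumes "y \<in> G k" "a' \<in> G (-k)" "h1 \<in> carrier C"
  shows "F2 h1 (y \<star> a') = lsum BT (\<lambda>u v. bp (th' a' \<star> u) ((v \<star> y) \<bullet> h1)) (tau (-k))"
proof -
  have tha: "th' a' \<in> G (-k)" using assms(2) by (rule th'_G)
  have cl: "th' a' \<star> u \<in> carrier C" "v \<star> y \<in> carrier C" if "(u, v) \<in> set (tau (-k))" for u v
    using that assms tha by (auto intro!: homC_C' dest: tau(1,2))
  have "F2 h1 (y \<star> a') = sweedler BT (rmul h1) (lsum BT (\<lambda>u v. bp (th' a' \<star> u) (v \<star> y)) (tau (-k)))"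
    unfolding F2_def using assms coprod_homog[OF tha, of y] by (simp add: T_pure G_carrier)
  also have "\<dots> = lsum BT (\<lambda>u v. sweedler BT (rmul h1) (bp (th' a' \<star> u) (v \<star> y))) (tau (-k))"
    by (rule lin_lsum[OF BT.tensor_cvs BT.tensor_cvs
          BT.sweedler_lin[OF BT.tensor_cvs rmul_bilin[OF assms(3)] rmul_descends[OF assms(3)]]])
      (simp add: cl)
  also have "\<dots> = lsum BT (\<lambda>u v. bp (th' a' \<star> u) ((v \<star> y) \<bullet> h1)) (tau (-k))"
    by (rule lsum_cong)
      (simp add: cl BT.sweedler_pure[OF BT.tensor_cvs rmul_bilin[OF assms(3)] rmul_descends[OF assms(3)]] rmul_def)
  finally show ?thesis .
qed

text \<open>The mirror image of the first case: multiplying y \<otimes> a' by the source of b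
  multiplies its image under \<open>T\<close> on the right by the target of b. In the coproduct this
  target appears to the right of v \<otimes> y and is absorbed by P.\<close>

lemma F2_descends: "descends BT F2 (st_rel B C (es_src A) (es_tgt A))"
proof (rule descends_BT[OF BT.tensor_cvs F2_bilin])
  fix P b Q assume P: "P \<in> carrier C" and b: "b \<in> G 0" and Q: "Q \<in> carrier C"
  show "F2 (es_tgt A b \<bullet> P) Q = F2 P (es_src A b \<bullet> Q)"
  proof (rule C_lin_eqI[OF BT.tensor_cvs _ _ _ Q])
    show "F2 (es_tgt A b \<bullet> P) \<in> lin C BT"
      by (intro bilin_right[OF F2_bilin] C_mult_closed tgt_C b P)
    show "(\<lambda>Q. F2 P (es_src A b \<bullet> Q)) \<in> lin C BT"
      by (intro bilin_lin_comp2[OF F2_bilin] C_mult_lin2 lin_id src_C b P)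
    fix y a' k assume ya: "y \<in> G k" "a' \<in> G (-k)"
    then have yb: "b \<otimes> y \<in> G k" using b by (auto intro: G_mult_eq)
    have "F2 (es_tgt A b \<bullet> P) (y \<star> a')
        = lsum BT (\<lambda>u v. bp (th' a' \<star> u) ((v \<star> y) \<bullet> (es_tgt A b \<bullet> P))) (tau (-k))"
      by (rule F2_homog[OF ya]) (intro C_mult_closed tgt_C b P)
    also have "\<dots> = lsum BT (\<lambda>u v. bp (th' a' \<star> u) ((v \<star> (b \<otimes> y)) \<bullet> P)) (tau (-k))"
    proof (rule lsum_cong)
      fix u v assume uv: "(u, v) \<in> set (tau (-k))"
      then have "v \<star> y \<in> carrier C" using ya by (auto intro!: homC_C' dest: tau(1,2))
      then have "(v \<star> y) \<bullet> (es_tgt A b \<bullet> P) = ((v \<star> y) \<bullet> es_tgt A b) \<bullet> P"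
        using b P by (simp add: E_assoc tgt_C)
      also have "(v \<star> y) \<bullet> es_tgt A b = v \<star> (b \<otimes> y)"
        using ya b tau_carrier[OF uv] by (simp add: es_tgt_def E_mult G_carrier)
      finally show "bp (th' a' \<star> u) ((v \<star> y) \<bullet> (es_tgt A b \<bullet> P))
          = bp (th' a' \<star> u) ((v \<star> (b \<otimes> y)) \<bullet> P)" by simp
    qed
    also have "\<dots> = F2 P (es_src A b \<bullet> (y \<star> a'))"
      using ya b F2_homog[OF yb ya(2) P] by (simp add: src_mult G_carrier)
    finally show "F2 (es_tgt A b \<bullet> P) (y \<star> a') = F2 P (es_src A b \<bullet> (y \<star> a'))" .
  qed
qed

text \<open>The coproduct of T(y \<otimes> a') = \<open>th'\<close> a' \<otimes> y has the terms
  (\<open>th'\<close> a' \<otimes> u) \<otimes>_B (v \<otimes> y). Multiplying the second factor by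
  a \<otimes> x gives v a \<otimes> x y. Now v a lies in B and moves to the left, the opposite
  direction to the first axiom, and \<Sum> u v = 1 leaves \<open>th'\<close> a' \<otimes> a.\<close>

lemma F2_value:
  assumes "a \<in> G k" "a' \<in> G (-k)" "x \<in> G (-k)" "y \<in> G k"
  shows "F2 (a \<star> x) (y \<star> a') = bp (th' a' \<star> a) (deg0 (\<one> \<star> (x \<otimes> y)))"
proof -
  have xy: "x \<otimes> y \<in> G 0" using assms by (auto intro: G_mult_eq)
  have xyC: "\<one> \<star> (x \<otimes> y) \<in> carrier C" using xy G_one by (intro homC_C') auto
  have tha: "th' a' \<in> G (-k)" using assms(2) by (rule th'_G)
  note cA = assms[THEN G_carrier] tha[THEN G_carrier]
  have "F2 (a \<star> x) (y \<star> a') = lsum BT (\<lambda>u v. bp (th' a' \<star> u) ((v \<star> y) \<bullet> (a \<star> x))) (tau (-k))"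
    using assms by (intro F2_homog homC_C') auto
  also have "\<dots> = bp (deg0 (th' a' \<star> (\<one> \<otimes> a))) (\<one> \<star> (x \<otimes> y))"
  proof (rule tau_collapse[where L = "\<lambda>t. bp (deg0 (th' a' \<star> (t \<otimes> a))) (\<one> \<star> (x \<otimes> y))", OF BT.tensor_cvs])
    show "(\<lambda>t. bp (deg0 (th' a' \<star> (t \<otimes> a))) (\<one> \<star> (x \<otimes> y))) \<in> lin A BT"
      by (intro bp_lin1 xyC lin_comp[OF _ deg0_lin_C] star_lin2 mult_lin1 lin_id calg_axioms cA)
    fix u v assume uv: "(u, v) \<in> set (tau (-k))"
    have u: "u \<in> G k" and v: "v \<in> G (-k)" using tau(1,2)[OF uv] by simp_all
    have va: "v \<otimes> a \<in> G 0" and uva: "u \<otimes> (v \<otimes> a) \<in> G k"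
      using assms u v by (auto intro!: G_mult_eq[of u k _ 0] G_mult_eq[of v "-k" a k])
    have "(v \<star> y) \<bullet> (a \<star> x) = ((v \<otimes> a) \<otimes> \<one>) \<star> (x \<otimes> y)"
      using cA tau_carrier[OF uv] by (simp add: E_mult)
    then have "bp (th' a' \<star> u) ((v \<star> y) \<bullet> (a \<star> x)) = bp (th' a' \<star> (u \<otimes> (v \<otimes> a))) (\<one> \<star> (x \<otimes> y))"
      using bp_move[OF tha _ va G_one, of u] u xy by simp
    also have "th' a' \<star> (u \<otimes> (v \<otimes> a)) = deg0 (th' a' \<star> (u \<otimes> v \<otimes> a))"
      using cA tau_carrier[OF uv] deg0_homog[OF tha uva] by (simp add: m_assoc)
    finally show "bp (th' a' \<star> u) ((v \<star> y) \<bullet> (a \<star> x))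
        = bp (deg0 (th' a' \<star> (u \<otimes> v \<otimes> a))) (\<one> \<star> (x \<otimes> y))" .
  qed
  also have "\<dots> = bp (th' a' \<star> a) (deg0 (\<one> \<star> (x \<otimes> y)))"
    using deg0_C[OF xyC] deg0_homog[OF tha assms(1)] cA by simp
  finally show ?thesis .
qed

text \<open>The remaining sum over \<open>tau k\<close> involves x and y only through x y in the
  last leg.\<close>

lemma antipode2:
  assumes "P \<in> carrier C"
  shows "sweedler BT F2 (cop P) = bp (T P) (\<one> \<star> \<one>)"
proof -
  have oneC: "\<one> \<star> \<one> \<in> carrier C" using G_one by (intro homC_C') auto
  have F2_lin: "sweedler BT F2 \<in> lin BT BT"
    by (rule BT.sweedler_lin[OF BT.tensor_cvs F2_bilin F2_descends])
  show ?thesis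
  proof (rule C_lin_eqI[OF BT.tensor_cvs lin_comp[OF coprod_lin F2_lin] bp_lin1[OF T_lin_C oneC] _ assms])
    fix a a' k assume a: "a \<in> G k" "a' \<in> G (-k)"
    have tha: "th' a' \<in> G (-k)" using a(2) by (rule th'_G)
    have a'C: "th' a' \<star> a \<in> carrier C" using a tha by (intro homC_C') auto
    have cl: "a \<star> x \<in> carrier C" "y \<star> a' \<in> carrier C" if "(x, y) \<in> set (tau k)" for x y
      using that a by (auto intro!: homC_C' dest: tau(1,2))
    have "sweedler BT F2 (cop (a \<star> a')) = lsum BT (\<lambda>x y. sweedler BT F2 (bp (a \<star> x) (y \<star> a'))) (tau k)"
      unfolding coprod_homog[OF a]
      by (rule lin_lsum[OF BT.tensor_cvs BT.tensor_cvs F2_lin]) (simp add: cl)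
    also have "\<dots> = bp (th' a' \<star> a) (deg0 (\<one> \<star> \<one>))"
    proof (rule tau_collapse[where L = "\<lambda>t. bp (th' a' \<star> a) (deg0 (\<one> \<star> t))", OF BT.tensor_cvs])
      show "(\<lambda>t. bp (th' a' \<star> a) (deg0 (\<one> \<star> t))) \<in> lin A BT"
        by (intro bp_lin2 a'C lin_comp[OF _ deg0_lin_C] star_lin2 lin_id one_closed)
      fix x y assume xy: "(x, y) \<in> set (tau k)"
      show "sweedler BT F2 (bp (a \<star> x) (y \<star> a')) = bp (th' a' \<star> a) (deg0 (\<one> \<star> (x \<otimes> y)))"
        using F2_value[OF a tau(1,2)[OF xy]] BT.sweedler_pure[OF BT.tensor_cvs F2_bilin F2_descends cl[OF xy]]
        by simp
    qed
    also have "\<dots> = bp (T (a \<star> a')) (\<one> \<star> \<one>)"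
      using deg0_C[OF oneC] a by (simp add: T_pure G_carrier)
    finally show "sweedler BT F2 (cop (a \<star> a')) = bp (T (a \<star> a')) (\<one> \<star> \<one>)" .
  qed
qed

lemma is_antipode_S: "is_antipode D S"
  unfolding is_antipode_def Let_def D_simps
proof (intro conjI ballI S_bij S_anti_hom)
  show "S (es_tgt A b) = es_src A b" if "b \<in> carrier B" for b using that S_tgt by simp
  fix h assume h: "h \<in> carrier C"
  show "sweedler BT (\<lambda>h1 h2. sweedler BT (\<lambda>x y. bp (x \<otimes>\<^bsub>C\<^esub> h2) y) (cop (S h1))) (cop h)
      = bp \<one>\<^bsub>C\<^esub> (S h)"
    using antipode1[OF h] by (simp add: F1_def[abs_def] lmul_def[abs_def])
  \<comment> \<open>\<open>inv_into\<close> agrees with \<open>T\<close> only on C. The replacement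
    under the Sweedler sum is legitimate because the representative of an element of C \<otimes>_B C
    is supported on pairs from C.\<close>
  have "sweedler BT (\<lambda>h1 h2. sweedler BT (\<lambda>x y. bp x (y \<bullet> h1)) (cop (inv_into (carrier C) S h2))) (cop h)
      = sweedler BT F2 (cop h)"
    by (rule BT.sweedler_cong[OF coprod_closed[OF h] BT.tensor_cvs])
      (simp_all add: inv_S F2_def rmul_def[abs_def] bilin_closed[OF F2_bilin, unfolded F2_def rmul_def[abs_def]])
  then show "sweedler BT (\<lambda>h1 h2. sweedler BT (\<lambda>x y. bp x (y \<otimes>\<^bsub>C\<^esub> h1)) (cop (inv_into (carrier C) S h2))) (cop h)
      = bp (inv_into (carrier C) S h) \<one>\<^bsub>C\<^esub>"
    using antipode2[OF h] inv_S[OF h] by simp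
qed

end

section \<open>Quotient algebras and the free algebra\<close>

locale calg_ideal = calg A + ideal I A for A :: "(complex, 'a) module" (structure) and I
begin

sublocale Q: subspace A I
proof (rule subspace.intro[OF cvs_axioms], unfold_locales)
  fix x c assume x: "x \<in> I"
  \<comment> \<open>A ring ideal of a unital algebra is closed under scalars, since scaling by c is
    multiplication by c times the unit.\<close>
  have "c \<odot> x = (c \<odot> \<one>) \<otimes> x"
    using a_subset x by (auto simp: smult_assoc2)
  then show "c \<odot> x \<in> I" using x by (simp add: I_l_closed)
qed (auto simp: a_subset)

lemma quot_mult: "\<lbrakk>x \<in> carrier A; y \<in> carrier A\<rbrakk> \<Longrightarrow> (I +> x) \<otimes>\<^bsub>quot A I\<^esub> (I +> y) = I +> (x \<otimes> y)"
  by (simp add: Q.quot_simps rcoset_mult_add)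

lemma calg_quot: "calg (quot A I)"
proof (rule calgI[OF Q.cvs_quot])
  let ?Q = "quot A I"
  have repr: "\<exists>x\<in>carrier A. X = I +> x" if "X \<in> carrier ?Q" for X
    using that by (auto simp: Q.quot_simps)
  have closed: "I +> x \<in> carrier ?Q" if "x \<in> carrier A" for x
    using that by (simp add: Q.quot_simps)
  note simps = quot_mult Q.quot_add Q.quot_smult closed
  have 1: "X \<otimes>\<^bsub>?Q\<^esub> Y \<in> carrier ?Q"
      "(c \<odot>\<^bsub>?Q\<^esub> X) \<otimes>\<^bsub>?Q\<^esub> Y = c \<odot>\<^bsub>?Q\<^esub> (X \<otimes>\<^bsub>?Q\<^esub> Y)"
      "X \<otimes>\<^bsub>?Q\<^esub> (c \<odot>\<^bsub>?Q\<^esub> Y) = c \<odot>\<^bsub>?Q\<^esub> (X \<otimes>\<^bsub>?Q\<^esub> Y)"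
    if XY: "X \<in> carrier ?Q" "Y \<in> carrier ?Q" for X Y c
  proof -
    obtain x y where "x \<in> carrier A" "y \<in> carrier A" "X = I +> x" "Y = I +> y"
      using repr[OF XY(1)] repr[OF XY(2)] by blast
    then show "X \<otimes>\<^bsub>?Q\<^esub> Y \<in> carrier ?Q"
      "(c \<odot>\<^bsub>?Q\<^esub> X) \<otimes>\<^bsub>?Q\<^esub> Y = c \<odot>\<^bsub>?Q\<^esub> (X \<otimes>\<^bsub>?Q\<^esub> Y)"
      "X \<otimes>\<^bsub>?Q\<^esub> (c \<odot>\<^bsub>?Q\<^esub> Y) = c \<odot>\<^bsub>?Q\<^esub> (X \<otimes>\<^bsub>?Q\<^esub> Y)"
      by (simp_all add: simps smult_assoc2 smult_assoc3)
  qed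
  have 2: "(Y \<oplus>\<^bsub>?Q\<^esub> Z) \<otimes>\<^bsub>?Q\<^esub> X = Y \<otimes>\<^bsub>?Q\<^esub> X \<oplus>\<^bsub>?Q\<^esub> Z \<otimes>\<^bsub>?Q\<^esub> X"
      "X \<otimes>\<^bsub>?Q\<^esub> (Y \<oplus>\<^bsub>?Q\<^esub> Z) = X \<otimes>\<^bsub>?Q\<^esub> Y \<oplus>\<^bsub>?Q\<^esub> X \<otimes>\<^bsub>?Q\<^esub> Z"
    if XYZ: "X \<in> carrier ?Q" "Y \<in> carrier ?Q" "Z \<in> carrier ?Q" for X Y Z
  proof -
    obtain x y z where "x \<in> carrier A" "y \<in> carrier A" "z \<in> carrier A"
      "X = I +> x" "Y = I +> y" "Z = I +> z"
      using repr[OF XYZ(1)] repr[OF XYZ(2)] repr[OF XYZ(3)] by blast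
    then show "(Y \<oplus>\<^bsub>?Q\<^esub> Z) \<otimes>\<^bsub>?Q\<^esub> X = Y \<otimes>\<^bsub>?Q\<^esub> X \<oplus>\<^bsub>?Q\<^esub> Z \<otimes>\<^bsub>?Q\<^esub> X"
      "X \<otimes>\<^bsub>?Q\<^esub> (Y \<oplus>\<^bsub>?Q\<^esub> Z) = X \<otimes>\<^bsub>?Q\<^esub> Y \<oplus>\<^bsub>?Q\<^esub> X \<otimes>\<^bsub>?Q\<^esub> Z"
      by (simp_all add: simps l_distr r_distr)
  qed
  show "bilin ?Q ?Q ?Q (mult ?Q)"
    by (intro bilinI linI) (simp_all only: 1 2)
  show "\<one>\<^bsub>?Q\<^esub> \<in> carrier ?Q" by (simp add: Q.quot_simps)
  fix X assume X: "X \<in> carrier ?Q"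
  then obtain x where x: "x \<in> carrier A" "X = I +> x" using repr[of X] by blast
  then show "\<one>\<^bsub>?Q\<^esub> \<otimes>\<^bsub>?Q\<^esub> X = X" "X \<otimes>\<^bsub>?Q\<^esub> \<one>\<^bsub>?Q\<^esub> = X"
    unfolding Q.quot_simps(3) by (simp_all add: quot_mult)
  fix Y Z assume "Y \<in> carrier ?Q" "Z \<in> carrier ?Q"
  then obtain y z where "y \<in> carrier A" "z \<in> carrier A" "Y = I +> y" "Z = I +> z"
    using repr[of Y] repr[of Z] by blast
  then show "(X \<otimes>\<^bsub>?Q\<^esub> Y) \<otimes>\<^bsub>?Q\<^esub> Z = X \<otimes>\<^bsub>?Q\<^esub> (Y \<otimes>\<^bsub>?Q\<^esub> Z)"
    using x by (simp add: simps m_assoc)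
qed

lemma coset_alg_hom: "(\<lambda>x. I +> x) \<in> alg_hom A (quot A I)"
  by (rule alg_homI[OF Q.coset_lin]) (simp_all add: Q.quot_simps(3) quot_mult)

lemma quot_lift:
  assumes Z: "calg Z" and L: "L \<in> alg_hom A Z" and kills: "\<And>x. x \<in> I \<Longrightarrow> L x = \<zero>\<^bsub>Z\<^esub>"
  shows "\<exists>f \<in> alg_hom (quot A I) Z. \<forall>x\<in>carrier A. f (I +> x) = L x"
proof -
  define f where "f X = L (SOME x. x \<in> X)" for X
  have f: "f (I +> x) = L x" if "x \<in> carrier A" for x
    unfolding f_def
    by (rule Q.lin_const_on_coset[OF calg_cvs[OF Z] alg_hom_lin[OF L] kills that])
      (assumption, rule someI[of "\<lambda>x. x \<in> _", OF a_rcos_self[OF that]])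
  have "f \<in> alg_hom (quot A I) Z"
  proof (rule alg_homI)
    show "f \<in> lin (quot A I) Z"
      by (rule Q.quot_lift_lin[OF calg_cvs[OF Z] alg_hom_lin[OF L] kills f])
    show "f \<one>\<^bsub>quot A I\<^esub> = \<one>\<^bsub>Z\<^esub>"
      by (simp add: Q.quot_simps(3) f alg_hom_one[OF L])
    fix X Y assume "X \<in> carrier (quot A I)" "Y \<in> carrier (quot A I)"
    then obtain x y where "x \<in> carrier A" "y \<in> carrier A" "X = I +> x" "Y = I +> y"
      by (auto simp: Q.quot_simps)
    then show "f (X \<otimes>\<^bsub>quot A I\<^esub> Y) = f X \<otimes>\<^bsub>Z\<^esub> f Y"
      by (simp add: quot_mult f alg_hom_mult[OF L])
  qed
  then show ?thesis using f by blast
qed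

end

text \<open>The sphere ideal is the smallest ideal containing the relations and their adjoints, so a
  homomorphism that kills these generators kills all of it once its kernel is known to be an
  ideal.\<close>

lemma alg_hom_kernel_ideal:
  assumes "calg A" "calg Z" "L \<in> alg_hom A Z"
  shows "ideal {x \<in> carrier A. L x = \<zero>\<^bsub>Z\<^esub>} A"
proof -
  interpret A: calg A by fact
  interpret Z: calg Z by fact
  have "ring_hom_ring A Z L"
    using assms(3) by (intro ring_hom_ringI2 A.ring_axioms Z.ring_axioms) (simp add: alg_hom_def)
  then show ?thesis
    using ring_hom_ring.kernel_is_ideal[of A Z L] by (simp add: a_kernel_def')
qed

section \<open>Weights of words and the homogeneity of the sphere relations\<close>

definition wt :: "(nat \<Rightarrow> int) \<Rightarrow> word \<Rightarrow> int" where
  "wt c w = sum_list (map (\<lambda>l. case l of Gen i \<Rightarrow> c i | GenStar i \<Rightarrow> - c i) (letters w))"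

lemma wt_simps [simp]: "wt c 0 = 0" "wt c (u + v) = wt c u + wt c v" "wt c (Word []) = 0"
  "wt c (Word [Gen i]) = c i" "wt c (Word [GenStar i]) = - c i"
  by (simp_all add: wt_def zero_word_def plus_word_def)

lemma wt_star: "wt c (word_star w) = - wt c w"
proof -
  have "sum_list (map (\<lambda>l. case l of Gen i \<Rightarrow> c i | GenStar i \<Rightarrow> - c i) (map letter_star ls))
      = - sum_list (map (\<lambda>l. case l of Gen i \<Rightarrow> c i | GenStar i \<Rightarrow> - c i) ls)" for ls
    by (induction ls) (auto split: letter.split)
  then show ?thesis
    by (simp add: wt_def word_star_def rev_map[symmetric] del: map_map)
qed

definition wt_homog :: "(nat \<Rightarrow> int) \<Rightarrow> int \<Rightarrow> (word \<Rightarrow>\<^sub>0 complex) \<Rightarrow> bool" where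
  "wt_homog c d p \<longleftrightarrow> (\<forall>w\<in>Poly_Mapping.keys p. wt c w = d)"

lemma wt_homog_diff: "wt_homog c d p \<Longrightarrow> wt_homog c d r \<Longrightarrow> wt_homog c d (p - r)"
  unfolding wt_homog_def using keys_diff[of p r] by blast

lemma wt_homog_sum: "(\<And>j. j \<in> S \<Longrightarrow> wt_homog c d (f j)) \<Longrightarrow> wt_homog c d (\<Sum>j\<in>S. f j)"
  unfolding wt_homog_def using keys_sum[of f S] by blast

lemma wt_homog_fscale: "wt_homog c d p \<Longrightarrow> wt_homog c d (fscale a p)"
  unfolding wt_homog_def using keys_fscale[of a p] by blast

lemma wt_homog_mult: "wt_homog c d p \<Longrightarrow> wt_homog c e r \<Longrightarrow> wt_homog c (d + e) (p * r)"
  unfolding wt_homog_def using keys_mult[of p r] by fastforce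

lemma wt_homog_gen: "wt_homog c (c i) (zf i)" "wt_homog c (- c i) (zsf i)" "wt_homog c 0 1"
  by (simp_all add: wt_homog_def zf_def zsf_def)

lemma wt_homog_mult_gen:
  "wt_homog c (c i + c j) (zf i * zf j)" "wt_homog c (c i - c j) (zf i * zsf j)"
  "wt_homog c (c j - c i) (zsf i * zf j)"
  using wt_homog_mult[OF wt_homog_gen(1) wt_homog_gen(1), of c i j]
    wt_homog_mult[OF wt_homog_gen(1) wt_homog_gen(2), of c i j]
    wt_homog_mult[OF wt_homog_gen(2) wt_homog_gen(1), of c i j] by simp_all

lemma wt_homog_eq: "wt_homog c d p \<Longrightarrow> d = e \<Longrightarrow> wt_homog c e p"
  by simp

lemma letter_star_star [simp]: "letter_star (letter_star l) = l"
  by (cases l) simp_all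

lemma word_star_star [simp]: "word_star (word_star w) = w"
  by (cases w) (simp add: word_star_def rev_map[symmetric] comp_def)

lemma inj_word_star: "inj word_star"
  by (rule inj_on_inverseI[of _ word_star]) simp

lemma keys_free_star: "w \<in> Poly_Mapping.keys (free_star p) \<Longrightarrow> word_star w \<in> Poly_Mapping.keys p"
  by (auto simp: free_star_def in_keys_iff Poly_Mapping.map.rep_eq map_key.rep_eq[OF inj_word_star] when_def split: if_splits)

text \<open>The adjoints of the relations are imposed too; the involution exchanges starred and
  unstarred letters, so they are again homogeneous, of the opposite weight.\<close>

lemma wt_homog_free_star: "wt_homog c d p \<Longrightarrow> wt_homog c (- d) (free_star p)"
  unfolding wt_homog_def using keys_free_star wt_star[of c] by force

text \<open>The two words in a commutation relation consist of the same letters in different order.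
  In the other relations every word is empty or has the form z_j z_j^* or z_j^* z_j, of weight 0 for
  any choice of \<open>c\<close>.\<close>

lemma sphere_rels_homog:
  assumes "r \<in> sphere_rels n q"
  shows "\<exists>d. wt_homog c d r"
proof -
  note intros = wt_homog_diff wt_homog_fscale wt_homog_mult_gen wt_homog_sum
  consider i j where "r = zf i * zf j - fscale (of_real q) (zf j * zf i)"
    | i j where "r = zsf i * zf j - fscale (of_real q) (zf j * zsf i)"
    | "r = zsf 1 * zf 1 - zf 1 * zsf 1"
    | k where "r = (zsf k * zf k - zf k * zsf k) - fscale (of_real (1 - q\<^sup>2)) (\<Sum>j=1..k-1. zf j * zsf j)"
    | "r = (\<Sum>j=1..n. zf j * zsf j) - 1"
    using assms unfolding sphere_rels_def by blast
  then show ?thesis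
  proof cases
    case (1 i j)
    have "wt_homog c (c i + c j) r"
      unfolding 1 by (intro intros wt_homog_eq[OF wt_homog_mult_gen(1)]) simp_all
    then show ?thesis ..
  next
    case (2 i j)
    have "wt_homog c (c j - c i) r" unfolding 2 by (intro intros)
    then show ?thesis ..
  next
    case 3
    have "wt_homog c (c 1 - c 1) r" unfolding 3 by (intro intros)
    then show ?thesis ..
  next
    case (4 k)
    have "wt_homog c 0 (zf j * zsf j)" for j using wt_homog_mult_gen(2)[of c j j] by simp
    moreover have "wt_homog c 0 (zsf j * zf j)" for j using wt_homog_mult_gen(3)[of c j j] by simp
    ultimately have "wt_homog c 0 r" unfolding 4 by (intro wt_homog_diff wt_homog_fscale wt_homog_sum)
    then show ?thesis ..
  next
    case 5
    have "wt_homog c 0 (zf j * zsf j)" for j using wt_homog_mult_gen(2)[of c j j] by simp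
    then have "wt_homog c 0 r" unfolding 5 by (intro wt_homog_diff wt_homog_sum wt_homog_gen)
    then show ?thesis ..
  qed
qed

section \<open>The free algebra and its homomorphisms\<close>

abbreviation alphabet :: "nat \<Rightarrow> letter set" where
  "alphabet n \<equiv> Gen ` {1..n} \<union> GenStar ` {1..n}"

abbreviation words :: "nat \<Rightarrow> word set" where
  "words n \<equiv> {w. set (letters w) \<subseteq> alphabet n}"

lemma free_alg_simps [simp]:
  "carrier (free_alg n) = {p. Poly_Mapping.keys p \<subseteq> words n}" "\<zero>\<^bsub>free_alg n\<^esub> = 0"
  "x \<oplus>\<^bsub>free_alg n\<^esub> y = x + y" "c \<odot>\<^bsub>free_alg n\<^esub> x = fscale c x" "\<one>\<^bsub>free_alg n\<^esub> = 1"
  "x \<otimes>\<^bsub>free_alg n\<^esub> y = x * y"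
  by (simp_all add: free_alg_def)

lemma calg_free_alg: "calg (free_alg n)"
  unfolding free_alg_def by (rule calg_monoid_algebra) (auto simp: zero_word_def plus_word_def)

lemma free_alg_minus:
  assumes "x \<in> carrier (free_alg n)" "y \<in> carrier (free_alg n)"
  shows "x \<ominus>\<^bsub>free_alg n\<^esub> y = x - y"
proof -
  interpret calg "free_alg n" by (rule calg_free_alg)
  have "\<ominus>\<^bsub>free_alg n\<^esub> y = - y"
    using assms(2) by (intro minus_equality) auto
  then show ?thesis by (simp add: minus_eq)
qed

lemma free_alg_span: "carrier (free_alg n) = lspan (free_alg n) ((\<lambda>w. Poly_Mapping.single w 1) ` words n)"
proof -
  have "lspan (free_alg n) X = lspan (free_vs (words n)) X" for X
    by (rule lspan_cong) (simp_all add: fun_eq_iff)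
  then show ?thesis using free_vs_span[of "words n"] by simp
qed

lemma lin_free_alg: "lin (free_vs (words n)) Z = lin (free_alg n) Z"
  by (simp add: lin_def)

text \<open>A monoid homomorphism from words to the multiplicative monoid of \<open>Z\<close>
  extends linearly; multiplicativity is checked on words and extended in one factor at a
  time.\<close>

lemma free_alg_hom:
  assumes Z: "calg Z" and b: "\<And>w. w \<in> words n \<Longrightarrow> b w \<in> carrier Z" "b 0 = \<one>\<^bsub>Z\<^esub>"
    "\<And>u v. \<lbrakk>u \<in> words n; v \<in> words n\<rbrakk> \<Longrightarrow> b (u + v) = b u \<otimes>\<^bsub>Z\<^esub> b v"
  shows "flin Z b \<in> alg_hom (free_alg n) Z"
proof -
  interpret Z: calg Z by fact
  interpret F: calg "free_alg n" by (rule calg_free_alg)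
  let ?L = "flin Z b"
  let ?X = "(\<lambda>w. Poly_Mapping.single w (1 :: complex)) ` words n"
  have L: "?L \<in> lin (free_alg n) Z"
    unfolding lin_free_alg[symmetric] by (rule Z.flin_lin) (rule b(1))
  have XF: "?X \<subseteq> carrier (free_alg n)" by auto
  have single: "?L (Poly_Mapping.single w 1) = b w" if "w \<in> words n" for w
    using b(1)[OF that] by simp
  have plus: "u + v \<in> words n" if "u \<in> words n" "v \<in> words n" for u v
    using that by (auto simp: plus_word_def)
  note eqI = lin_eqI[OF F.cvs_axioms Z.cvs_axioms _ _ XF]
  show ?thesis
  proof (rule alg_homI[OF L])
    have "0 \<in> words n" by (simp add: zero_word_def)
    from single[OF this] b(2) show "?L \<one>\<^bsub>free_alg n\<^esub> = \<one>\<^bsub>Z\<^esub>" by simp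
    fix x y assume x: "x \<in> carrier (free_alg n)" and y: "y \<in> carrier (free_alg n)"
    show "?L (x \<otimes>\<^bsub>free_alg n\<^esub> y) = ?L x \<otimes>\<^bsub>Z\<^esub> ?L y"
    proof (rule eqI[where x = x])
      show "(\<lambda>x. ?L (x \<otimes>\<^bsub>free_alg n\<^esub> y)) \<in> lin (free_alg n) Z"
        by (rule lin_comp[OF mult_lin1[OF calg_free_alg lin_id y] L])
      show "(\<lambda>x. ?L x \<otimes>\<^bsub>Z\<^esub> ?L y) \<in> lin (free_alg n) Z"
        by (rule mult_lin1[OF Z L lin_closed[OF L y]])
      show "x \<in> lspan (free_alg n) ?X" using x free_alg_span[of n] by blast
      fix x assume "x \<in> ?X"
      then obtain u where u: "u \<in> words n" "x = Poly_Mapping.single u 1" by blast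
      then have x: "x \<in> carrier (free_alg n)" by auto
      show "?L (x \<otimes>\<^bsub>free_alg n\<^esub> y) = ?L x \<otimes>\<^bsub>Z\<^esub> ?L y"
      proof (rule eqI[where x = y])
        show "(\<lambda>y. ?L (x \<otimes>\<^bsub>free_alg n\<^esub> y)) \<in> lin (free_alg n) Z"
          by (rule lin_comp[OF mult_lin2[OF calg_free_alg lin_id x] L])
        show "(\<lambda>y. ?L x \<otimes>\<^bsub>Z\<^esub> ?L y) \<in> lin (free_alg n) Z"
          by (rule mult_lin2[OF Z L lin_closed[OF L x]])
        show "y \<in> lspan (free_alg n) ?X" using y free_alg_span[of n] by blast
        fix y assume "y \<in> ?X"
        then obtain v where v: "v \<in> words n" "y = Poly_Mapping.single v 1" by blast
        then show "?L (x \<otimes>\<^bsub>free_alg n\<^esub> y) = ?L x \<otimes>\<^bsub>Z\<^esub> ?L y"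
          using u single[OF plus[OF u(1) v(1)]] single[OF u(1)] single[OF v(1)] b(3)
          by (simp add: mult_single)
      qed
    qed
  qed
qed

section \<open>The quantum sphere\<close>

locale sphere =
  fixes n :: nat and q :: real
  assumes n: "1 \<le> n" and q: "0 < q"
begin

abbreviation "R \<equiv> sphere_rels n q \<union> free_star ` sphere_rels n q"
abbreviation "F \<equiv> free_alg n"
abbreviation "I \<equiv> sphere_ideal n q"
abbreviation "A \<equiv> qsphere n q"

definition cls :: "(word \<Rightarrow>\<^sub>0 complex) \<Rightarrow> (word \<Rightarrow>\<^sub>0 complex) set" where
  "cls p = I +>\<^bsub>F\<^esub> p"

abbreviation mon :: "word \<Rightarrow> (word \<Rightarrow>\<^sub>0 complex) set" where
  "mon w \<equiv> cls (Poly_Mapping.single w 1)"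

sublocale F: calg F by (rule calg_free_alg)

lemma zf_F: "i \<in> {1..n} \<Longrightarrow> zf i \<in> carrier F" "i \<in> {1..n} \<Longrightarrow> zsf i \<in> carrier F"
  by (auto simp: zf_def zsf_def)

lemma F_closed:
  "x \<in> carrier F \<Longrightarrow> y \<in> carrier F \<Longrightarrow> x * y \<in> carrier F"
  "x \<in> carrier F \<Longrightarrow> y \<in> carrier F \<Longrightarrow> x - y \<in> carrier F"
  "x \<in> carrier F \<Longrightarrow> fscale c x \<in> carrier F" "1 \<in> carrier F"
  using F.m_closed[of x y] F.minus_closed[of x y] F.smult_closed[of x c] F.one_closed
    free_alg_minus[of x n y]
  by simp_all

lemma sum_F:
  assumes "finite S" "\<And>j. j \<in> S \<Longrightarrow> f j \<in> carrier F"
  shows "(\<Sum>j\<in>S. f j) \<in> carrier F"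
  using assms
proof (induction S)
  case empty
  then show ?case using F.zero_closed by simp
next
  case (insert j S)
  then show ?case using F.a_closed[of "f j" "\<Sum>j\<in>S. f j"] by simp
qed

lemma sphere_rels_F: "sphere_rels n q \<subseteq> carrier F"
proof
  fix r assume "r \<in> sphere_rels n q"
  then consider i j where "r = zf i * zf j - fscale (of_real q) (zf j * zf i)" "1 \<le> i" "i < j" "j \<le> n"
    | i j where "r = zsf i * zf j - fscale (of_real q) (zf j * zsf i)" "i \<in> {1..n}" "j \<in> {1..n}"
    | "r = zsf 1 * zf 1 - zf 1 * zsf 1"
    | k where "r = (zsf k * zf k - zf k * zsf k) - fscale (of_real (1 - q\<^sup>2)) (\<Sum>j=1..k-1. zf j * zsf j)" "1 < k" "k \<le> n"
    | "r = (\<Sum>j=1..n. zf j * zsf j) - 1"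
    unfolding sphere_rels_def by blast
  then show "r \<in> carrier F"
  proof cases
    case (1 i j)
    then have "i \<in> {1..n}" "j \<in> {1..n}" by simp_all
    then show ?thesis unfolding 1(1) by (intro F_closed zf_F)
  next
    case (2 i j)
    show ?thesis unfolding 2(1) using 2(2,3) by (intro F_closed zf_F)
  next
    case 3
    show ?thesis unfolding 3 using n by (intro F_closed zf_F) simp_all
  next
    case (4 k)
    show ?thesis unfolding 4(1) using 4(2,3) by (intro F_closed zf_F sum_F) auto
  next
    case 5
    show ?thesis unfolding 5 by (intro F_closed zf_F sum_F) simp_all
  qed
qed

lemma free_star_F: "p \<in> carrier F \<Longrightarrow> free_star p \<in> carrier F"
proof -
  assume p: "p \<in> carrier F"
  have "w \<in> words n" if "w \<in> Poly_Mapping.keys (free_star p)" for w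
  proof -
    have star: "set (letters (word_star w)) \<subseteq> alphabet n"
      using keys_free_star[OF that] p by auto
    have "l \<in> alphabet n" if "l \<in> set (letters w)" for l
    proof -
      have "letter_star l \<in> set (letters (word_star w))" using that by (simp add: word_star_def)
      then have "letter_star l \<in> alphabet n" using star by (rule subsetD[rotated])
      then show ?thesis by (cases l) auto
    qed
    then show ?thesis by blast
  qed
  then show ?thesis unfolding free_alg_simps by blast
qed

lemma R_F: "R \<subseteq> carrier F"
  using sphere_rels_F free_star_F by blast

sublocale I: calg_ideal F I
  unfolding sphere_ideal_def by (intro calg_ideal.intro F.calg_axioms F.genideal_ideal R_F)

lemma A_eq: "A = quot F I"
  by (simp add: qsphere_def)

lemma calg_A: "calg A"
  unfolding A_eq by (rule I.calg_quot)

sublocale A: calg A by (rule calg_A)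

lemma cls_hom: "cls \<in> alg_hom F A"
  unfolding A_eq cls_def[abs_def] by (rule I.coset_alg_hom)

lemmas cls_lin = alg_hom_lin[OF cls_hom]
lemmas cls_closed = lin_closed[OF cls_lin]

lemma cls_zero_iff: "x \<in> carrier F \<Longrightarrow> cls x = \<zero>\<^bsub>A\<^esub> \<longleftrightarrow> x \<in> I"
  unfolding cls_def A_eq I.Q.quot_simps by (rule I.Q.coset_zero_iff)

lemma mon_closed: "w \<in> words n \<Longrightarrow> mon w \<in> carrier A"
  by (rule cls_closed) simp

lemma mon_plus: "u \<in> words n \<Longrightarrow> v \<in> words n \<Longrightarrow> mon (u + v) = mon u \<otimes>\<^bsub>A\<^esub> mon v"
  using alg_hom_mult[OF cls_hom, of "Poly_Mapping.single u 1" "Poly_Mapping.single v 1"]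
  by (simp add: mult_single)

lemma mon_zero: "mon 0 = \<one>\<^bsub>A\<^esub>"
  using alg_hom_one[OF cls_hom] by simp

lemma A_span: "carrier A = lspan A (mon ` words n)"
proof -
  have "carrier A = lspan A (cls ` (\<lambda>w. Poly_Mapping.single w 1) ` words n)"
    unfolding A_eq cls_def[abs_def] by (rule I.Q.quot_span[OF free_alg_span]) auto
  then show ?thesis by (simp add: image_image)
qed

lemma qs_z_mon: "qs_z n q i = mon (Word [Gen i])" "qs_zs n q i = mon (Word [GenStar i])"
  by (simp_all add: qs_z_def qs_zs_def cls_def zf_def zsf_def)

text \<open>The relations are homogeneous for every grading of the free algebra by weights.  The coaction
  and the automorphisms in the antipode are both instances.\<close>

lemma weighted_hom:
  fixes c :: "nat \<Rightarrow> int"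
  assumes Z: "calg Z" and g: "\<And>d. g d \<in> lin A Z" "g 0 \<one>\<^bsub>A\<^esub> = \<one>\<^bsub>Z\<^esub>"
    "\<And>d e x y. \<lbrakk>x \<in> carrier A; y \<in> carrier A\<rbrakk> \<Longrightarrow> g (d + e) (x \<otimes>\<^bsub>A\<^esub> y) = g d x \<otimes>\<^bsub>Z\<^esub> g e y"
  shows "\<exists>f \<in> alg_hom A Z. \<forall>w\<in>words n. f (mon w) = g (wt c w) (mon w)"
proof -
  interpret Z: calg Z by fact
  define b where "b w = g (wt c w) (mon w)" for w
  have b_closed: "b w \<in> carrier Z" if "w \<in> words n" for w
    unfolding b_def using lin_closed[OF g(1) mon_closed[OF that]] .
  have L: "flin Z b \<in> alg_hom F Z"
  proof (rule free_alg_hom[OF Z b_closed])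
    show "b 0 = \<one>\<^bsub>Z\<^esub>" unfolding b_def wt_simps mon_zero by (rule g(2))
    show "b (u + v) = b u \<otimes>\<^bsub>Z\<^esub> b v" if "u \<in> words n" "v \<in> words n" for u v
      using that by (simp only: b_def mon_plus wt_simps g(3) mon_closed)
  qed
  \<comment> \<open>On polynomials of a single weight d the map on the free algebra is
    \<open>g d\<close> applied to the class in A. A homogeneous relation has class 0 and is
    therefore sent to \<open>g d\<close> of 0.\<close>
  have homog: "flin Z b r = g d (cls r)" if r: "r \<in> carrier F" "wt_homog c d r" for r d
  proof -
    have gd: "g d (mon w) \<in> carrier Z" if "w \<in> words n" for w
      using lin_closed[OF g(1) mon_closed[OF that]] .
    have "flin Z b r = flin Z (\<lambda>w. g d (mon w)) r"
      by (rule Z.flin_cong) (use r gd in \<open>auto simp: b_def wt_homog_def\<close>)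
    also have "\<dots> = g d (cls r)"
    proof (rule lin_eqI[OF F.cvs_axioms Z.cvs_axioms])
      show "flin Z (\<lambda>w. g d (mon w)) \<in> lin F Z"
        unfolding lin_free_alg[symmetric] by (rule Z.flin_lin) (rule gd)
      show "(\<lambda>r. g d (cls r)) \<in> lin F Z" by (rule lin_comp[OF cls_lin g(1)])
      show "r \<in> lspan F ((\<lambda>w. Poly_Mapping.single w 1) ` words n)"
        using r(1) free_alg_span[of n] by blast
      show "flin Z (\<lambda>w. g d (mon w)) x = g d (cls x)" if "x \<in> (\<lambda>w. Poly_Mapping.single w 1) ` words n" for x
      proof -
        obtain w where w: "w \<in> words n" "x = Poly_Mapping.single w 1" using \<open>x \<in> _\<close> by blast
        then show ?thesis
          using Z.flin_single[where f = "\<lambda>w. g d (mon w)" and k = w and c = 1] gd[OF w(1)] by simp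
      qed
    qed auto
    finally show ?thesis .
  qed
  have R: "flin Z b r = \<zero>\<^bsub>Z\<^esub>" if r: "r \<in> R" for r
  proof -
    obtain d where d: "wt_homog c d r"
      using r sphere_rels_homog wt_homog_free_star by blast
    have rF: "r \<in> carrier F" using r R_F by blast
    have "r \<in> I" unfolding sphere_ideal_def using F.genideal_self[OF R_F] r by blast
    then have "cls r = \<zero>\<^bsub>A\<^esub>" using cls_zero_iff[OF rF] by simp
    then show ?thesis
      using homog[OF rF d] lin_zero[OF A.cvs_axioms Z.cvs_axioms g(1)] by simp
  qed
  have "I \<subseteq> {x \<in> carrier F. flin Z b x = \<zero>\<^bsub>Z\<^esub>}"
    unfolding sphere_ideal_def
    by (rule F.genideal_minimal[OF alg_hom_kernel_ideal[OF F.calg_axioms Z L]]) (use R R_F in blast)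
  then obtain f where f: "f \<in> alg_hom A Z" "\<forall>x\<in>carrier F. f (I +>\<^bsub>F\<^esub> x) = flin Z b x"
    using I.quot_lift[OF Z L] unfolding A_eq by blast
  have "f (mon w) = g (wt c w) (mon w)" if w: "w \<in> words n" for w
  proof -
    have "Poly_Mapping.single w 1 \<in> carrier F" using w by simp
    then have "f (mon w) = flin Z b (Poly_Mapping.single w 1)" using f(2) by (simp add: cls_def)
    then show ?thesis using b_closed[OF w] by (simp add: b_def)
  qed
  then show ?thesis using f(1) by blast
qed

text \<open>Supplies the uniqueness in the definition of the coaction by its values on the
  generators.\<close>

lemma A_hom_eqI:
  assumes Z: "calg Z" and f: "f \<in> alg_hom A Z" "f' \<in> alg_hom A Z"
    and eq: "\<And>i. i \<in> {1..n} \<Longrightarrow> f (qs_z n q i) = f' (qs_z n q i)" "\<And>i. i \<in> {1..n} \<Longrightarrow> f (qs_zs n q i) = f' (qs_zs n q i)"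
    and x: "x \<in> carrier A"
  shows "f x = f' x"
proof (rule lin_eqI[OF A.cvs_axioms calg_cvs[OF Z] alg_hom_lin[OF f(1)] alg_hom_lin[OF f(2)]])
  show "x \<in> lspan A (mon ` words n)" using x A_span by simp
  show "mon ` words n \<subseteq> carrier A" using mon_closed by blast
  fix x assume "x \<in> mon ` words n"
  then obtain w where w: "w \<in> words n" "x = mon w" by blast
  have "f (mon (Word ls)) = f' (mon (Word ls))" if "set ls \<subseteq> alphabet n" for ls
    using that
  proof (induction ls)
    case Nil
    then show ?case
      using alg_hom_one[OF f(1)] alg_hom_one[OF f(2)] mon_zero by (simp add: zero_word_def)
  next
    case (Cons l ls)
    have l: "Word [l] \<in> words n" "Word ls \<in> words n" using Cons.prems by simp_all
    have "Word (l # ls) = Word [l] + Word ls" by (simp add: plus_word_def)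
    then have m: "mon (Word (l # ls)) = mon (Word [l]) \<otimes>\<^bsub>A\<^esub> mon (Word ls)"
      using mon_plus[OF l] by simp
    have "f (mon (Word [l])) = f' (mon (Word [l]))"
      using Cons.prems eq by (auto simp: qs_z_mon simp del: atLeastAtMost_iff)
    then show ?case
      using Cons mon_closed[OF l(1)] mon_closed[OF l(2)]
      by (simp add: m alg_hom_mult[OF f(1)] alg_hom_mult[OF f(2)])
  qed
  from this[of "letters w"] show "f x = f' x" using w by simp
qed

subsection \<open>The coaction\<close>

abbreviation "Z \<equiv> tens_alg A OU1"
abbreviation "U k \<equiv> Poly_Mapping.single (k :: int) (1 :: complex)"
abbreviation "rho \<equiv> sphere_coaction n q"
abbreviation "deg \<equiv> wt (\<lambda>_. 1)"

sublocale AU: two_calg A OU1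
  by (intro two_calg.intro calg_A calg_OU1)

lemma rho_exists:
  "\<exists>f \<in> alg_hom A Z. \<forall>w\<in>words n. f (mon w) = tpure A OU1 (mon w) (U (deg w))"
proof -
  have 1: "(\<lambda>x. tpure A OU1 x (U d)) \<in> lin A Z" for d
    using tpure_lin1[OF A.cvs_axioms cvs_OU1 lin_id, of "U d"] by (simp add: lin_def)
  show ?thesis
    by (rule weighted_hom[where g = "\<lambda>d x. tpure A OU1 x (U d)", OF AU.calg_tens_alg 1])
      (use AU.tens_mult_pure in \<open>auto simp: mult_single\<close>)
qed

lemma alg_hom_restrict:
  assumes "calg A'" "f \<in> alg_hom A' Z'"
  shows "restrict f (carrier A') \<in> alg_hom A' Z'"
proof -
  interpret A': calg A' by fact
  show ?thesis using assms(2) by (auto simp: alg_hom_def ring_hom_def)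
qed

lemma rho:
  "rho \<in> alg_hom A Z" "w \<in> words n \<Longrightarrow> rho (mon w) = tpure A OU1 (mon w) (U (deg w))"
proof -
  obtain f where f: "f \<in> alg_hom A Z" "\<forall>w\<in>words n. f (mon w) = tpure A OU1 (mon w) (U (deg w))"
    using rho_exists by blast
  \<comment> \<open>A homomorphism is arbitrary outside the carrier; restricting it singles out the
    extensional function that the definition of \<open>sphere_coaction\<close> asks for.\<close>
  define r where "r = restrict f (carrier A)"
  have gens: "Word [Gen i] \<in> words n" "Word [GenStar i] \<in> words n" if "i \<in> {1..n}" for i
    using that by auto
  have r: "r \<in> alg_hom A Z" unfolding r_def by (rule alg_hom_restrict[OF calg_A f(1)])
  have rmon: "r (mon w) = tpure A OU1 (mon w) (U (deg w))" if "w \<in> words n" for w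
    using f(2) that mon_closed[OF that] by (simp add: r_def)
  have "rho = r"
    unfolding sphere_coaction_def
  proof (rule the_equality)
    show "r \<in> extensional (carrier A) \<and> r \<in> alg_hom A Z \<and>
      (\<forall>i\<in>{1..n}. r (qs_z n q i) = tpure A OU1 (qs_z n q i) (U 1) \<and>
                  r (qs_zs n q i) = tpure A OU1 (qs_zs n q i) (U (- 1)))"
      using r rmon[OF gens(1)] rmon[OF gens(2)] by (simp add: r_def qs_z_mon)
    fix s assume s: "s \<in> extensional (carrier A) \<and> s \<in> alg_hom A Z \<and>
      (\<forall>i\<in>{1..n}. s (qs_z n q i) = tpure A OU1 (qs_z n q i) (U 1) \<and>
                  s (qs_zs n q i) = tpure A OU1 (qs_zs n q i) (U (- 1)))"
    show "s = r"
    proof (rule extensionalityI[of _ "carrier A"])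
      fix x assume x: "x \<in> carrier A"
      show "s x = r x"
        by (rule A_hom_eqI[OF AU.calg_tens_alg _ r _ _ x])
          (use s rmon[OF gens(1)] rmon[OF gens(2)] in \<open>simp_all add: qs_z_mon\<close>)
    qed (use s in \<open>simp_all add: r_def\<close>)
  qed
  with r rmon show "rho \<in> alg_hom A Z" "w \<in> words n \<Longrightarrow> rho (mon w) = tpure A OU1 (mon w) (U (deg w))"
    by simp_all
qed

lemma mon_homog: "w \<in> words n \<Longrightarrow> mon w \<in> homog A rho (deg w)"
  by (simp only: homog_def mem_Collect_eq mon_closed rho(2) simp_thms)

lemma gen_homog:
  "i \<in> {1..n} \<Longrightarrow> qs_z n q i \<in> homog A rho 1" "i \<in> {1..n} \<Longrightarrow> qs_zs n q i \<in> homog A rho (-1)"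
  using mon_homog[of "Word [Gen i]"] mon_homog[of "Word [GenStar i]"] by (simp_all add: qs_z_mon)

subsection \<open>Decompositions of the unit\<close>

lemma rel_I: "r \<in> sphere_rels n q \<Longrightarrow> r \<in> I"
  unfolding sphere_ideal_def using F.genideal_self[OF R_F] by blast

lemma cls_diff_eq: "x \<in> carrier F \<Longrightarrow> y \<in> carrier F \<Longrightarrow> x - y \<in> I \<Longrightarrow> cls x = cls y"
  unfolding cls_def using I.Q.coset_eq_iff[of x y] free_alg_minus[of x n y] by simp

lemma cls_mult_gen:
  "\<lbrakk>i \<in> {1..n}; j \<in> {1..n}\<rbrakk> \<Longrightarrow> cls (zf i * zsf j) = qs_z n q i \<otimes>\<^bsub>A\<^esub> qs_zs n q j"
  "\<lbrakk>i \<in> {1..n}; j \<in> {1..n}\<rbrakk> \<Longrightarrow> cls (zsf i * zf j) = qs_zs n q i \<otimes>\<^bsub>A\<^esub> qs_z n q j"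
  using alg_hom_mult[OF cls_hom zf_F(1)[of i] zf_F(2)[of j]] alg_hom_mult[OF cls_hom zf_F(2)[of i] zf_F(1)[of j]]
  by (simp_all add: qs_z_def qs_zs_def cls_def)

abbreviation "zzs \<equiv> {x \<otimes>\<^bsub>A\<^esub> y | x y. x \<in> qs_z n q ` {1..n} \<and> y \<in> qs_zs n q ` {1..n}}"
abbreviation "zsz \<equiv> {x \<otimes>\<^bsub>A\<^esub> y | x y. x \<in> qs_zs n q ` {1..n} \<and> y \<in> qs_z n q ` {1..n}}"

lemma gen_sum_F: "m \<le> n \<Longrightarrow> (\<Sum>j=1..m. zf j * zsf j) \<in> carrier F"
  by (intro sum_F F_closed zf_F) auto

lemma cls_sum: "cls (\<Sum>j=1..n. zf j * zsf j) = \<one>\<^bsub>A\<^esub>"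
proof -
  have "(\<Sum>j=1..n. zf j * zsf j) - 1 \<in> I" by (rule rel_I) (simp add: sphere_rels_def)
  then have "cls (\<Sum>j=1..n. zf j * zsf j) = cls 1"
    using gen_sum_F[of n] F_closed(4) by (intro cls_diff_eq) simp_all
  then show ?thesis using alg_hom_one[OF cls_hom] by simp
qed

lemma one_zzs: "\<one>\<^bsub>A\<^esub> \<in> lspan A zzs"
proof -
  let ?s = "\<lambda>m. \<Sum>j=1..m. zf j * zsf j"
  have "cls (?s m) \<in> lspan A zzs" if "m \<le> n" for m
    using that
  proof (induction m)
    case 0
    then show ?case
      using lin_zero[OF F.cvs_axioms A.cvs_axioms cls_lin] by (simp add: lspan.zero)
  next
    case (Suc m)
    have i: "Suc m \<in> {1..n}" using Suc.prems by simp
    have "cls (?s (Suc m)) = cls (?s m) \<oplus>\<^bsub>A\<^esub> cls (zf (Suc m) * zsf (Suc m))"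
      using lin_add[OF cls_lin gen_sum_F[of m], of "zf (Suc m) * zsf (Suc m)"] F_closed(1)[OF zf_F(1)[OF i] zf_F(2)[OF i]] Suc.prems
      by simp
    also have "\<dots> \<in> lspan A zzs"
    proof (rule lspan.add[OF Suc.IH lspan.incl])
      show "m \<le> n" using Suc.prems by simp
      show "cls (zf (Suc m) * zsf (Suc m)) \<in> zzs" using i cls_mult_gen(1)[OF i i] by blast
    qed
    finally show ?case .
  qed
  from this[of n] show ?thesis by (simp only: order.refl cls_sum)
qed

text \<open>The separate relation for k = 1 is the general one with an empty sum. Uniting them lets
  the induction on partial sums start at 0.\<close>

lemma commutator_I:
  assumes "k \<in> {1..n}"
  shows "(zsf k * zf k - zf k * zsf k) - fscale (of_real (1 - q\<^sup>2)) (\<Sum>j=1..k-1. zf j * zsf j) \<in> I"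
proof (cases "k = 1")
  case True
  have "zsf 1 * zf 1 - zf 1 * zsf 1 \<in> I"
    by (rule rel_I, unfold sphere_rels_def, rule UnI1, rule UnI1, rule UnI2, rule singletonI)
  moreover have "(\<Sum>j=1..k-1. zf j * zsf j) = 0" using True by simp
  ultimately show ?thesis by (simp only: True fvs.scale_zero_right diff_0_right)
next
  case False
  then have "1 < k" "k \<le> n" using assms by auto
  then have "(zsf k * zf k - zf k * zsf k) - fscale (of_real (1 - q\<^sup>2)) (\<Sum>j=1..k-1. zf j * zsf j)
      \<in> {(zsf k * zf k - zf k * zsf k)
        - fscale (of_real (1 - q\<^sup>2)) (\<Sum>j=1..k-1. zf j * zsf j) | k. 1 < k \<and> k \<le> n}"
    by blast
  then show ?thesis
    by (intro rel_I) (unfold sphere_rels_def, rule UnI1, rule UnI2)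
qed

text \<open>The partial sums \<open>s\<^sub>k\<close> of the \<open>z\<^sub>j z\<^sub>j\<^sup>*\<close> satisfy \<open>s\<^sub>k = q\<^sup>2 s\<^sub>k\<^sub>-\<^sub>1 + z\<^sub>k\<^sup>* z\<^sub>k\<close>.\<close>

lemma one_zsz: "\<one>\<^bsub>A\<^esub> \<in> lspan A zsz"
proof -
  let ?s = "\<lambda>m. \<Sum>j=1..m. zf j * zsf j"
  have "cls (?s m) \<in> lspan A zsz" if "m \<le> n" for m
    using that
  proof (induction m)
    case 0
    then show ?case
      using lin_zero[OF F.cvs_axioms A.cvs_axioms cls_lin] by (simp add: lspan.zero)
  next
    case (Suc m)
    have i: "Suc m \<in> {1..n}" using Suc.prems by simp
    let ?z = "zf (Suc m)" and ?zs = "zsf (Suc m)"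
    have zF: "?zs * ?z \<in> carrier F" "?z * ?zs \<in> carrier F"
      by (rule F_closed(1)[OF zf_F(2)[OF i] zf_F(1)[OF i]], rule F_closed(1)[OF zf_F(1)[OF i] zf_F(2)[OF i]])
    have mF: "?s m \<in> carrier F" "fscale (of_real (q\<^sup>2)) (?s m) \<in> carrier F"
      using gen_sum_F[of m] Suc.prems F_closed(3)[of "?s m" "of_real (q\<^sup>2)"] by simp_all
    have diff_id: "(a + b) - (s + c) = (b - c) - (s - a)" for a b c s :: "word \<Rightarrow>\<^sub>0 complex"
      by (simp add: algebra_simps)
    have s_Suc: "?s (Suc m) = ?s m + ?z * ?zs" by simp
    have "fscale (of_real (1 - q\<^sup>2)) (?s m) = ?s m - fscale (of_real (q\<^sup>2)) (?s m)"
      by (simp only: of_real_diff of_real_1 fvs.scale_left_diff_distrib fvs.scale_one)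
    \<comment> \<open>The two expressions for the partial sum up to m + 1 differ exactly by the
      commutator relation for k = m + 1, so they have the same class in A.\<close>
    then have "(fscale (of_real (q\<^sup>2)) (?s m) + ?zs * ?z) - ?s (Suc m)
        = (?zs * ?z - ?z * ?zs) - fscale (of_real (1 - q\<^sup>2)) (?s m)"
      by (simp only: s_Suc diff_id)
    also have "\<dots> \<in> I" using commutator_I[OF i] by (simp only: diff_Suc_1)
    finally have "cls (?s (Suc m)) = cls (fscale (of_real (q\<^sup>2)) (?s m) + ?zs * ?z)"
      using cls_diff_eq[of "fscale (of_real (q\<^sup>2)) (?s m) + ?zs * ?z" "?s (Suc m)"]
        F.a_closed[OF mF(2) zF(1)] gen_sum_F[OF Suc.prems] by simp
    also have "\<dots> = of_real (q\<^sup>2) \<odot>\<^bsub>A\<^esub> cls (?s m) \<oplus>\<^bsub>A\<^esub> cls (?zs * ?z)"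
      using lin_add[OF cls_lin mF(2) zF(1)] lin_smult[OF cls_lin mF(1), of "of_real (q\<^sup>2)"] by simp
    also have "\<dots> \<in> lspan A zsz"
    proof (rule lspan.add[OF lspan.smult[OF Suc.IH] lspan.incl])
      show "m \<le> n" using Suc.prems by simp
      show "cls (?zs * ?z) \<in> zsz" using i cls_mult_gen(2)[OF i i] by blast
    qed
    finally show ?case .
  qed
  from this[of n] show ?thesis by (simp only: order.refl cls_sum)
qed

lemma lspan_mono: "X \<subseteq> Y \<Longrightarrow> lspan M X \<subseteq> lspan M Y"
  by (rule lspan_subset) (auto intro: lspan.incl)

lemma strongly_graded: "strongly_graded A rho"
proof (intro strongly_graded.intro strongly_graded_axioms.intro calg_A rho(1))
  show "carrier A = lspan A (\<Union>k. homog A rho k)"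
  proof
    have "mon ` words n \<subseteq> (\<Union>k. homog A rho k)" using mon_homog by blast
    then show "carrier A \<subseteq> lspan A (\<Union>k. homog A rho k)" unfolding A_span by (rule lspan_mono)
    show "lspan A (\<Union>k. homog A rho k) \<subseteq> carrier A"
      using lspan_closed[OF A.cvs_axioms, of "\<Union>k. homog A rho k"] by (auto simp: homog_def)
  qed
  have "zzs \<subseteq> {x \<otimes>\<^bsub>A\<^esub> y |x y. x \<in> homog A rho 1 \<and> y \<in> homog A rho (- 1)}" using gen_homog by blast
  then show "\<one>\<^bsub>A\<^esub> \<in> lspan A {x \<otimes>\<^bsub>A\<^esub> y |x y. x \<in> homog A rho 1 \<and> y \<in> homog A rho (- 1)}"
    by (rule subsetD[OF lspan_mono one_zzs])
  have "zsz \<subseteq> {x \<otimes>\<^bsub>A\<^esub> y |x y. x \<in> homog A rho (-1) \<and> y \<in> homog A rho 1}" using gen_homog by blast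
  then show "\<one>\<^bsub>A\<^esub> \<in> lspan A {x \<otimes>\<^bsub>A\<^esub> y |x y. x \<in> homog A rho (- 1) \<and> y \<in> homog A rho 1}"
    by (rule subsetD[OF lspan_mono one_zsz])
qed


sublocale SG: strongly_graded A rho
  by (rule strongly_graded)

section \<open>Automorphisms rescaling the generators by powers of q\<close>

lemma theta_exists:
  "\<exists>f \<in> alg_hom A A. \<forall>w\<in>words n. f (mon w) = of_real (q powi wt c w) \<odot>\<^bsub>A\<^esub> mon w"
proof (rule weighted_hom[where g = "\<lambda>d x. of_real (q powi d) \<odot>\<^bsub>A\<^esub> x", OF calg_A])
  show "(\<lambda>x. of_real (q powi d) \<odot>\<^bsub>A\<^esub> x) \<in> lin A A" for d
    by (rule lin_smult_const[OF A.cvs_axioms lin_id])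
  show "of_real (q powi 0) \<odot>\<^bsub>A\<^esub> \<one>\<^bsub>A\<^esub> = \<one>\<^bsub>A\<^esub>" by simp
  fix d e x y assume xy: "x \<in> carrier A" "y \<in> carrier A"
  have "complex_of_real (q powi (d + e)) = of_real (q powi d) * of_real (q powi e)"
    using q by (simp add: power_int_add)
  then show "of_real (q powi (d + e)) \<odot>\<^bsub>A\<^esub> (x \<otimes>\<^bsub>A\<^esub> y) = of_real (q powi d) \<odot>\<^bsub>A\<^esub> x \<otimes>\<^bsub>A\<^esub> (of_real (q powi e) \<odot>\<^bsub>A\<^esub> y)"
    using xy A.smult_commute[OF A.m_closed[OF xy], of "of_real (q powi d)"]
    by (simp only: A.smult_assoc1 A.smult_assoc2 A.smult_assoc3 A.m_closed A.smult_closed)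
qed

definition theta :: "(nat \<Rightarrow> int) \<Rightarrow> (word \<Rightarrow>\<^sub>0 complex) set \<Rightarrow> (word \<Rightarrow>\<^sub>0 complex) set" where
  "theta c = (SOME f. f \<in> alg_hom A A \<and> (\<forall>w\<in>words n. f (mon w) = of_real (q powi wt c w) \<odot>\<^bsub>A\<^esub> mon w))"

lemma theta:
  "theta c \<in> alg_hom A A" "w \<in> words n \<Longrightarrow> theta c (mon w) = of_real (q powi wt c w) \<odot>\<^bsub>A\<^esub> mon w"
proof -
  have "theta c \<in> alg_hom A A \<and> (\<forall>w\<in>words n. theta c (mon w) = of_real (q powi wt c w) \<odot>\<^bsub>A\<^esub> mon w)"
    unfolding theta_def by (rule someI_ex[OF theta_exists[unfolded Bex_def]])
  then show "theta c \<in> alg_hom A A" "w \<in> words n \<Longrightarrow> theta c (mon w) = of_real (q powi wt c w) \<odot>\<^bsub>A\<^esub> mon w"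
    by blast+
qed

lemmas theta_lin = alg_hom_lin[OF theta(1)]

lemma mon_lin_eqI:
  assumes "cvs M" "f \<in> lin A M" "g \<in> lin A M" "\<And>w. w \<in> words n \<Longrightarrow> f (mon w) = g (mon w)" "x \<in> carrier A"
  shows "f x = g x"
proof (rule lin_eqI[OF A.cvs_axioms assms(1-3)])
  show "x \<in> lspan A (mon ` words n)" using assms(5) A_span by simp
  show "mon ` words n \<subseteq> carrier A" using mon_closed by blast
  show "f x = g x" if "x \<in> mon ` words n" for x using that assms(4) by blast
qed

lemma wt_uminus: "wt (\<lambda>i. - c i) w = - wt c w"
proof -
  have "sum_list (map (\<lambda>l. case l of Gen i \<Rightarrow> - c i | GenStar i \<Rightarrow> - (- c i)) ls)
      = - sum_list (map (\<lambda>l. case l of Gen i \<Rightarrow> c i | GenStar i \<Rightarrow> - c i) ls)" for ls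
    by (induction ls) (auto split: letter.split)
  then show ?thesis by (simp add: wt_def)
qed

lemma theta_inverse:
  assumes "x \<in> carrier A"
  shows "theta (\<lambda>i. - c i) (theta c x) = x"
proof (rule mon_lin_eqI[OF A.cvs_axioms lin_comp[OF theta_lin theta_lin] lin_id _ assms])
  fix w assume w: "w \<in> words n"
  have "theta (\<lambda>i. - c i) (theta c (mon w))
      = of_real (q powi wt c w) \<odot>\<^bsub>A\<^esub> (of_real (q powi (- wt c w)) \<odot>\<^bsub>A\<^esub> mon w)"
    by (simp only: theta(2)[OF w] lin_smult[OF theta_lin mon_closed[OF w]] wt_uminus)
  also have "\<dots> = (of_real (q powi wt c w) * of_real (q powi (- wt c w))) \<odot>\<^bsub>A\<^esub> mon w"
    by (rule A.smult_assoc1[OF mon_closed[OF w], symmetric])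
  also have "complex_of_real (q powi wt c w) * of_real (q powi (- wt c w)) = 1"
    using q by (simp add: power_int_minus flip: of_real_mult)
  finally show "theta (\<lambda>i. - c i) (theta c (mon w)) = mon w"
    using mon_closed[OF w] by simp
qed

text \<open>The components are defined through the coaction, so the point is that the coaction
  intertwines \<open>theta c\<close> with \<open>theta c\<close> \<otimes> id. On a monomial both
  sides multiply by the same scalar.\<close>

lemma theta_homog:
  assumes "a \<in> homog A rho k"
  shows "theta c a \<in> homog A rho k"
proof -
  let ?f = "\<lambda>x h. tpure A OU1 (theta c x) h"
  have a: "a \<in> carrier A" using assms by (rule SG.G_carrier)
  have bil: "bilin A OU1 (tens A OU1) ?f"
    by (intro bilinI tpure_lin1 tpure_lin2 A.cvs_axioms cvs_OU1 theta_lin lin_id lin_closed[OF theta_lin])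
  note cvsT = tens_cvs[OF A.cvs_axioms cvs_OU1]
  have sw: "sweedler (tens A OU1) ?f (tpure A OU1 x h) = ?f x h" if "x \<in> carrier A" for x h
    by (rule tens_sweedler_pure[OF A.cvs_axioms cvs_OU1 cvsT bil that]) simp
  have "rho (theta c a) = sweedler (tens A OU1) ?f (rho a)"
  proof (rule mon_lin_eqI[OF cvsT lin_comp[OF theta_lin SG.rho_lin] SG.rho_sweedler_lin[OF cvsT bil] _ a])
    fix w assume w: "w \<in> words n"
    have "rho (theta c (mon w)) = of_real (q powi wt c w) \<odot>\<^bsub>tens A OU1\<^esub> rho (mon w)"
      by (simp only: theta(2)[OF w] lin_smult[OF SG.rho_lin mon_closed[OF w]])
    also have "\<dots> = ?f (mon w) (U (deg w))"
      by (simp only: theta(2)[OF w] rho(2)[OF w] tpure_smult1[OF A.cvs_axioms cvs_OU1 mon_closed[OF w]] OU1_simps UNIV_I)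
    also have "\<dots> = sweedler (tens A OU1) ?f (rho (mon w))"
      unfolding rho(2)[OF w] by (rule sw[OF mon_closed[OF w], symmetric])
    finally show "rho (theta c (mon w)) = sweedler (tens A OU1) ?f (rho (mon w))" .
  qed
  also have "\<dots> = tpure A OU1 (theta c a) (U k)"
    unfolding SG.G_rho[OF assms] by (rule sw[OF a])
  finally show ?thesis using lin_closed[OF theta_lin a] by (rule SG.G_I[rotated])
qed

text \<open>The exponent is read off from the prescribed values. The image of V_ij has the legs z_j
  and \<theta> applied to z_i^*, and it has to be q^(j-i) W_ji, which is q^(2n-2i) times z_j
  \<otimes> z_i^*. So z_i^* is scaled by q^(2n-2i) and z_i by the inverse. For W_ij the factors
  q^(2n-i-j) and q^(2i-2n) then combine to the required q^(i-j).\<close>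

abbreviation "wtS \<equiv> \<lambda>i. 2 * int i - 2 * int n"

sublocale GA: graded_automorphism A rho "theta wtS" "theta (\<lambda>i. - wtS i)"
proof (intro graded_automorphism.intro graded_automorphism_axioms.intro strongly_graded theta(1) theta_homog theta_inverse)
  fix a assume "a \<in> carrier A"
  then show "theta wtS (theta (\<lambda>i. - wtS i) a) = a"
    using theta_inverse[of a "\<lambda>i. - wtS i"] by simp
qed

subsection \<open>Generators of the bialgebroid\<close>

abbreviation "C \<equiv> sphere_C n q"

lemma sphere_C_eq: "C = es_alg A OU1 rho"
  by (simp add: sphere_bialgebroid_def es_bialgebroid_def)

abbreviation star (infixl "\<star>" 72) where "x \<star> y \<equiv> tpure A A x y"

abbreviation "gens \<equiv> {ES_V n q i j | i j. i \<in> {1..n} \<and> j \<in> {1..n}} \<union> {ES_W n q i j | i j. i \<in> {1..n} \<and> j \<in> {1..n}}"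

abbreviation "K \<equiv> alg_span C gens"

lemma qs_closed: "i \<in> {1..n} \<Longrightarrow> qs_z n q i \<in> carrier A" "i \<in> {1..n} \<Longrightarrow> qs_zs n q i \<in> carrier A"
  using gen_homog SG.G_carrier by blast+

lemma ES_V_eq: "ES_V n q i j = qs_zs n q i \<star> qs_z n q j"
  by (simp add: ES_V_def)

lemma ES_W_eq: "ES_W n q i j = of_real (q powi (2 * int n - int i - int j)) \<odot>\<^bsub>SG.AA\<^esub> (qs_z n q i \<star> qs_zs n q j)"
  by (simp add: ES_W_def sphere_C_eq)

lemma smult_AA_cancel:
  assumes "P \<in> carrier SG.AA"
  shows "of_real (q powi d) \<odot>\<^bsub>SG.AA\<^esub> (of_real (q powi e) \<odot>\<^bsub>SG.AA\<^esub> P) = of_real (q powi (d + e)) \<odot>\<^bsub>SG.AA\<^esub> P"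
  using q cvs.smult_assoc1[OF SG.cvsAA assms, of "of_real (q powi d)" "of_real (q powi e)"]
  by (simp add: power_int_add)

lemma K_add: "x \<in> K \<Longrightarrow> y \<in> K \<Longrightarrow> x \<oplus>\<^bsub>SG.AA\<^esub> y \<in> K"
  and K_smult: "x \<in> K \<Longrightarrow> a \<odot>\<^bsub>SG.AA\<^esub> x \<in> K"
  and K_mult: "x \<in> K \<Longrightarrow> y \<in> K \<Longrightarrow> x \<otimes>\<^bsub>SG.E\<^esub> y \<in> K"
  and K_one: "\<one>\<^bsub>A\<^esub> \<star> \<one>\<^bsub>A\<^esub> \<in> K"
  using alg_span.add[of x C gens y] alg_span.smult[of x C gens a] alg_span.mult[of x C gens y] alg_span.one[of C gens]
  by (simp_all add: sphere_C_eq)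

lemma K_zero: "\<zero>\<^bsub>SG.AA\<^esub> \<in> K"
proof -
  have "\<one>\<^bsub>A\<^esub> \<star> \<one>\<^bsub>A\<^esub> \<in> carrier SG.AA" by simp
  then have "0 \<odot>\<^bsub>SG.AA\<^esub> (\<one>\<^bsub>A\<^esub> \<star> \<one>\<^bsub>A\<^esub>) = \<zero>\<^bsub>SG.AA\<^esub>"
    by (rule cvs.smult_zero_left[OF SG.cvsAA])
  then show ?thesis using K_smult[OF K_one, of 0] by simp
qed

lemma K_lspan: "X \<subseteq> K \<Longrightarrow> x \<in> lspan SG.AA X \<Longrightarrow> x \<in> K"
proof -
  assume X: "X \<subseteq> K" and "x \<in> lspan SG.AA X"
  from this(2) show "x \<in> K"
    by induction (use X K_zero K_add K_smult in blast)+
qed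

lemma K_gen:
  assumes "i \<in> {1..n}" "j \<in> {1..n}"
  shows "qs_zs n q i \<star> qs_z n q j \<in> K" "qs_z n q i \<star> qs_zs n q j \<in> K"
proof -
  show "qs_zs n q i \<star> qs_z n q j \<in> K"
    unfolding ES_V_eq[symmetric] using assms by (intro alg_span.incl) blast
  have c: "qs_z n q i \<star> qs_zs n q j \<in> carrier SG.AA"
    using assms qs_closed SG.star_closed by blast
  have "ES_W n q i j \<in> K" using assms by (intro alg_span.incl) blast
  \<comment> \<open>The power of q in the definition of W_ij is invertible, so it can be removed;
    the word arguments below work with unscaled pairs of letters.\<close>
  then have "of_real (q powi (- (2 * int n - int i - int j))) \<odot>\<^bsub>SG.AA\<^esub> ES_W n q i j \<in> K" by (rule K_smult)
  then show "qs_z n q i \<star> qs_zs n q j \<in> K"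
    unfolding ES_W_eq smult_AA_cancel[OF c] using cvs.smult_one[OF SG.cvsAA c] by simp
qed

lemma gens_C:
  assumes "i \<in> {1..n}" "j \<in> {1..n}"
  shows "qs_zs n q i \<star> qs_z n q j \<in> carrier C" "qs_z n q i \<star> qs_zs n q j \<in> carrier C"
  unfolding sphere_C_eq using assms gen_homog by (auto intro!: SG.homC_C' simp del: atLeastAtMost_iff)

lemma calg_sphere_C: "calg C"
  unfolding sphere_C_eq by (rule SG.calg_C)

lemma K_C: "K \<subseteq> carrier C"
proof
  interpret C: calg C by (rule calg_sphere_C)
  fix x assume "x \<in> K"
  then show "x \<in> carrier C"
  proof induction
    case (incl x)
    then consider i j where "x = ES_V n q i j" "i \<in> {1..n}" "j \<in> {1..n}"
      | i j where "x = ES_W n q i j" "i \<in> {1..n}" "j \<in> {1..n}" by blast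
    then show ?case
    proof cases
      case (1 i j)
      then show ?thesis using gens_C(1)[of i j] by (simp add: ES_V_eq)
    next
      case (2 i j)
      then show ?thesis using C.smult_closed[OF gens_C(2)[of i j]] by (simp add: ES_W_def)
    qed
  qed auto
qed

section \<open>Splitting pairs of words into generators\<close>

fun pos :: "letter \<Rightarrow> bool" where
  "pos (Gen i) = True" | "pos (GenStar i) = False"

abbreviation "mn ls \<equiv> mon (Word ls)"

lemma mn_append: "set u \<subseteq> alphabet n \<Longrightarrow> set v \<subseteq> alphabet n \<Longrightarrow> mn (u @ v) = mn u \<otimes>\<^bsub>A\<^esub> mn v"
  using mon_plus[of "Word u" "Word v"] by (simp add: plus_word_def)

lemma mn_Nil: "mn [] = \<one>\<^bsub>A\<^esub>"
  using mon_zero by (simp add: zero_word_def)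

lemma mn_closed: "set u \<subseteq> alphabet n \<Longrightarrow> mn u \<in> carrier A"
  by (rule mon_closed) simp

lemma K_letters:
  assumes "l \<in> alphabet n" "l' \<in> alphabet n" "pos l \<noteq> pos l'"
  shows "mn [l] \<star> mn [l'] \<in> K"
  using assms K_gen by (cases l; cases l') (auto simp: qs_z_mon simp del: atLeastAtMost_iff)

text \<open>Both decompositions of 1 in one statement: \<open>b\<close> selects whether the first
  letter is unstarred or starred, and the second letter has the other sign.\<close>

lemma one_letters:
  "\<one>\<^bsub>A\<^esub> \<in> lspan A {mn [l, l'] | l l'. l \<in> alphabet n \<and> l' \<in> alphabet n \<and> pos l = b \<and> pos l' \<noteq> b}"
    (is "_ \<in> lspan A ?X")
proof -
  have 2: "mn [l, l'] = mn [l] \<otimes>\<^bsub>A\<^esub> mn [l']" if "l \<in> alphabet n" "l' \<in> alphabet n" for l l'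
    using mn_append[of "[l]" "[l']"] that by simp
  show ?thesis
  proof (cases b)
    case True
    have "zzs \<subseteq> ?X"
    proof
      fix x assume "x \<in> zzs"
      then obtain i j where ij: "i \<in> {1..n}" "j \<in> {1..n}" "x = qs_z n q i \<otimes>\<^bsub>A\<^esub> qs_zs n q j" by blast
      have "x = mn [Gen i, GenStar j]" using ij 2[of "Gen i" "GenStar j"] by (simp add: qs_z_mon)
      moreover have "Gen i \<in> alphabet n" "GenStar j \<in> alphabet n" using ij by blast+
      ultimately show "x \<in> ?X" using True pos.simps by blast
    qed
    then show ?thesis by (rule subsetD[OF lspan_mono one_zzs])
  next
    case False
    have "zsz \<subseteq> ?X"
    proof
      fix x assume "x \<in> zsz"
      then obtain i j where ij: "i \<in> {1..n}" "j \<in> {1..n}" "x = qs_zs n q i \<otimes>\<^bsub>A\<^esub> qs_z n q j" by blast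
      have "x = mn [GenStar i, Gen j]" using ij 2[of "GenStar i" "Gen j"] by (simp add: qs_z_mon)
      moreover have "GenStar i \<in> alphabet n" "Gen j \<in> alphabet n" using ij by blast+
      ultimately show "x \<in> ?X" using False pos.simps by blast
    qed
    then show ?thesis by (rule subsetD[OF lspan_mono one_zsz])
  qed
qed

text \<open>\<open>L\<close> is an expression with a slot occupied by 1. Filling the slot with
  two-letter words, with the order of signs chosen to suit the neighbouring words, lengthens the
  words without changing the element.\<close>

lemma insert_one:
  assumes L: "L \<in> lin A SG.AA"
    and "\<And>l l'. \<lbrakk>l \<in> alphabet n; l' \<in> alphabet n; pos l = b; pos l' \<noteq> b\<rbrakk> \<Longrightarrow> L (mn [l, l']) \<in> K"
  shows "L \<one>\<^bsub>A\<^esub> \<in> K"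
proof (rule K_lspan)
  let ?X = "{mn [l, l'] | l l'. l \<in> alphabet n \<and> l' \<in> alphabet n \<and> pos l = b \<and> pos l' \<noteq> b}"
  have "?X \<subseteq> carrier A"
  proof
    fix x assume "x \<in> ?X"
    then obtain l l' where "x = mn [l, l']" "l \<in> alphabet n" "l' \<in> alphabet n" by blast
    then show "x \<in> carrier A" using mn_closed[of "[l, l']"] by simp
  qed
  then show "L \<one>\<^bsub>A\<^esub> \<in> lspan SG.AA (L ` ?X)"
    by (rule lin_image_lspan[OF A.cvs_axioms SG.cvsAA L _ one_letters])
  show "L ` ?X \<subseteq> K" using assms(2) by blast
qed

lemma deg_Cons: "deg (Word (l # ls)) = (if pos l then 1 else -1) + deg (Word ls)"
  by (cases l) (simp_all add: wt_def)

lemma deg_append: "deg (Word (u @ v)) = deg (Word u) + deg (Word v)"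
  by (simp add: wt_def)

lemma deg_mono: "\<forall>l\<in>set w. pos l = b \<Longrightarrow> deg (Word w) = (if b then int (length w) else - int (length w))"
  by (induction w) (auto simp: deg_Cons)

text \<open>The product of A \<otimes> A^op nests its factors: u goes to the far left of the first
  leg and u' to the far right of the second. A generator can thus be split off at the outer ends of
  a pair of words.\<close>

lemma K_pair_mult:
  assumes "set u \<subseteq> alphabet n" "set u' \<subseteq> alphabet n" "set v \<subseteq> alphabet n" "set v' \<subseteq> alphabet n"
    and "mn u \<star> mn u' \<in> K" "mn v \<star> mn v' \<in> K"
  shows "mn (u @ v) \<star> mn (v' @ u') \<in> K"
  using K_mult[OF assms(5,6)] assms(1-4) by (simp add: SG.E_mult mn_append mn_closed)

text \<open>Remove the last letter l of w' in each step. If w begins with a letter of the opposite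
  sign, the two form a generator and split off. Otherwise all letters of w have the sign of l;
  inserting 1 = \<Sum> x y in front of w, with x of sign opposite to l, lets x and l split off. The
  rest y w again has letters of one sign only, which keeps the induction going although the first
  word has grown.\<close>

lemma K_mono_words:
  assumes "set w' \<subseteq> alphabet n" "set w \<subseteq> alphabet n" "\<forall>l\<in>set w. pos l = b" "deg (Word w) + deg (Word w') = 0"
  shows "mn w \<star> mn w' \<in> K"
  using assms
proof (induction w' arbitrary: w b rule: rev_induct)
  case Nil
  then have "deg (Word w) = 0" by simp
  then have "w = []" using deg_mono[OF Nil.prems(3)] by (simp split: if_splits)
  then show ?case unfolding mn_Nil by (simp only: mn_Nil K_one)
next
  case (snoc l w1)
  have l: "l \<in> alphabet n" and w1: "set w1 \<subseteq> alphabet n" using snoc.prems(1) by simp_all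
  have dg: "deg (Word w) + (deg (Word w1) + (if pos l then 1 else -1)) = 0"
    using snoc.prems(4) deg_append[of w1 "[l]"] deg_Cons[of l "[]"] by simp
  show ?case
  proof (cases "\<exists>l0 w0. w = l0 # w0 \<and> pos l0 \<noteq> pos l")
    case True
    then obtain l0 w0 where w: "w = l0 # w0" "pos l0 \<noteq> pos l" by blast
    have "mn w0 \<star> mn w1 \<in> K"
      by (rule snoc.IH[OF w1, of _ b]) (use snoc.prems w dg in \<open>auto simp: deg_Cons split: if_splits\<close>)
    then have "mn ([l0] @ w0) \<star> mn (w1 @ [l]) \<in> K"
      using snoc.prems(2) w l w1 by (intro K_pair_mult K_letters) auto
    then show ?thesis by (simp add: w(1))
  next
    case False
    have same: "\<forall>l'\<in>set w. pos l' = pos l"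
      using False snoc.prems(3) by (cases w) auto
    have wA: "mn w \<in> carrier A" "mn (w1 @ [l]) \<in> carrier A"
      using snoc.prems(1,2) mn_closed by blast+
    have "(\<lambda>t. (t \<otimes>\<^bsub>A\<^esub> mn w) \<star> mn (w1 @ [l])) \<in> lin A SG.AA"
      by (intro SG.star_lin1 mult_lin1 lin_id calg_A wA)
    then have "(\<one>\<^bsub>A\<^esub> \<otimes>\<^bsub>A\<^esub> mn w) \<star> mn (w1 @ [l]) \<in> K"
    proof (rule insert_one[where b = "\<not> pos l"])
      fix x y assume xy: "x \<in> alphabet n" "y \<in> alphabet n" "pos x = (\<not> pos l)" "pos y \<noteq> (\<not> pos l)"
      have "mn (y # w) \<star> mn w1 \<in> K"
        by (rule snoc.IH[OF w1, of _ "pos l"]) (use snoc.prems same dg xy in \<open>auto simp: deg_Cons split: if_splits\<close>)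
      then have "mn ([x] @ (y # w)) \<star> mn (w1 @ [l]) \<in> K"
        using snoc.prems(2) xy l w1 by (intro K_pair_mult K_letters) auto
      moreover have "mn ([x] @ (y # w)) = mn [x, y] \<otimes>\<^bsub>A\<^esub> mn w"
        using mn_append[of "[x, y]" w] snoc.prems(2) xy by simp
      ultimately show "(mn [x, y] \<otimes>\<^bsub>A\<^esub> mn w) \<star> mn (w1 @ [l]) \<in> K" by simp
    qed
    then show ?thesis using wA by simp
  qed
qed

text \<open>The first letter l of w is paired with a letter created for it: appending 1 = \<Sum> y x
  to w', with x of sign opposite to l, lets l and x split off. What remains is a shorter first word
  and the second word w' y. When w is used up, \<open>K_mono_words\<close> applies to the empty
  word.\<close>

lemma K_words:
  assumes "set w \<subseteq> alphabet n" "set w' \<subseteq> alphabet n" "deg (Word w) + deg (Word w') = 0"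
  shows "mn w \<star> mn w' \<in> K"
  using assms
proof (induction w arbitrary: w')
  case Nil
  then show ?case by (intro K_mono_words[of _ _ True]) auto
next
  case (Cons l w)
  have l: "l \<in> alphabet n" and w: "set w \<subseteq> alphabet n" using Cons.prems(1) by simp_all
  have wA: "mn (l # w) \<in> carrier A" "mn w' \<in> carrier A"
    using Cons.prems(1,2) mn_closed by blast+
  have "(\<lambda>t. mn (l # w) \<star> (mn w' \<otimes>\<^bsub>A\<^esub> t)) \<in> lin A SG.AA"
    by (intro SG.star_lin2 mult_lin2 lin_id calg_A wA)
  then have "mn (l # w) \<star> (mn w' \<otimes>\<^bsub>A\<^esub> \<one>\<^bsub>A\<^esub>) \<in> K"
  proof (rule insert_one[where b = "pos l"])
    fix y x assume xy: "y \<in> alphabet n" "x \<in> alphabet n" "pos y = pos l" "pos x \<noteq> pos l"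
    have "mn w \<star> mn (w' @ [y]) \<in> K"
      by (rule Cons.IH[OF w])
        (use Cons.prems xy deg_append[of w' "[y]"] deg_Cons[of y "[]"] in \<open>auto simp: deg_Cons split: if_splits\<close>)
    then have "mn ([l] @ w) \<star> mn ((w' @ [y]) @ [x]) \<in> K"
      using Cons.prems(2) xy l w by (intro K_pair_mult K_letters) auto
    moreover have "mn ((w' @ [y]) @ [x]) = mn w' \<otimes>\<^bsub>A\<^esub> mn [y, x]"
      using mn_append[of w' "[y, x]"] Cons.prems(2) xy by simp
    ultimately show "mn (l # w) \<star> (mn w' \<otimes>\<^bsub>A\<^esub> mn [y, x]) \<in> K" by simp
  qed
  then show ?case using wA by simp
qed

text \<open>With the monomials of degree k as spanning set of each component,
  \<open>carrier_C_span\<close> shows that C is spanned by pairs of words of opposite degree, and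
  these are covered by \<open>K_words\<close>.\<close>

lemma alg_span_gens: "K = carrier C"
proof
  show "K \<subseteq> carrier C" by (rule K_C)
  show "carrier C \<subseteq> K"
  proof
    fix P assume P: "P \<in> carrier C"
    let ?X = "\<lambda>k. mon ` {w \<in> words n. deg w = k}"
    have X: "?X k \<subseteq> homog A rho k" for k using mon_homog by blast
    have "(\<Union>k. ?X k) = mon ` words n" by blast
    then have "carrier A = lspan A (\<Union>k. ?X k)" using A_span by simp
    from SG.carrier_C_span[OF X this]
    have "P \<in> lspan SG.AA {a \<star> a' | a a'. \<exists>k. a \<in> ?X k \<and> a' \<in> ?X (-k)}"
      using P unfolding sphere_C_eq by blast
    moreover have "{a \<star> a' | a a'. \<exists>k. a \<in> ?X k \<and> a' \<in> ?X (-k)} \<subseteq> K"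
    proof
      fix x assume "x \<in> {a \<star> a' | a a'. \<exists>k. a \<in> ?X k \<and> a' \<in> ?X (-k)}"
      then obtain u v where uv: "x = mon u \<star> mon v" "u \<in> words n" "v \<in> words n" "deg u = - deg v"
        by auto
      then show "x \<in> K"
        using K_words[of "letters u" "letters v"] by simp
    qed
    ultimately show "P \<in> K" by (rule K_lspan[rotated])
  qed
qed

lemma theta_gens:
  assumes "i \<in> {1..n}"
  shows "theta c (qs_z n q i) = of_real (q powi c i) \<odot>\<^bsub>A\<^esub> qs_z n q i"
    "theta c (qs_zs n q i) = of_real (q powi (- c i)) \<odot>\<^bsub>A\<^esub> qs_zs n q i"
  using theta(2)[of "Word [Gen i]" c] theta(2)[of "Word [GenStar i]" c] assms
  by (simp_all add: qs_z_mon)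

text \<open>\<open>S\<close> puts the scalar of the automorphism on the second leg and
  \<open>T\<close> the inverse scalar on the first. This exchanges the roles of i and j in the
  exponents, for instance q^(2n-2i) for \<open>S\<close> against q^(2n-2j) for \<open>T\<close> on
  V_ij.\<close>

lemma S_gens:
  assumes "i \<in> {1..n}" "j \<in> {1..n}"
  shows "GA.S (ES_V n q i j) = of_real (q powi (int j - int i)) \<odot>\<^bsub>SG.AA\<^esub> ES_W n q j i"
    "GA.S (ES_W n q i j) = of_real (q powi (int i - int j)) \<odot>\<^bsub>SG.AA\<^esub> ES_V n q j i"
    "GA.T (ES_V n q i j) = of_real (q powi (int i - int j)) \<odot>\<^bsub>SG.AA\<^esub> ES_W n q j i"
    "GA.T (ES_W n q i j) = of_real (q powi (int j - int i)) \<odot>\<^bsub>SG.AA\<^esub> ES_V n q j i"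
proof -
  note cl = qs_closed[OF assms(1)] qs_closed[OF assms(2)]
  note sm2 = tpure_smult2[OF A.cvs_axioms A.cvs_axioms] and sm1 = tpure_smult1[OF A.cvs_axioms A.cvs_axioms]
  note th = theta_gens[OF assms(1)] theta_gens[OF assms(2)]
  have c: "qs_z n q i \<star> qs_zs n q j \<in> carrier SG.AA" "qs_z n q j \<star> qs_zs n q i \<in> carrier SG.AA"
    "qs_zs n q i \<star> qs_z n q j \<in> carrier SG.AA" "qs_zs n q j \<star> qs_z n q i \<in> carrier SG.AA"
    using cl by simp_all
  show "GA.S (ES_V n q i j) = of_real (q powi (int j - int i)) \<odot>\<^bsub>SG.AA\<^esub> ES_W n q j i"
    unfolding ES_V_eq ES_W_eq GA.S_pure[OF cl(2,3)] th sm2[OF cl(3,2)] smult_AA_cancel[OF c(2)]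
    by (simp add: algebra_simps)
  show "GA.S (ES_W n q i j) = of_real (q powi (int i - int j)) \<odot>\<^bsub>SG.AA\<^esub> ES_V n q j i"
    unfolding ES_V_eq ES_W_eq lin_smult[OF GA.S_lin c(1)] GA.S_pure[OF cl(1,4)] th sm2[OF cl(4,1)] smult_AA_cancel[OF c(4)]
    by (simp add: algebra_simps)
  show "GA.T (ES_V n q i j) = of_real (q powi (int i - int j)) \<odot>\<^bsub>SG.AA\<^esub> ES_W n q j i"
    unfolding ES_V_eq ES_W_eq GA.T_pure[OF cl(2,3)] th sm1[OF cl(3,2)] smult_AA_cancel[OF c(2)]
    by (simp add: algebra_simps)
  show "GA.T (ES_W n q i j) = of_real (q powi (int j - int i)) \<odot>\<^bsub>SG.AA\<^esub> ES_V n q j i"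
    unfolding ES_V_eq ES_W_eq lin_smult[OF GA.T_lin c(1)] GA.T_pure[OF cl(1,4)] th sm1[OF cl(4,1)] smult_AA_cancel[OF c(4)]
    by (simp add: algebra_simps)
qed

lemma sphere_antipode:
  "alg_span C gens = carrier C \<and> (\<exists>S \<in> anti_alg_hom C C.
     (\<forall>i\<in>{1..n}. \<forall>j\<in>{1..n}.
        S (ES_V n q i j) = of_real (q powi (int j - int i)) \<odot>\<^bsub>C\<^esub> ES_W n q j i \<and>
        S (ES_W n q i j) = of_real (q powi (int i - int j)) \<odot>\<^bsub>C\<^esub> ES_V n q j i)
   \<and> is_antipode (sphere_bialgebroid n q) S
   \<and> (\<forall>i\<in>{1..n}. \<forall>j\<in>{1..n}.
        inv_into (carrier C) S (ES_V n q i j) = of_real (q powi (int i - int j)) \<odot>\<^bsub>C\<^esub> ES_W n q j i \<and>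
        inv_into (carrier C) S (ES_W n q i j) = of_real (q powi (int j - int i)) \<odot>\<^bsub>C\<^esub> ES_V n q j i))"
proof (intro conjI alg_span_gens bexI[of _ GA.S])
  show "GA.S \<in> anti_alg_hom C C" unfolding sphere_C_eq by (rule GA.S_anti_hom)
  show "is_antipode (sphere_bialgebroid n q) GA.S"
    unfolding sphere_bialgebroid_def by (rule GA.is_antipode_S)
  have smult_C: "smult C = smult SG.AA" by (simp add: sphere_C_eq)
  have in_C: "ES_V n q i j \<in> carrier C" "ES_W n q i j \<in> carrier C" if "i \<in> {1..n}" "j \<in> {1..n}" for i j
    unfolding alg_span_gens[symmetric] using that by (intro alg_span.incl; blast)+
  show "\<forall>i\<in>{1..n}. \<forall>j\<in>{1..n}.
        GA.S (ES_V n q i j) = of_real (q powi (int j - int i)) \<odot>\<^bsub>C\<^esub> ES_W n q j i \<and>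
        GA.S (ES_W n q i j) = of_real (q powi (int i - int j)) \<odot>\<^bsub>C\<^esub> ES_V n q j i"
    unfolding smult_C using S_gens by blast
  show "\<forall>i\<in>{1..n}. \<forall>j\<in>{1..n}.
        inv_into (carrier C) GA.S (ES_V n q i j) = of_real (q powi (int i - int j)) \<odot>\<^bsub>C\<^esub> ES_W n q j i \<and>
        inv_into (carrier C) GA.S (ES_W n q i j) = of_real (q powi (int j - int i)) \<odot>\<^bsub>C\<^esub> ES_V n q j i"
    unfolding smult_C using S_gens(3,4) in_C GA.inv_S[folded sphere_C_eq] by simp
qed

end

theorem proposition4p1:
  fixes n :: nat and q :: real
  assumes "1 \<le> n" and "0 < q" and "q < 1"
  shows "alg_span (sphere_C n q)
           ({ES_V n q i j | i j. i \<in> {1..n} \<and> j \<in> {1..n}} \<union> {ES_W n q i j | i j. i \<in> {1..n} \<and> j \<in> {1..n}})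
         = carrier (sphere_C n q)
       \<and> (\<exists>S \<in> anti_alg_hom (sphere_C n q) (sphere_C n q).
           (\<forall>i\<in>{1..n}. \<forall>j\<in>{1..n}.
              S (ES_V n q i j) = complex_of_real (q powi (int j - int i)) \<odot>\<^bsub>sphere_C n q\<^esub> ES_W n q j i \<and>
              S (ES_W n q i j) = complex_of_real (q powi (int i - int j)) \<odot>\<^bsub>sphere_C n q\<^esub> ES_V n q j i)
         \<and> is_antipode (sphere_bialgebroid n q) S
         \<and> (\<forall>i\<in>{1..n}. \<forall>j\<in>{1..n}.
              inv_into (carrier (sphere_C n q)) S (ES_V n q i j)
                = complex_of_real (q powi (int i - int j)) \<odot>\<^bsub>sphere_C n q\<^esub> ES_W n q j i \<and>
              inv_into (carrier (sphere_C n q)) S (ES_W n q i j)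
                = complex_of_real (q powi (int j - int i)) \<odot>\<^bsub>sphere_C n q\<^esub> ES_V n q j i))"
proof -
  interpret sphere n q
    using assms(1,2) by unfold_locales
  show ?thesis by (rule sphere_antipode)
qed

end
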